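(* Suppose that a connected Riemannian manifold $(M,g)$ supports a one-form $\alpha$ such that the holonomy group of $\nabla^\alpha$ is compact. Then: (1) If $g(R^{\nabla^\alpha}(X,Y)Y,X)>0$ for all orthonormal pairs $X,Y$ (with respect to $g$), then there is a Riemannian metric $\widetilde g$ on $M$ with $\mathrm{sec}_{\widetilde g}>0$. (2) If $\mathrm{Ric}^{\nabla^\alpha}>0$, then there is a Riemannian metric $\widetilde g$ on $M$ with $\mathrm{Ric}_{\widetilde g}>0$. Both parts also hold with "positive" replaced (in both hypothesis and conclusion) by non-negative, negative, or non-positive.
   Context: With $\nabla$ the Levi-Civita connection of $g$, $\nabla^\alpha_UV=\nabla_UV-\alpha(U)V-\alpha(V)U$. The holonomy group of $\nabla^\alpha$ at $p$ is the group of linear maps of $T_pM$ given by $\nabla^\alpha$-parallel translation around piecewise $C^1$ loops based at $p$. For a connection $\widetilde\nabla$, $R^{\widetilde\nabla}(X,Y)Z=\widetilde\nabla_X\widetilde\nabla_YZ-\widetilde\nabla_Y\widetilde\nabla_XZ-\widetilde\nabla_{[X,Y]}Z$ and $\mathrm{Ric}^{\widetilde\nabla}(Y,Z)=\mathrm{Tr}[X\mapsto R^{\widetilde\nabla}(X,Y)Z]$. *)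

theory Defs
  imports "HOL-Analysis.Analysis"
begin

section \<open>Smooth maps between Euclidean spaces\<close>

text \<open>Both notions are only used on open sets.\<close>

fun Ck_on :: "nat \<Rightarrow> 'a::euclidean_space set \<Rightarrow> ('a \<Rightarrow> 'b::real_normed_vector) \<Rightarrow> bool" where
  "Ck_on 0 S f \<longleftrightarrow> continuous_on S f"
| "Ck_on (Suc k) S f \<longleftrightarrow>
     (\<forall>x\<in>S. f differentiable (at x)) \<and>
     (\<forall>v. Ck_on k S (\<lambda>x. frechet_derivative f (at x) v))"

definition Cinf_on :: "'a::euclidean_space set \<Rightarrow> ('a \<Rightarrow> 'b::real_normed_vector) \<Rightarrow> bool" where
  "Cinf_on S f \<longleftrightarrow> (\<forall>k. Ck_on k S f)"


section \<open>Smooth manifolds\<close>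

text \<open>The points of the manifold are the elements of a type \<open>'m\<close>; that the space is Hausdorff and
  second countable is expressed by the type classes \<open>t2_space\<close> and \<open>second_countable_topology\<close>.
  A chart is a pair of its domain and its coordinate map; the coordinate map is irrelevant outside
  the domain. The dimension of the manifold is \<open>CARD('n)\<close>.\<close>

type_synonym ('m, 'n) chart = "'m set \<times> ('m \<Rightarrow> real^'n)"

abbreviation cdom :: "('m, 'n) chart \<Rightarrow> 'm set" where
  "cdom c \<equiv> fst c"

abbreviation cmap :: "('m, 'n) chart \<Rightarrow> 'm \<Rightarrow> real^'n" where
  "cmap c \<equiv> snd c"

definition cinv :: "('m, 'n) chart \<Rightarrow> real^'n \<Rightarrow> 'm" where
  "cinv c = inv_into (cdom c) (cmap c)"

definition smooth_atlas :: "('m::topological_space, 'n::finite) chart set \<Rightarrow> bool" where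
  "smooth_atlas A \<longleftrightarrow>
     (\<Union>c\<in>A. cdom c) = UNIV \<and>
     (\<forall>c\<in>A. open (cdom c) \<and> open (cmap c ` cdom c) \<and>
        homeomorphism (cdom c) (cmap c ` cdom c) (cmap c) (cinv c)) \<and>
     (\<forall>c\<in>A. \<forall>d\<in>A. Cinf_on (cmap c ` (cdom c \<inter> cdom d)) (\<lambda>x. cmap d (cinv c x)))"

definition charts_at :: "('m, 'n) chart set \<Rightarrow> 'm \<Rightarrow> ('m, 'n) chart set" where
  "charts_at A p = {c \<in> A. p \<in> cdom c}"

text \<open>An arbitrary chart around a point; everything defined with it below is chart independent.\<close>

definition chart_at :: "('m, 'n) chart set \<Rightarrow> 'm \<Rightarrow> ('m, 'n) chart" where
  "chart_at A p = (SOME c. c \<in> charts_at A p)"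

definition smooth_fun ::
    "('m::topological_space, 'n::finite) chart set \<Rightarrow> 'm set \<Rightarrow> ('m \<Rightarrow> real) \<Rightarrow> bool" where
  "smooth_fun A U f \<longleftrightarrow> (\<forall>c\<in>A. Cinf_on (cmap c ` (U \<inter> cdom c)) (\<lambda>x. f (cinv c x)))"


section \<open>Tangent vectors and vector fields\<close>

text \<open>A tangent vector at \<open>p\<close> assigns to every chart around \<open>p\<close> a coordinate vector, such that the
  coordinate vectors transform by the derivatives of the coordinate changes. It is normalised to
  vanish on the other charts, so that equality of tangent vectors is equality of functions.\<close>

type_synonym ('m, 'n) tvec = "('m, 'n) chart \<Rightarrow> real^'n"

type_synonym ('m, 'n) vfield = "'m \<Rightarrow> ('m, 'n) tvec"

definition trans_deriv ::
    "('m, 'n::finite) chart \<Rightarrow> ('m, 'n) chart \<Rightarrow> 'm \<Rightarrow> real^'n \<Rightarrow> real^'n" where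
  "trans_deriv c d p = frechet_derivative (\<lambda>x. cmap d (cinv c x)) (at (cmap c p))"

definition tangent_space :: "('m, 'n::finite) chart set \<Rightarrow> 'm \<Rightarrow> ('m, 'n) tvec set" where
  "tangent_space A p =
     {v. (\<forall>c. c \<notin> charts_at A p \<longrightarrow> v c = 0) \<and>
         (\<forall>c\<in>charts_at A p. \<forall>d\<in>charts_at A p. v d = trans_deriv c d p (v c))}"

definition tzero :: "('m, 'n::finite) tvec" where
  "tzero = (\<lambda>c. 0)"

definition tadd :: "('m, 'n::finite) tvec \<Rightarrow> ('m, 'n) tvec \<Rightarrow> ('m, 'n) tvec" where
  "tadd v w = (\<lambda>c. v c + w c)"

definition tdiff :: "('m, 'n::finite) tvec \<Rightarrow> ('m, 'n) tvec \<Rightarrow> ('m, 'n) tvec" where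
  "tdiff v w = (\<lambda>c. v c - w c)"

definition tscale :: "real \<Rightarrow> ('m, 'n::finite) tvec \<Rightarrow> ('m, 'n) tvec" where
  "tscale r v = (\<lambda>c. r *\<^sub>R v c)"

text \<open>The tangent vector at \<open>p\<close> with coordinates \<open>\<xi>\<close> in the chart \<open>c\<close>.\<close>

definition coord_vec ::
    "('m, 'n::finite) chart set \<Rightarrow> ('m, 'n) chart \<Rightarrow> 'm \<Rightarrow> real^'n \<Rightarrow> ('m, 'n) tvec" where
  "coord_vec A c p \<xi> = (\<lambda>d. if d \<in> charts_at A p then trans_deriv c d p \<xi> else 0)"

text \<open>The vector field on the domain of \<open>c\<close> with constant coordinates \<open>\<xi>\<close> in the chart \<open>c\<close>, that is
  \<open>\<Sum>i. \<xi>\<^sub>i \<partial>\<^sub>i\<close>.\<close>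

definition coord_field ::
    "('m, 'n::finite) chart set \<Rightarrow> ('m, 'n) chart \<Rightarrow> real^'n \<Rightarrow> ('m, 'n) vfield" where
  "coord_field A c \<xi> = (\<lambda>p. coord_vec A c p \<xi>)"

definition smooth_vfield ::
    "('m::topological_space, 'n::finite) chart set \<Rightarrow> 'm set \<Rightarrow> ('m, 'n) vfield \<Rightarrow> bool" where
  "smooth_vfield A U X \<longleftrightarrow>
     (\<forall>p\<in>U. X p \<in> tangent_space A p) \<and>
     (\<forall>c\<in>A. Cinf_on (cmap c ` (U \<inter> cdom c)) (\<lambda>x. X (cinv c x) c))"

text \<open>The derivative of a function \<open>f\<close> in the direction of a tangent vector \<open>v\<close> at \<open>p\<close>.\<close>

definition dir_deriv ::
    "('m, 'n::finite) chart set \<Rightarrow> 'm \<Rightarrow> ('m, 'n) tvec \<Rightarrow> ('m \<Rightarrow> 'b::real_normed_vector) \<Rightarrow> 'b" where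
  "dir_deriv A p v f =
     (let c = chart_at A p in frechet_derivative (\<lambda>x. f (cinv c x)) (at (cmap c p)) (v c))"

text \<open>In every chart \<open>[X,Y]\<^sup>k = X(Y\<^sup>k) - Y(X\<^sup>k)\<close>.\<close>

definition lie_bracket ::
    "('m, 'n::finite) chart set \<Rightarrow> ('m, 'n) vfield \<Rightarrow> ('m, 'n) vfield \<Rightarrow> ('m, 'n) vfield" where
  "lie_bracket A X Y = (\<lambda>p c.
     if c \<in> charts_at A p
     then dir_deriv A p (X p) (\<lambda>q. Y q c) - dir_deriv A p (Y p) (\<lambda>q. X q c) else 0)"


section \<open>Riemannian metrics, one-forms, connections\<close>

type_synonym ('m, 'n) metric = "'m \<Rightarrow> ('m, 'n) tvec \<Rightarrow> ('m, 'n) tvec \<Rightarrow> real"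

type_synonym ('m, 'n) form = "'m \<Rightarrow> ('m, 'n) tvec \<Rightarrow> real"

definition riemannian_metric ::
    "('m::topological_space, 'n::finite) chart set \<Rightarrow> ('m, 'n) metric \<Rightarrow> bool" where
  "riemannian_metric A g \<longleftrightarrow>
     (\<forall>p. \<forall>u\<in>tangent_space A p. \<forall>v\<in>tangent_space A p. \<forall>w\<in>tangent_space A p. \<forall>r.
        g p (tadd u v) w = g p u w + g p v w \<and>
        g p (tscale r v) w = r * g p v w \<and>
        g p v w = g p w v \<and>
        (v \<noteq> tzero \<longrightarrow> 0 < g p v v)) \<and>
     (\<forall>U X Y. open U \<and> smooth_vfield A U X \<and> smooth_vfield A U Y \<longrightarrow>
        smooth_fun A U (\<lambda>p. g p (X p) (Y p)))"

definition one_form ::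
    "('m::topological_space, 'n::finite) chart set \<Rightarrow> ('m, 'n) form \<Rightarrow> bool" where
  "one_form A \<alpha> \<longleftrightarrow>
     (\<forall>p. \<forall>v\<in>tangent_space A p. \<forall>w\<in>tangent_space A p. \<forall>r.
        \<alpha> p (tadd v w) = \<alpha> p v + \<alpha> p w \<and> \<alpha> p (tscale r v) = r * \<alpha> p v) \<and>
     (\<forall>U X. open U \<and> smooth_vfield A U X \<longrightarrow> smooth_fun A U (\<lambda>p. \<alpha> p (X p)))"

text \<open>For a connection \<open>D\<close>, the value \<open>D p v Y\<close> is the covariant derivative at \<open>p\<close> in direction \<open>v\<close>
  of a vector field \<open>Y\<close> that is defined and smooth near \<open>p\<close>. Values for other arguments are
  irrelevant. Connections act on locally defined fields, and compatibly with restriction, so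
  that they can be applied to coordinate vector fields.\<close>

type_synonym ('m, 'n) connection = "'m \<Rightarrow> ('m, 'n) tvec \<Rightarrow> ('m, 'n) vfield \<Rightarrow> ('m, 'n) tvec"

definition affine_connection ::
    "('m::topological_space, 'n::finite) chart set \<Rightarrow> ('m, 'n) connection \<Rightarrow> bool" where
  "affine_connection A D \<longleftrightarrow>
     (\<forall>U Y. open U \<and> smooth_vfield A U Y \<longrightarrow>
        (\<forall>p\<in>U. \<forall>v\<in>tangent_space A p.
           D p v Y \<in> tangent_space A p \<and>
           (\<forall>w\<in>tangent_space A p. D p (tadd v w) Y = tadd (D p v Y) (D p w Y)) \<and>
           (\<forall>r. D p (tscale r v) Y = tscale r (D p v Y)) \<and>
           (\<forall>Z. smooth_vfield A U Z \<longrightarrow>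
              D p v (\<lambda>q. tadd (Y q) (Z q)) = tadd (D p v Y) (D p v Z)) \<and>
           (\<forall>f. smooth_fun A U f \<longrightarrow>
              D p v (\<lambda>q. tscale (f q) (Y q)) =
                tadd (tscale (dir_deriv A p v f) (Y p)) (tscale (f p) (D p v Y))) \<and>
           (\<forall>Z. (\<forall>q\<in>U. Z q = Y q) \<longrightarrow> D p v Z = D p v Y)) \<and>
        (\<forall>X. smooth_vfield A U X \<longrightarrow> smooth_vfield A U (\<lambda>p. D p (X p) Y)))"

definition torsion_free ::
    "('m::topological_space, 'n::finite) chart set \<Rightarrow> ('m, 'n) connection \<Rightarrow> bool" where
  "torsion_free A D \<longleftrightarrow>
     (\<forall>U X Y. open U \<and> smooth_vfield A U X \<and> smooth_vfield A U Y \<longrightarrow>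
        (\<forall>p\<in>U. tdiff (D p (X p) Y) (D p (Y p) X) = lie_bracket A X Y p))"

definition metric_compatible ::
    "('m::topological_space, 'n::finite) chart set \<Rightarrow> ('m, 'n) metric \<Rightarrow> ('m, 'n) connection \<Rightarrow> bool"
  where
  "metric_compatible A g D \<longleftrightarrow>
     (\<forall>U X Y. open U \<and> smooth_vfield A U X \<and> smooth_vfield A U Y \<longrightarrow>
        (\<forall>p\<in>U. \<forall>v\<in>tangent_space A p.
           dir_deriv A p v (\<lambda>q. g q (X q) (Y q)) = g p (D p v X) (Y p) + g p (X p) (D p v Y)))"

text \<open>\<open>D\<close> is the Levi-Civita connection of \<open>g\<close>; on smooth fields it is determined by \<open>g\<close>.\<close>

definition levi_civita ::
    "('m::topological_space, 'n::finite) chart set \<Rightarrow> ('m, 'n) metric \<Rightarrow> ('m, 'n) connection \<Rightarrow> bool"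
  where
  "levi_civita A g D \<longleftrightarrow> affine_connection A D \<and> torsion_free A D \<and> metric_compatible A g D"

text \<open>\<open>\<nabla>\<^sup>\<alpha>\<^bsub>U\<^esub>V = \<nabla>\<^bsub>U\<^esub>V - \<alpha>(U)V - \<alpha>(V)U\<close>\<close>

definition weighted_connection ::
    "('m, 'n::finite) connection \<Rightarrow> ('m, 'n) form \<Rightarrow> ('m, 'n) connection" where
  "weighted_connection D \<alpha> =
     (\<lambda>p u V. tdiff (tdiff (D p u V) (tscale (\<alpha> p u) (V p))) (tscale (\<alpha> p (V p)) u))"


section \<open>Curvature\<close>

definition curvature ::
    "('m, 'n::finite) chart set \<Rightarrow> ('m, 'n) connection \<Rightarrow>
       ('m, 'n) vfield \<Rightarrow> ('m, 'n) vfield \<Rightarrow> ('m, 'n) vfield \<Rightarrow> ('m, 'n) vfield" where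
  "curvature A D X Y Z = (\<lambda>p.
     tdiff (tdiff (D p (X p) (\<lambda>q. D q (Y q) Z)) (D p (Y p) (\<lambda>q. D q (X q) Z)))
       (D p (lie_bracket A X Y p) Z))"

text \<open>The curvature tensor on tangent vectors at \<open>p\<close>. As \<open>R(X,Y)Z\<close> is tensorial, the vectors may be
  extended to arbitrary vector fields near \<open>p\<close>; we use constant coordinates in a chart.\<close>

definition curv_at ::
    "('m, 'n::finite) chart set \<Rightarrow> ('m, 'n) connection \<Rightarrow> 'm \<Rightarrow>
       ('m, 'n) tvec \<Rightarrow> ('m, 'n) tvec \<Rightarrow> ('m, 'n) tvec \<Rightarrow> ('m, 'n) tvec" where
  "curv_at A D p x y z =
     (let c = chart_at A p in
        curvature A D (coord_field A c (x c)) (coord_field A c (y c)) (coord_field A c (z c)) p)"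

text \<open>The matrix, in the coordinates of a chart around \<open>p\<close>, of a linear endomorphism of the tangent
  space at \<open>p\<close>.\<close>

definition tmatrix ::
    "('m, 'n::finite) chart set \<Rightarrow> 'm \<Rightarrow> (('m, 'n) tvec \<Rightarrow> ('m, 'n) tvec) \<Rightarrow> real^'n^'n" where
  "tmatrix A p L = (let c = chart_at A p in matrix (\<lambda>\<xi>. L (coord_vec A c p \<xi>) c))"

definition ricci ::
    "('m, 'n::finite) chart set \<Rightarrow> ('m, 'n) connection \<Rightarrow> 'm \<Rightarrow>
       ('m, 'n) tvec \<Rightarrow> ('m, 'n) tvec \<Rightarrow> real" where
  "ricci A D p y z = trace (tmatrix A p (\<lambda>x. curv_at A D p x y z))"

text \<open>The sectional curvature of the plane spanned by \<open>x\<close> and \<open>y\<close>, where \<open>D\<close> is the Levi-Civita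
  connection of \<open>g\<close>.\<close>

definition sectional_curvature ::
    "('m, 'n::finite) chart set \<Rightarrow> ('m, 'n) metric \<Rightarrow> ('m, 'n) connection \<Rightarrow> 'm \<Rightarrow>
       ('m, 'n) tvec \<Rightarrow> ('m, 'n) tvec \<Rightarrow> real" where
  "sectional_curvature A g D p x y =
     g p (curv_at A D p x y y) x / (g p x x * g p y y - (g p x y)\<^sup>2)"

definition orthonormal_pair ::
    "('m, 'n::finite) chart set \<Rightarrow> ('m, 'n) metric \<Rightarrow> 'm \<Rightarrow>
       ('m, 'n) tvec \<Rightarrow> ('m, 'n) tvec \<Rightarrow> bool" where
  "orthonormal_pair A g p x y \<longleftrightarrow>
     x \<in> tangent_space A p \<and> y \<in> tangent_space A p \<and>
     g p x x = 1 \<and> g p y y = 1 \<and> g p x y = 0"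

definition independent_pair ::
    "('m, 'n::finite) chart set \<Rightarrow> 'm \<Rightarrow> ('m, 'n) tvec \<Rightarrow> ('m, 'n) tvec \<Rightarrow> bool" where
  "independent_pair A p x y \<longleftrightarrow>
     x \<in> tangent_space A p \<and> y \<in> tangent_space A p \<and>
     (\<forall>a b. tadd (tscale a x) (tscale b y) = tzero \<longrightarrow> a = 0 \<and> b = 0)"

text \<open>\<open>sec_cond\<close> and \<open>ric_cond\<close> express \<open>sec > 0\<close> and \<open>Ric > 0\<close> and the other sign conditions, the
  sign being given by a predicate \<open>P\<close> such as \<open>\<lambda>r. r > 0\<close>. As usual for a bilinear form, a sign
  condition on \<open>Ric\<close> is one on \<open>Ric(y,y)\<close> for \<open>y \<noteq> 0\<close>; the Ricci tensor of a general connection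
  need not be symmetric.\<close>

definition sec_cond ::
    "(real \<Rightarrow> bool) \<Rightarrow> ('m, 'n::finite) chart set \<Rightarrow> ('m, 'n) metric \<Rightarrow> ('m, 'n) connection \<Rightarrow> bool"
  where
  "sec_cond P A g D \<longleftrightarrow>
     (\<forall>p x y. independent_pair A p x y \<longrightarrow> P (sectional_curvature A g D p x y))"

definition ric_cond ::
    "(real \<Rightarrow> bool) \<Rightarrow> ('m, 'n::finite) chart set \<Rightarrow> ('m, 'n) connection \<Rightarrow> bool" where
  "ric_cond P A D \<longleftrightarrow>
     (\<forall>p. \<forall>y\<in>tangent_space A p. y \<noteq> tzero \<longrightarrow> P (ricci A D p y y))"


section \<open>Parallel translation and holonomy\<close>

text \<open>\<open>C\<^sup>1\<close> on a closed interval, with one-sided derivatives at the end points.\<close>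

definition C1_curve ::
    "('m::topological_space, 'n::finite) chart set \<Rightarrow> (real \<Rightarrow> 'm) \<Rightarrow> real \<Rightarrow> real \<Rightarrow> bool" where
  "C1_curve A \<gamma> a b \<longleftrightarrow>
     continuous_on {a..b} \<gamma> \<and>
     (\<forall>c\<in>A. let T = {t \<in> {a..b}. \<gamma> t \<in> cdom c} in
        (\<forall>t\<in>T. (\<lambda>s. cmap c (\<gamma> s)) differentiable (at t within {a..b})) \<and>
        continuous_on T (\<lambda>t. vector_derivative (\<lambda>s. cmap c (\<gamma> s)) (at t within {a..b})))"

definition velocity ::
    "('m, 'n::finite) chart set \<Rightarrow> (real \<Rightarrow> 'm) \<Rightarrow> real \<Rightarrow> real \<Rightarrow> real \<Rightarrow> ('m, 'n) tvec" where
  "velocity A \<gamma> a b t = (\<lambda>c.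
     if c \<in> charts_at A (\<gamma> t)
     then vector_derivative (\<lambda>s. cmap c (\<gamma> s)) (at t within {a..b}) else 0)"

text \<open>The vanishing of the covariant derivative
  \<open>D\<^sub>t V = \<Sum>j. (dV\<^sup>j/dt) \<partial>\<^sub>j + V\<^sup>j \<nabla>\<^bsub>\<gamma>'\<^esub> \<partial>\<^sub>j\<close> in every chart.\<close>

definition parallel_on ::
    "('m::topological_space, 'n::finite) chart set \<Rightarrow> ('m, 'n) connection \<Rightarrow> (real \<Rightarrow> 'm) \<Rightarrow>
       real \<Rightarrow> real \<Rightarrow> (real \<Rightarrow> ('m, 'n) tvec) \<Rightarrow> bool" where
  "parallel_on A D \<gamma> a b V \<longleftrightarrow>
     (\<forall>t\<in>{a..b}. V t \<in> tangent_space A (\<gamma> t) \<and>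
        (\<forall>c\<in>charts_at A (\<gamma> t).
           ((\<lambda>s. V s c) has_vector_derivative
              - D (\<gamma> t) (velocity A \<gamma> a b t) (coord_field A c (V t c)) c) (at t within {a..b})))"

definition unit_partition :: "nat \<Rightarrow> (nat \<Rightarrow> real) \<Rightarrow> bool" where
  "unit_partition k \<tau> \<longleftrightarrow> \<tau> 0 = 0 \<and> \<tau> k = 1 \<and> (\<forall>i<k. \<tau> i < \<tau> (Suc i))"

text \<open>Unlike the piecewise \<open>C\<^sup>1\<close> functions of the library, these curves have one-sided
  derivatives at the break points.\<close>

definition pw_C1_curve ::
    "('m::topological_space, 'n::finite) chart set \<Rightarrow> (real \<Rightarrow> 'm) \<Rightarrow> bool" where
  "pw_C1_curve A \<gamma> \<longleftrightarrow>
     (\<exists>k \<tau>. unit_partition k \<tau> \<and> (\<forall>i<k. C1_curve A \<gamma> (\<tau> i) (\<tau> (Suc i))))"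

definition parallel_along ::
    "('m::topological_space, 'n::finite) chart set \<Rightarrow> ('m, 'n) connection \<Rightarrow> (real \<Rightarrow> 'm) \<Rightarrow>
       (real \<Rightarrow> ('m, 'n) tvec) \<Rightarrow> bool" where
  "parallel_along A D \<gamma> V \<longleftrightarrow>
     (\<exists>k \<tau>. unit_partition k \<tau> \<and>
        (\<forall>i<k. C1_curve A \<gamma> (\<tau> i) (\<tau> (Suc i)) \<and> parallel_on A D \<gamma> (\<tau> i) (\<tau> (Suc i)) V))"

definition parallel_translation ::
    "('m::topological_space, 'n::finite) chart set \<Rightarrow> ('m, 'n) connection \<Rightarrow> (real \<Rightarrow> 'm) \<Rightarrow>
       ('m, 'n) tvec \<Rightarrow> ('m, 'n) tvec" where
  "parallel_translation A D \<gamma> v =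
     (THE w. \<exists>V. parallel_along A D \<gamma> V \<and> V 0 = v \<and> V 1 = w)"

definition holonomy_group ::
    "('m::topological_space, 'n::finite) chart set \<Rightarrow> ('m, 'n) connection \<Rightarrow> 'm \<Rightarrow>
       (('m, 'n) tvec \<Rightarrow> ('m, 'n) tvec) set" where
  "holonomy_group A D p =
     {restrict (parallel_translation A D \<gamma>) (tangent_space A p) | \<gamma>.
        pw_C1_curve A \<gamma> \<and> \<gamma> 0 = p \<and> \<gamma> 1 = p}"

text \<open>Compactness in the general linear group of the tangent space, whose topology is that of
  matrices in a basis.\<close>

definition compact_holonomy ::
    "('m::topological_space, 'n::finite) chart set \<Rightarrow> ('m, 'n) connection \<Rightarrow> 'm \<Rightarrow> bool" where
  "compact_holonomy A D p \<longleftrightarrow> compact (tmatrix A p ` holonomy_group A D p)"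

end

theory Submission
  imports Defs
begin

text \<open>Compactness of the holonomy group yields an inner product on the tangent space at \<open>p\<^sub>0\<close> that is
  invariant under all loops, and parallel translation spreads it to a \<open>\<nabla>\<^sup>\<alpha>\<close>-parallel metric
  \<open>g'\<close>. Its coefficients satisfy the linear system \<open>dg' = \<Gamma> g'\<close> along every line in a chart, so they
  are smooth by bootstrapping. As \<open>\<nabla>\<^sup>\<alpha>\<close> is torsion free, it is the Levi-Civita connection of
  \<open>g'\<close>; hence the Ricci tensors agree. For the sectional curvature fix \<open>Y\<close>: the operator
  \<open>X \<mapsto> R(X,Y)Y\<close> is \<open>g'\<close>-self-adjoint and annihilates \<open>Y\<close>, so its extremal values on the
  \<open>g'\<close>-complement of \<open>Y\<close> are eigenvalues \<open>\<lambda>\<close>; subtracting a multiple of \<open>Y\<close> from an eigenvector makes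
  it \<open>g\<close>-orthogonal to \<open>Y\<close>, and the hypothesis gives the sign of \<open>\<lambda>\<close>.\<close>

section \<open>Calculus of smooth maps\<close>

text \<open>The obstacle is regularity. The candidate metric is defined point by point, through
  arbitrarily chosen paths from \<open>p\<^sub>0\<close>; holonomy invariance only says that
  parallel translation along every piecewise C^1 curve is isometric. From this each coefficient is
  differentiable along each line (\<open>gc_line\<close>), which in general does not even imply
  continuity. Gronwall's inequality along rays supplies a local bound uniform in the direction,
  hence Lipschitz estimates and continuity; then the directional derivatives, which the system
  expresses through the coefficients, are continuous too and give total differentiability. The
  invariant inner product comes from a minimisation over a compact convex set of inner products, in
  place of Haar averaging. It rests on closure of the holonomy under composition, so all paths are
  traversed forwards. The metrics \<open>g\<close> and \<open>g'\<close> are unrelated, so the signs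
  of g(R(X,Y)Y,X) and g'(R(X,Y)Y,X) cannot be compared vector by vector. Eigenvalues do not refer to
  an inner product and mediate between the two; torsion freeness and the second derivatives of
  \<open>g'\<close> enter through self-adjointness.\<close>

lemma frechet_derivative_eq:
  assumes "(f has_derivative f') (at x)"
  shows "frechet_derivative f (at x) = f'"
  using frechet_derivative_at[OF assms] by simp

lemma has_derivative_frechet:
  assumes "f differentiable (at x)"
  shows "(f has_derivative frechet_derivative f (at x)) (at x)"
  using assms frechet_derivative_works by blast

text \<open>Openness lets \<open>f\<close> and \<open>g\<close> agree on a neighbourhood of each
  point, so their derivatives agree as well and the induction on \<open>k\<close> can
  proceed.\<close>

lemma Ck_on_cong:
  fixes f g :: "'a::euclidean_space \<Rightarrow> 'b::real_normed_vector"
  assumes "open S" "\<And>x. x \<in> S \<Longrightarrow> f x = g x" "Ck_on k S f"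
  shows "Ck_on k S g"
  using assms(2,3)
proof (induction k arbitrary: f g)
  case 0
  then show ?case using continuous_on_cong[of S S f g] by simp
next
  case (Suc k)
  have d: "(g has_derivative frechet_derivative f (at x)) (at x)" if "x \<in> S" for x
    using has_derivative_transform_within_open[OF has_derivative_frechet assms(1) that, of f g] Suc.prems that
    by auto
  have "Ck_on k S (\<lambda>x. frechet_derivative g (at x) v)" for v
  proof (rule Suc.IH)
    show "frechet_derivative f (at x) v = frechet_derivative g (at x) v" if "x \<in> S" for x
      using frechet_derivative_eq[OF d[OF that]] by simp
    show "Ck_on k S (\<lambda>x. frechet_derivative f (at x) v)"
      using Suc.prems by simp
  qed
  then show ?case using d by (auto simp: differentiable_def)
qed

lemma Ck_on_subset: "T \<subseteq> S \<Longrightarrow> Ck_on k S f \<Longrightarrow> Ck_on k T f"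
  by (induction k arbitrary: f) (auto intro: continuous_on_subset)

lemma Ck_on_SucD: "Ck_on (Suc k) S f \<Longrightarrow> Ck_on k S f"
proof (induction k arbitrary: f)
  case 0
  then show ?case
    by (auto intro!: continuous_at_imp_continuous_on differentiable_imp_continuous_within)
next
  case (Suc k)
  then have "Ck_on k S (\<lambda>x. frechet_derivative f (at x) v)" for v
    by (metis Ck_on.simps(2))
  then show ?case using Suc.prems by simp
qed

lemma Ck_on_const: "Ck_on k S (\<lambda>x. c)"
  by (induction k arbitrary: c) auto

text \<open>Derivatives at a point are unique, so any explicitly given family \<open>f'\<close> may
  stand for \<open>frechet_derivative\<close>.\<close>

lemma Ck_on_SucI:
  assumes "open S" "\<And>x. x \<in> S \<Longrightarrow> (f has_derivative f' x) (at x)" "\<And>v. Ck_on k S (\<lambda>x. f' x v)"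
  shows "Ck_on (Suc k) S f"
proof -
  have "Ck_on k S (\<lambda>x. frechet_derivative f (at x) v)" for v
    by (rule Ck_on_cong[OF assms(1) _ assms(3)[of v]]) (simp add: frechet_derivative_eq[OF assms(2)])
  then show ?thesis using assms(2) by (auto simp: differentiable_def)
qed

lemma Ck_on_Suc_derivative:
  assumes "Ck_on (Suc k) S f" "x \<in> S"
  shows "(f has_derivative frechet_derivative f (at x)) (at x)"
  using assms by (simp add: has_derivative_frechet)

section \<open>Sums, bilinear products and composites of C^k maps\<close>

lemma Ck_on_add:
  assumes "open S" "Ck_on k S f" "Ck_on k S g"
  shows "Ck_on k S (\<lambda>x. f x + g x)"
  using assms(2,3)
proof (induction k arbitrary: f g)
  case (Suc k)
  show ?case
  proof (rule Ck_on_SucI[OF assms(1)])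
    show "((\<lambda>x. f x + g x) has_derivative
        (\<lambda>v. frechet_derivative f (at x) v + frechet_derivative g (at x) v)) (at x)" if "x \<in> S" for x
      using Suc.prems that by (intro has_derivative_add Ck_on_Suc_derivative)
  qed (use Suc in auto)
qed (simp add: continuous_on_add)

lemma Ck_on_sum:
  assumes "open S" "\<And>i. i \<in> I \<Longrightarrow> Ck_on k S (f i)"
  shows "Ck_on k S (\<lambda>x. \<Sum>i\<in>I. f i x)"
  using assms(2)
  by (induction I rule: infinite_finite_induct) (auto intro!: Ck_on_const Ck_on_add[OF assms(1)])

text \<open>The undifferentiated factor of each Leibniz term is known to order \<open>Suc k\<close>;
  \<open>Ck_on_SucD\<close> lowers it to fit the induction hypothesis.\<close>

lemma (in bounded_bilinear) Ck_on:
  assumes "open S" "Ck_on k S f" "Ck_on k S g"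
  shows "Ck_on k S (\<lambda>x. prod (f x) (g x))"
  using assms(2,3)
proof (induction k arbitrary: f g)
  case 0
  then show ?case by (simp add: continuous_on)
next
  case (Suc k)
  show ?case
  proof (rule Ck_on_SucI[OF assms(1)])
    show "((\<lambda>x. prod (f x) (g x)) has_derivative
        (\<lambda>v. prod (f x) (frechet_derivative g (at x) v) + prod (frechet_derivative f (at x) v) (g x))) (at x)"
      if "x \<in> S" for x
      using Suc.prems that by (intro FDERIV Ck_on_Suc_derivative)
    show "Ck_on k S (\<lambda>x. prod (f x) (frechet_derivative g (at x) v) + prod (frechet_derivative f (at x) v) (g x))"
      for v
      using Suc.prems Suc.prems[THEN Ck_on_SucD] by (intro Ck_on_add[OF assms(1)] Suc.IH) simp_all
  qed
qed

lemmas Ck_on_scaleR = bounded_bilinear.Ck_on[OF bounded_bilinear_scaleR]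

lemma Ck_on_linear_compose:
  assumes "open S" "bounded_linear L" "Ck_on k S f"
  shows "Ck_on k S (\<lambda>x. L (f x))"
  using assms(3)
proof (induction k arbitrary: f)
  case 0
  then show ?case by (simp add: bounded_linear.continuous_on[OF assms(2)])
next
  case (Suc k)
  show ?case
    by (rule Ck_on_SucI[OF assms(1), where f' = "\<lambda>x v. L (frechet_derivative f (at x) v)"])
      (use Suc in \<open>auto intro!: bounded_linear.has_derivative[OF assms(2)] Ck_on_Suc_derivative\<close>)
qed

lemma linear_Basis_expand:
  assumes "linear f" shows "f v = (\<Sum>b\<in>Basis. (v \<bullet> b) *\<^sub>R f b)"
proof -
  have "f v = f (\<Sum>b\<in>Basis. (v \<bullet> b) *\<^sub>R b)" by (simp add: euclidean_representation)
  then show ?thesis by (simp add: linear_sum[OF assms] linear_cmul[OF assms])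
qed

lemma Ck_on_compose:
  fixes f :: "'b::euclidean_space \<Rightarrow> 'c::real_normed_vector" and h :: "'a::euclidean_space \<Rightarrow> 'b"
  assumes "open S" "open T" "\<And>x. x \<in> S \<Longrightarrow> h x \<in> T" "Ck_on k S h" "Ck_on k T f"
  shows "Ck_on k S (\<lambda>x. f (h x))"
  using assms(4,5)
proof (induction k arbitrary: f)
  case 0
  then show ?case using assms(3) by (auto intro!: continuous_on_compose2[of T f])
next
  case (Suc k)
  have h: "Ck_on k S h" using Suc.prems(1) by (rule Ck_on_SucD)
  show ?case
  proof (rule Ck_on_SucI[OF assms(1)])
    show d: "((\<lambda>x. f (h x)) has_derivative
       (\<lambda>v. frechet_derivative f (at (h x)) (frechet_derivative h (at x) v))) (at x)" if "x \<in> S" for x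
      using diff_chain_at[OF Ck_on_Suc_derivative[OF Suc.prems(1) that] Ck_on_Suc_derivative[OF Suc.prems(2) assms(3)[OF that]]]
      by (simp add: o_def)
    fix v
    \<comment> \<open>The chain rule differentiates \<open>f\<close> in the direction
      \<open>frechet_derivative h (at x) v\<close>, which moves with \<open>x\<close>, whereas
      \<open>Ck_on\<close> controls fixed directions; the basis expansion separates the two.\<close>
    have "Ck_on k S (\<lambda>x. \<Sum>b\<in>Basis. (frechet_derivative h (at x) v \<bullet> b) *\<^sub>R frechet_derivative f (at (h x)) b)"
      using Suc.prems h
      by (intro Ck_on_sum Ck_on_scaleR assms(1) Ck_on_linear_compose[OF _ bounded_linear_inner_left] Suc.IH) auto
    then show "Ck_on k S (\<lambda>x. frechet_derivative f (at (h x)) (frechet_derivative h (at x) v))"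
    proof (rule Ck_on_cong[OF assms(1), rotated])
      fix x assume "x \<in> S"
      then have "linear (frechet_derivative f (at (h x)))"
        using Suc.prems assms(3) by (simp add: linear_frechet_derivative)
      then show "(\<Sum>b\<in>Basis. (frechet_derivative h (at x) v \<bullet> b) *\<^sub>R frechet_derivative f (at (h x)) b) =
        frechet_derivative f (at (h x)) (frechet_derivative h (at x) v)"
        by (rule linear_Basis_expand[symmetric])
    qed
  qed
qed

lemma Cinf_onD: "Cinf_on S f \<Longrightarrow> Ck_on k S f"
  by (simp add: Cinf_on_def)

lemma Cinf_on_cong:
  assumes "open S" "\<And>x. x \<in> S \<Longrightarrow> f x = g x" "Cinf_on S f"
  shows "Cinf_on S g"
  using assms Ck_on_cong[of S f g] by (auto simp: Cinf_on_def)

lemma Cinf_on_subset: "Cinf_on S f \<Longrightarrow> T \<subseteq> S \<Longrightarrow> Cinf_on T f"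
  by (auto simp: Cinf_on_def intro: Ck_on_subset)

lemma Cinf_on_const [simp]: "Cinf_on S (\<lambda>x. c)"
  by (simp add: Cinf_on_def Ck_on_const)

lemma Cinf_on_add: "open S \<Longrightarrow> Cinf_on S f \<Longrightarrow> Cinf_on S g \<Longrightarrow> Cinf_on S (\<lambda>x. f x + g x)"
  by (simp add: Cinf_on_def Ck_on_add)

lemma Cinf_on_sum: "open S \<Longrightarrow> (\<And>i. i \<in> I \<Longrightarrow> Cinf_on S (f i)) \<Longrightarrow> Cinf_on S (\<lambda>x. \<Sum>i\<in>I. f i x)"
  by (simp add: Cinf_on_def Ck_on_sum)

lemma Cinf_on_linear_compose: "open S \<Longrightarrow> bounded_linear L \<Longrightarrow> Cinf_on S f \<Longrightarrow> Cinf_on S (\<lambda>x. L (f x))"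
  by (simp add: Cinf_on_def Ck_on_linear_compose)

lemma Cinf_on_scaleR: "open S \<Longrightarrow> Cinf_on S f \<Longrightarrow> Cinf_on S g \<Longrightarrow> Cinf_on S (\<lambda>x. f x *\<^sub>R g x)"
  by (simp add: Cinf_on_def Ck_on_scaleR)

lemma Cinf_on_diff: "open S \<Longrightarrow> Cinf_on S f \<Longrightarrow> Cinf_on S g \<Longrightarrow> Cinf_on S (\<lambda>x. f x - g x)"
  using Cinf_on_add[of S f "\<lambda>x. - g x"] Cinf_on_linear_compose[of S uminus g]
  by (simp add: bounded_linear_minus[OF bounded_linear_ident])

lemma Cinf_on_compose:
  assumes "open S" "open T" "\<And>x. x \<in> S \<Longrightarrow> h x \<in> T" "Cinf_on S h" "Cinf_on T f"
  shows "Cinf_on S (\<lambda>x. f (h x))"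
  using Ck_on_compose[OF assms(1,2), of h _ f] assms(3-5) unfolding Cinf_on_def by blast

lemma Cinf_on_continuous: "Cinf_on S f \<Longrightarrow> continuous_on S f"
  using Cinf_onD[of S f 0] by simp

lemma Cinf_on_has_derivative:
  "Cinf_on S f \<Longrightarrow> x \<in> S \<Longrightarrow> (f has_derivative frechet_derivative f (at x)) (at x)"
  using Ck_on_Suc_derivative Cinf_onD by blast

lemma Cinf_on_frechet_derivative: "Cinf_on S f \<Longrightarrow> Cinf_on S (\<lambda>x. frechet_derivative f (at x) v)"
  unfolding Cinf_on_def by (metis Ck_on.simps(2))

section \<open>Linear differential equations\<close>

text \<open>The squared norm times \<open>exp (- 2 * C * \<sigma> * u)\<close> is monotone, where
  the sign \<open>\<sigma>\<close> treats estimates forwards and backwards in time alike. With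
  \<open>f s = 0\<close> this is uniqueness for linear systems; with \<open>C = 0\<close> it is
  constancy of functions with zero derivative.\<close>

lemma gronwall_linear:
  fixes f :: "real \<Rightarrow> 'a::real_inner"
  assumes f: "\<And>t. t \<in> {a..b} \<Longrightarrow> (f has_vector_derivative f' t) (at t within {a..b})"
    and bd: "\<And>t. t \<in> {a..b} \<Longrightarrow> norm (f' t) \<le> C * norm (f t)"
    and st: "s \<in> {a..b}" "t \<in> {a..b}"
  shows "norm (f t) \<le> exp (C * \<bar>t - s\<bar>) * norm (f s)"
proof -
  have *: "norm (f t) \<le> exp (C * \<bar>t - s\<bar>) * norm (f s)"
    if \<sigma>: "\<sigma> \<in> {1, -1}" and le: "\<sigma> * s \<le> \<sigma> * t" for \<sigma> :: real
  proof -
    define \<phi> where "\<phi> = (\<lambda>u. (f u \<bullet> f u) * exp (- 2 * C * \<sigma> * u))"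
    define \<phi>' where "\<phi>' = (\<lambda>u. 2 * (f u \<bullet> f' u - C * \<sigma> * (f u \<bullet> f u)) * exp (- 2 * C * \<sigma> * u))"
    have der: "(\<phi> has_real_derivative \<phi>' u) (at u within {a..b})" if "u \<in> {a..b}" for u
    proof -
      have "((\<lambda>u. f u \<bullet> f u) has_real_derivative 2 * (f u \<bullet> f' u)) (at u within {a..b})"
        using has_derivative_inner[OF f[OF that, unfolded has_vector_derivative_def] f[OF that, unfolded has_vector_derivative_def]]
        unfolding has_field_derivative_def
        by (rule has_derivative_eq_rhs) (auto simp: inner_commute algebra_simps)
      then show ?thesis unfolding \<phi>_def \<phi>'_def
        by (auto intro!: derivative_eq_intros simp: algebra_simps)
    qed
    have nn: "\<sigma> * \<phi>' u \<le> 0" if "u \<in> {a..b}" for u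
    proof -
      have "\<bar>f u \<bullet> f' u\<bar> \<le> C * (f u \<bullet> f u)"
      proof -
        have "\<bar>f u \<bullet> f' u\<bar> \<le> norm (f u) * norm (f' u)" by (rule Cauchy_Schwarz_ineq2)
        also have "\<dots> \<le> norm (f u) * (C * norm (f u))" using bd[OF that] by (simp add: mult_left_mono)
        finally show ?thesis by (simp add: dot_square_norm power2_eq_square algebra_simps)
      qed
      then have "\<sigma> * (f u \<bullet> f' u - C * \<sigma> * (f u \<bullet> f u)) \<le> 0" using \<sigma> by auto
      then have "\<sigma> * (f u \<bullet> f' u - C * \<sigma> * (f u \<bullet> f u)) * (2 * exp (- 2 * C * \<sigma> * u)) \<le> 0"
        by (simp add: mult_nonpos_nonneg)
      then show ?thesis unfolding \<phi>'_def by (simp add: algebra_simps)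
    qed
    define l r where "l = min s t" and "r = max s t"
    have lr: "l \<le> r" "{l..r} \<subseteq> {a..b}" using st by (auto simp: l_def r_def)
    have "\<And>u. \<lbrakk>l \<le> u; u \<le> r\<rbrakk> \<Longrightarrow> (\<phi> has_derivative (*) (\<phi>' u)) (at u within {l..r})"
      using der lr(2) unfolding has_field_derivative_def by (meson atLeastAtMost_iff has_derivative_subset subset_eq)
    from mvt_very_simple[OF lr(1) this] obtain u where u: "u \<in> {l..r}" "\<phi> r - \<phi> l = \<phi>' u * (r - l)"
      by auto
    have "\<sigma> * (\<phi> r - \<phi> l) \<le> 0"
    proof -
      have "(\<sigma> * \<phi>' u) * (r - l) \<le> 0"
        by (rule mult_nonpos_nonneg[OF nn]) (use u(1) lr in auto)
      then show ?thesis using u(2) by simp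
    qed
    then have "\<phi> t \<le> \<phi> s" using le \<sigma> by (auto simp: l_def r_def min_def max_def split: if_splits)
    then have "(norm (f t))\<^sup>2 * exp (- 2 * C * \<sigma> * t) \<le> (norm (f s))\<^sup>2 * exp (- 2 * C * \<sigma> * s)"
      by (simp add: \<phi>_def dot_square_norm)
    then have "(norm (f t))\<^sup>2 * exp (- 2 * C * \<sigma> * t) * exp (2 * C * \<sigma> * t)
        \<le> (norm (f s))\<^sup>2 * exp (- 2 * C * \<sigma> * s) * exp (2 * C * \<sigma> * t)"
      by (rule mult_right_mono) simp
    then have "(norm (f t))\<^sup>2 \<le> (exp (C * \<sigma> * (t - s)) * norm (f s))\<^sup>2"
      by (simp add: mult.assoc exp_add[symmetric] power_mult_distrib exp_double[symmetric] algebra_simps)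
    then have "norm (f t) \<le> exp (C * \<sigma> * (t - s)) * norm (f s)"
      by (rule power2_le_imp_le) simp
    moreover have "\<sigma> * (t - s) = \<bar>t - s\<bar>" using \<sigma> le by auto
    ultimately show ?thesis by (simp add: mult.assoc)
  qed
  show ?thesis
  proof (cases "s \<le> t")
    case True
    then show ?thesis using *[of 1] by simp
  next
    case False
    then show ?thesis using *[of "-1"] by simp
  qed
qed

lemma basis_expansion_bound:
  fixes L :: "'i \<Rightarrow> 'a::euclidean_space \<Rightarrow> 'b::real_normed_vector"
  assumes "\<And>t. t \<in> T \<Longrightarrow> linear (L t)" "\<And>b t. b \<in> Basis \<Longrightarrow> t \<in> T \<Longrightarrow> norm (L t b) \<le> M b" "t \<in> T"
  shows "norm (L t x) \<le> (\<Sum>b\<in>Basis. M b) * norm x"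
proof -
  have "norm (L t x) = norm (\<Sum>b\<in>Basis. (x \<bullet> b) *\<^sub>R L t b)"
    by (rule arg_cong[OF linear_Basis_expand[OF assms(1)[OF assms(3)]]])
  also have "\<dots> \<le> (\<Sum>b\<in>Basis. norm ((x \<bullet> b) *\<^sub>R L t b))" by (rule norm_sum)
  also have "\<dots> \<le> (\<Sum>b\<in>Basis. norm x * M b)"
    using assms(2,3) by (intro sum_mono) (auto simp: Basis_le_norm intro!: mult_mono)
  finally show ?thesis by (simp add: sum_distrib_left mult.commute)
qed

text \<open>Linear maps depending on \<open>t\<close> are plain functions here, so continuity of the
  family is expressed on basis vectors; the basis expansion then admits a moving argument.\<close>

lemma continuous_on_linear_family:
  fixes L :: "'i::topological_space \<Rightarrow> 'a::euclidean_space \<Rightarrow> 'b::real_normed_vector"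
  assumes "\<And>t. t \<in> T \<Longrightarrow> linear (L t)" "\<And>b. b \<in> Basis \<Longrightarrow> continuous_on T (\<lambda>t. L t b)" "continuous_on T f"
  shows "continuous_on T (\<lambda>t. L t (f t))"
proof -
  have "continuous_on T (\<lambda>t. \<Sum>b\<in>Basis. (f t \<bullet> b) *\<^sub>R L t b)"
    using assms by (intro continuous_intros) auto
  then show ?thesis
    by (rule continuous_on_eq) (rule linear_Basis_expand[OF assms(1), symmetric])
qed

lemma compact_basis_expansion_bound:
  fixes L :: "'i::topological_space \<Rightarrow> 'a::euclidean_space \<Rightarrow> 'b::real_normed_vector"
  assumes "compact T" "\<And>t. t \<in> T \<Longrightarrow> linear (L t)" "\<And>b. b \<in> Basis \<Longrightarrow> continuous_on T (\<lambda>t. L t b)"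
  obtains M where "M \<ge> 0" "\<And>t x. t \<in> T \<Longrightarrow> norm (L t x) \<le> M * norm x"
proof -
  have "\<exists>m. \<forall>t\<in>T. norm (L t b) \<le> m" if "b \<in> Basis" for b
    using compact_imp_bounded[OF compact_continuous_image[OF assms(3)[OF that] assms(1)]]
    by (auto simp: bounded_iff)
  then obtain m where m: "\<And>b t. b \<in> Basis \<Longrightarrow> t \<in> T \<Longrightarrow> norm (L t b) \<le> m b" by metis
  define M where "M = max 0 (\<Sum>b\<in>Basis. m b)"
  have "norm (L t x) \<le> M * norm x" if "t \<in> T" for t x
  proof -
    have "norm (L t x) \<le> (\<Sum>b\<in>Basis. m b) * norm x"
      using basis_expansion_bound[of T L m t x] assms(2) m that by blast
    also have "\<dots> \<le> M * norm x" by (auto simp: M_def mult_right_mono)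
    finally show ?thesis .
  qed
  then show ?thesis using that[of M] by (auto simp: M_def)
qed

text \<open>Picard iteration; for a linear equation the iterates are the partial sums of a series that is
  dominated by the exponential series.\<close>

lemma linear_ode_exists:
  fixes L :: "real \<Rightarrow> 'a::euclidean_space \<Rightarrow> 'a"
  assumes ab: "a \<le> b" and lin: "\<And>t. t \<in> {a..b} \<Longrightarrow> linear (L t)"
    and cont: "\<And>i. i \<in> Basis \<Longrightarrow> continuous_on {a..b} (\<lambda>t. L t i)"
  obtains f where "f a = v" "\<And>t. t \<in> {a..b} \<Longrightarrow> (f has_vector_derivative L t (f t)) (at t within {a..b})"
proof -
  obtain M where M: "M \<ge> 0" "\<And>t x. t \<in> {a..b} \<Longrightarrow> norm (L t x) \<le> M * norm x"
    using compact_basis_expansion_bound[of "{a..b}" L] lin cont by auto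
  \<comment> \<open>\<open>F k\<close> is the k-th term of the series, not the k-th Picard iterate;
    each integration contributes a factor M (t - a) / k to the bound \<open>Fb\<close>.\<close>
  define F where "F = rec_nat (\<lambda>t. v) (\<lambda>k f t. integral {a..t} (\<lambda>s. L s (f s)))"
  have F0: "F 0 t = v" and FS: "F (Suc k) t = integral {a..t} (\<lambda>s. L s (F k s))" for k t
    by (simp_all add: F_def)
  have Fc: "continuous_on {a..b} (F k)" for k
  proof (induction k)
    case (Suc k)
    then have "continuous_on {a..b} (\<lambda>s. L s (F k s))"
      using continuous_on_linear_family[of "{a..b}" L] lin cont by blast
    then have "continuous_on {a..b} (\<lambda>t. integral {a..t} (\<lambda>s. L s (F k s)))"
      by (intro indefinite_integral_continuous_1 integrable_continuous_real)
    then show ?case by (simp add: FS[abs_def])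
  qed (simp add: F0[abs_def])
  have LFc: "continuous_on {a..b} (\<lambda>s. L s (F k s))" for k
    using continuous_on_linear_family[of "{a..b}" L] lin cont Fc by blast
  have Fd: "(F (Suc k) has_vector_derivative L t (F k t)) (at t within {a..b})" if "t \<in> {a..b}" for k t
    using integral_has_vector_derivative[OF LFc that] by (simp add: FS[abs_def])
  have Fb: "norm (F k t) \<le> (M * (t - a)) ^ k / fact k * norm v" if "t \<in> {a..b}" for k t
    using that
  proof (induction k arbitrary: t)
    case (Suc k)
    let ?p = "\<lambda>s. (M * (s - a)) ^ Suc k / fact (Suc k) * norm v"
    let ?q = "\<lambda>s. M * ((M * (s - a)) ^ k / fact k * norm v)"
    have "(?q has_integral (?p t - ?p a)) {a..t}"
    proof (rule fundamental_theorem_of_calculus)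
      show "a \<le> t" using Suc.prems by simp
      fix s
      have "(?p has_real_derivative ((1 + real k) * (M * (s - a)) ^ k * M / fact (Suc k) * norm v)) (at s within {a..t})"
      proof -
        have "((\<lambda>s. M * (s - a)) has_real_derivative M) (at s within {a..t})"
          by (auto intro!: derivative_eq_intros)
        from DERIV_power[OF this, of "Suc k"]
        have "((\<lambda>s. (M * (s - a)) ^ Suc k) has_real_derivative (1 + real k) * (M * (s - a)) ^ k * M) (at s within {a..t})"
          by (simp only: diff_Suc_Suc minus_nat.diff_0 of_nat_Suc mult_ac)
        then show ?thesis by (intro DERIV_cmult_right DERIV_cdivide)
      qed
      moreover have "(1 + real k) * (M * (s - a)) ^ k * M / fact (Suc k) * norm v = ?q s"
        by (simp add: mult_ac)
      ultimately show "(?p has_vector_derivative ?q s) (at s within {a..t})"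
        using DERIV_cong has_real_derivative_iff_has_vector_derivative[of ?p "?q s"] by blast
    qed
    then have q: "(?q has_integral ?p t) {a..t}" by simp
    have "norm (integral {a..t} (\<lambda>s. L s (F k s))) \<le> integral {a..t} ?q"
    proof (rule integral_norm_bound_integral)
      show "(\<lambda>s. L s (F k s)) integrable_on {a..t}"
        using LFc[of k] Suc.prems by (intro integrable_continuous_real) (auto intro: continuous_on_subset)
      show "?q integrable_on {a..t}" using q by blast
      fix s assume "s \<in> {a..t}"
      then have s: "s \<in> {a..b}" using Suc.prems by auto
      then have "norm (L s (F k s)) \<le> M * norm (F k s)" by (rule M)
      also have "\<dots> \<le> ?q s" using Suc.IH[OF s] M(1) by (rule mult_left_mono)
      finally show "norm (L s (F k s)) \<le> ?q s" .
    qed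
    then show ?case using integral_unique[OF q] by (simp add: FS)
  qed (simp add: F0)
  define K where "K = (\<lambda>k. (M * (b - a)) ^ k / fact k * norm v)"
  have FK: "norm (F k t) \<le> K k" if "t \<in> {a..b}" for k t
  proof -
    have "(M * (t - a)) ^ k / fact k * norm v \<le> K k"
      unfolding K_def using that M(1) by (intro mult_right_mono divide_right_mono power_mono mult_left_mono) auto
    then show ?thesis using Fb[OF that, of k] by linarith
  qed
  have K: "summable K"
    unfolding K_def using summable_exp[of "M * (b - a)"]
    by (intro summable_mult2) (simp add: field_simps)
  define G where "G = (\<lambda>t. \<Sum>k. F k t)"
  have unif: "uniform_limit {a..b} (\<lambda>n t. \<Sum>k<n. F k t) G sequentially"
    unfolding G_def using FK K by (intro Weierstrass_m_test) auto
  \<comment> \<open>The derivative of term \<open>Suc j\<close> is \<open>L\<close> applied to term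
    \<open>j\<close>, and term 0 is constant. Because of this shift the first \<open>Suc n\<close>
    derivatives sum to \<open>L\<close> of the first \<open>n\<close> terms.\<close>
  define D where "D = (\<lambda>k t (h::real). case k of 0 \<Rightarrow> 0 | Suc j \<Rightarrow> h *\<^sub>R L t (F j t))"
  have sumD: "(\<Sum>i<Suc n. D i t h) = h *\<^sub>R L t (\<Sum>k<n. F k t)" if "t \<in> {a..b}" for n t h
    by (simp add: D_def sum.lessThan_Suc_shift linear_sum[OF lin[OF that]] scaleR_sum_right del: sum.lessThan_Suc)
  have sumsG: "(\<lambda>k. F k t) sums G t" if "t \<in> {a..b}" for t
    unfolding G_def by (rule summable_sums, rule summable_comparison_test'[OF K, of 0], rule FK[OF that])
  have "\<exists>g. \<forall>t\<in>{a..b}. (\<lambda>k. F k t) sums g t \<and> (g has_derivative (\<lambda>h. h *\<^sub>R L t (G t))) (at t within {a..b})"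
  proof (rule has_derivative_series)
    show "(F k has_derivative D k t) (at t within {a..b})" if "t \<in> {a..b}" for k t
      using Fd[OF that] by (cases k) (simp_all add: D_def has_vector_derivative_def F0[abs_def])
    show "a \<in> {a..b}" using ab by simp
    then show "(\<lambda>k. F k a) sums G a" by (rule sumsG)
    fix e :: real assume "e > 0"
    \<comment> \<open>The summand 1 guards against \<open>M = 0\<close>.\<close>
    then have "e / (M + 1) > 0" using M(1) by simp
    with unif have "\<forall>\<^sub>F n in sequentially. \<forall>t\<in>{a..b}. dist (\<Sum>k<n. F k t) (G t) < e / (M + 1)"
      by (auto simp: uniform_limit_iff)
    then have "\<forall>\<^sub>F n in sequentially. \<forall>t\<in>{a..b}. \<forall>h. norm ((\<Sum>i<Suc n. D i t h) - h *\<^sub>R L t (G t)) \<le> e * norm h"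
    proof eventually_elim
      case (elim n)
      show ?case
      proof (intro ballI allI)
        fix t h assume t: "t \<in> {a..b}"
        have "norm ((\<Sum>i<Suc n. D i t h) - h *\<^sub>R L t (G t)) = \<bar>h\<bar> * norm (L t ((\<Sum>k<n. F k t) - G t))"
          unfolding sumD[OF t] by (simp add: linear_diff[OF lin[OF t]] scaleR_diff_right[symmetric])
        also have "\<dots> \<le> \<bar>h\<bar> * (M * norm ((\<Sum>k<n. F k t) - G t))"
          using M(2)[OF t] by (intro mult_left_mono) auto
        also have "\<dots> \<le> \<bar>h\<bar> * (M * (e / (M + 1)))"
          using elim t M(1) by (intro mult_left_mono) (auto simp: dist_norm less_imp_le)
        also have "\<dots> \<le> \<bar>h\<bar> * e"
          using M(1) \<open>e > 0\<close> by (intro mult_left_mono) (auto simp: field_simps)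
        finally show "norm ((\<Sum>i<Suc n. D i t h) - h *\<^sub>R L t (G t)) \<le> e * norm h" by (simp add: mult.commute)
      qed
    qed
    then show "\<forall>\<^sub>F n in sequentially. \<forall>t\<in>{a..b}. \<forall>h. norm ((\<Sum>i<n. D i t h) - h *\<^sub>R L t (G t)) \<le> e * norm h"
      by (rule eventually_sequentially_Suc[THEN iffD1])
  qed simp
  then obtain g where g: "\<And>t. t \<in> {a..b} \<Longrightarrow> (\<lambda>k. F k t) sums g t"
      "\<And>t. t \<in> {a..b} \<Longrightarrow> (g has_derivative (\<lambda>h. h *\<^sub>R L t (G t))) (at t within {a..b})" by blast
  have gG: "g t = G t" if "t \<in> {a..b}" for t
    using g(1)[OF that] sumsG[OF that] by (rule sums_unique2)
  \<comment> \<open>Integrals from \<open>a\<close> to \<open>a\<close> vanish, so term 0 alone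
    contributes to the initial value.\<close>
  have "(\<lambda>k. F k a) = (\<lambda>k. if k = 0 then v else 0)"
    by (rule ext) (case_tac k, simp_all add: F0 FS)
  then have "(\<lambda>k. F k a) sums v" using sums_single[of 0 "\<lambda>_. v"] by simp
  then have "g a = v" using g(1)[of a] ab sums_unique2 by fastforce
  then show ?thesis
    using that[of g] g(2) gG by (simp add: has_vector_derivative_def)
qed

section \<open>Directional derivatives\<close>

text \<open>The mean value theorem on the segment from \<open>x\<close> to \<open>y\<close> turns
  the increment of \<open>F\<close> into a directional derivative at an intermediate point, and
  continuity of the \<open>H b\<close> compares it with the one at \<open>x\<close>. Since
  \<open>dir\<close> makes this derivative linear in \<open>h\<close>, a single segment suffices in
  place of a path parallel to the axes.\<close>

lemma has_derivative_of_directional: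
  fixes F :: "'a::euclidean_space \<Rightarrow> real"
  assumes S: "open S" "x \<in> S"
    and dir: "\<And>x h. x \<in> S \<Longrightarrow> ((\<lambda>t. F (x + t *\<^sub>R h)) has_real_derivative (\<Sum>b\<in>Basis. (h \<bullet> b) * H b x)) (at 0)"
    and cont: "\<And>b. b \<in> Basis \<Longrightarrow> continuous_on S (H b)"
  shows "(F has_derivative (\<lambda>h. \<Sum>b\<in>Basis. (h \<bullet> b) * H b x)) (at x)"
  unfolding has_derivative_at_alt
proof (intro conjI allI impI)
  show "bounded_linear (\<lambda>h. \<Sum>b\<in>Basis. (h \<bullet> b) * H b x)"
    by (intro bounded_linear_intros)
  fix e :: real assume e: "e > 0"
  define e' where "e' = e / DIM('a)"
  have e': "e' > 0" using e by (simp add: e'_def)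
  have "\<forall>\<^sub>F y in nhds x. y \<in> S \<and> (\<forall>b\<in>Basis. dist (H b y) (H b x) < e')"
  proof (intro eventually_conj eventually_ball_finite ballI)
    show "\<forall>\<^sub>F y in nhds x. y \<in> S" using S by (simp add: eventually_nhds_in_open)
    fix b :: 'a assume "b \<in> Basis"
    then have "isCont (H b) x" using cont S by (simp add: continuous_on_eq_continuous_at)
    then have "(H b \<longlongrightarrow> H b x) (nhds x)" by (simp only: isCont_def tendsto_at_iff_tendsto_nhds)
    then show "\<forall>\<^sub>F y in nhds x. dist (H b y) (H b x) < e'" using e' by (simp add: tendsto_iff)
  qed simp
  then obtain d where d: "d > 0" "\<And>y. dist y x < d \<Longrightarrow> y \<in> S"
      "\<And>y b. dist y x < d \<Longrightarrow> b \<in> Basis \<Longrightarrow> \<bar>H b y - H b x\<bar> < e'"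
    unfolding eventually_nhds_metric by (auto simp: dist_real_def)
  show "\<exists>d>0. \<forall>y. norm (y - x) < d \<longrightarrow>
      norm (F y - F x - (\<Sum>b\<in>Basis. ((y - x) \<bullet> b) * H b x)) \<le> e * norm (y - x)"
  proof (intro exI conjI allI impI)
    show "d > 0" by fact
    fix y assume y: "norm (y - x) < d"
    define h where "h = y - x"
    have inb: "dist (x + t *\<^sub>R h) x < d" if "0 \<le> t" "t \<le> 1" for t
    proof -
      have "\<bar>t\<bar> * norm h \<le> 1 * norm h" using that by (intro mult_right_mono) auto
      then show ?thesis using y by (simp add: dist_norm h_def)
    qed
    have "((\<lambda>t. F (x + t *\<^sub>R h)) has_real_derivative (\<Sum>b\<in>Basis. (h \<bullet> b) * H b (x + t *\<^sub>R h))) (at t)"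
      if "0 \<le> t" "t \<le> 1" for t
    proof -
      have "((\<lambda>s. F (x + t *\<^sub>R h + s *\<^sub>R h)) has_real_derivative (\<Sum>b\<in>Basis. (h \<bullet> b) * H b (x + t *\<^sub>R h))) (at 0)"
        by (rule dir) (use inb[OF that] d in auto)
      then have "((\<lambda>s. F (x + (s + t) *\<^sub>R h)) has_real_derivative (\<Sum>b\<in>Basis. (h \<bullet> b) * H b (x + t *\<^sub>R h))) (at 0)"
        by (simp add: scaleR_add_left add_ac)
      then show ?thesis using DERIV_shift[of "\<lambda>s. F (x + s *\<^sub>R h)" _ 0 t] by simp
    qed
    then obtain t where t: "0 < t" "t < 1" "F (x + 1 *\<^sub>R h) - F (x + 0 *\<^sub>R h) = (1 - 0) * (\<Sum>b\<in>Basis. (h \<bullet> b) * H b (x + t *\<^sub>R h))"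
      using MVT2[of 0 1 "\<lambda>t. F (x + t *\<^sub>R h)" "\<lambda>t. (\<Sum>b\<in>Basis. (h \<bullet> b) * H b (x + t *\<^sub>R h))"] by auto
    have "F y - F x - (\<Sum>b\<in>Basis. (h \<bullet> b) * H b x) = (\<Sum>b\<in>Basis. (h \<bullet> b) * (H b (x + t *\<^sub>R h) - H b x))"
      using t(3) by (simp add: right_diff_distrib sum_subtractf) (simp add: h_def)
    also have "\<bar>\<dots>\<bar> \<le> (\<Sum>b\<in>Basis. \<bar>(h \<bullet> b) * (H b (x + t *\<^sub>R h) - H b x)\<bar>)" by (rule sum_abs)
    also have "\<dots> \<le> (\<Sum>b\<in>(Basis::'a set). norm h * e')"
      using t inb[of t] d(3)[of "x + t *\<^sub>R h"]
      by (intro sum_mono) (auto simp: abs_mult Basis_le_norm less_imp_le intro!: mult_mono)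
    also have "\<dots> = e * norm h" by (simp add: e'_def)
    finally show "norm (F y - F x - (\<Sum>b\<in>Basis. ((y - x) \<bullet> b) * H b x)) \<le> e * norm (y - x)"
      by (simp add: h_def)
  qed
qed

text \<open>Mean value theorem twice, first in direction \<open>v\<close>, then in direction
  \<open>w\<close>. The second difference is symmetric in \<open>v\<close> and \<open>w\<close>,
  which is what makes mixed derivatives commute.\<close>

lemma second_difference_mvt:
  fixes f :: "'a::real_normed_vector \<Rightarrow> real"
  assumes h: "h > 0"
    and f: "\<And>s t. s \<in> {0..h} \<Longrightarrow> t \<in> {0..h} \<Longrightarrow> (f has_derivative f' (x + s *\<^sub>R v + t *\<^sub>R w)) (at (x + s *\<^sub>R v + t *\<^sub>R w))"
    and f': "\<And>s t. s \<in> {0..h} \<Longrightarrow> t \<in> {0..h} \<Longrightarrow>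
      ((\<lambda>y. f' y v) has_derivative f'' (x + s *\<^sub>R v + t *\<^sub>R w)) (at (x + s *\<^sub>R v + t *\<^sub>R w))"
  obtains s t where "s \<in> {0..h}" "t \<in> {0..h}"
    "f (x + h *\<^sub>R v + h *\<^sub>R w) - f (x + h *\<^sub>R v) - f (x + h *\<^sub>R w) + f x = h * h * f'' (x + s *\<^sub>R v + t *\<^sub>R w) w"
proof -
  have line: "((\<lambda>s. k (p + s *\<^sub>R u)) has_real_derivative k' u) (at s)"
    if "(k has_derivative k') (at (p + s *\<^sub>R u))" for k :: "'a \<Rightarrow> real" and k' p u s
  proof -
    have "((\<lambda>s. p + s *\<^sub>R u) has_derivative (\<lambda>r. r *\<^sub>R u)) (at s)" by (auto intro!: derivative_eq_intros)
    from diff_chain_at[OF this that] have "((\<lambda>s. k (p + s *\<^sub>R u)) has_derivative (\<lambda>r. k' (r *\<^sub>R u))) (at s)"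
      by (simp add: o_def)
    moreover have "k' (r *\<^sub>R u) = k' u * r" for r
      using linear_cmul[OF has_derivative_linear[OF that]] by simp
    ultimately show ?thesis by (simp add: has_field_derivative_def)
  qed
  define g where "g s = f ((x + h *\<^sub>R w) + s *\<^sub>R v) - f (x + s *\<^sub>R v)" for s
  have "(g has_real_derivative (f' (x + s *\<^sub>R v + h *\<^sub>R w) v - f' (x + s *\<^sub>R v + 0 *\<^sub>R w) v)) (at s)"
    if "s \<in> {0..h}" for s
    unfolding g_def using that h f[of s h] f[of s 0]
    by (intro DERIV_diff line) (simp_all add: add_ac)
  then obtain s where s: "0 < s" "s < h"
      "g h - g 0 = (h - 0) * (f' (x + s *\<^sub>R v + h *\<^sub>R w) v - f' (x + s *\<^sub>R v + 0 *\<^sub>R w) v)"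
    using MVT2[OF h, of g "\<lambda>s. f' (x + s *\<^sub>R v + h *\<^sub>R w) v - f' (x + s *\<^sub>R v + 0 *\<^sub>R w) v"] by auto
  have "((\<lambda>t. f' (x + s *\<^sub>R v + t *\<^sub>R w) v) has_real_derivative f'' (x + s *\<^sub>R v + t *\<^sub>R w) w) (at t)"
    if "t \<in> {0..h}" for t
    using that s f' by (intro line) auto
  then obtain t where t: "0 < t" "t < h"
      "f' (x + s *\<^sub>R v + h *\<^sub>R w) v - f' (x + s *\<^sub>R v + 0 *\<^sub>R w) v = (h - 0) * f'' (x + s *\<^sub>R v + t *\<^sub>R w) w"
    using MVT2[OF h, of "\<lambda>t. f' (x + s *\<^sub>R v + t *\<^sub>R w) v" "\<lambda>t. f'' (x + s *\<^sub>R v + t *\<^sub>R w) w"] by auto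
  show ?thesis
  proof (rule that)
    show "s \<in> {0..h}" "t \<in> {0..h}" using s t by auto
    show "f (x + h *\<^sub>R v + h *\<^sub>R w) - f (x + h *\<^sub>R v) - f (x + h *\<^sub>R w) + f x = h * h * f'' (x + s *\<^sub>R v + t *\<^sub>R w) w"
      using s(3) t(3) by (simp add: g_def add_ac)
  qed
qed

text \<open>Schwarz's theorem: the second difference equates one mixed derivative at a point near
  \<open>x\<close> with the other at a second point near \<open>x\<close>, and continuity moves both
  points to \<open>x\<close>.\<close>

lemma second_derivative_symmetric:
  fixes f :: "'a::euclidean_space \<Rightarrow> real"
  assumes "open S" "x \<in> S" "Cinf_on S f"
  shows "frechet_derivative (\<lambda>y. frechet_derivative f (at y) v) (at x) w =
    frechet_derivative (\<lambda>y. frechet_derivative f (at y) w) (at x) v"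
proof -
  define f' where "f' = (\<lambda>y. frechet_derivative f (at y))"
  define f'' where "f'' = (\<lambda>v y. frechet_derivative (\<lambda>y. f' y v) (at y))"
  have f: "(f has_derivative f' y) (at y)" if "y \<in> S" for y
    unfolding f'_def using Cinf_on_has_derivative[OF assms(3) that] .
  have f': "((\<lambda>y. f' y v) has_derivative f'' v y) (at y)" if "y \<in> S" for y v
    unfolding f''_def f'_def
    by (rule Cinf_on_has_derivative[OF Cinf_on_frechet_derivative[OF assms(3)] that])
  have cont: "continuous_on S (\<lambda>y. f'' v y w)" for v w
    unfolding f''_def f'_def
    by (intro Cinf_on_continuous Cinf_on_frechet_derivative assms)
  have "\<bar>f'' v x w - f'' w x v\<bar> \<le> e" if e: "e > 0" for e
  proof -
    have "\<forall>\<^sub>F y in nhds x. y \<in> S \<and> dist (f'' v y w) (f'' v x w) < e / 2 \<and> dist (f'' w y v) (f'' w x v) < e / 2"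
    proof (intro eventually_conj)
      show "\<forall>\<^sub>F y in nhds x. y \<in> S" using assms by (simp add: eventually_nhds_in_open)
      have *: "\<forall>\<^sub>F y in nhds x. dist (f'' v y w) (f'' v x w) < e / 2" for v w
      proof -
        have "isCont (\<lambda>y. f'' v y w) x" using cont assms by (simp add: continuous_on_eq_continuous_at)
        then have "((\<lambda>y. f'' v y w) \<longlongrightarrow> f'' v x w) (nhds x)"
          using tendsto_at_iff_tendsto_nhds[of "\<lambda>y. f'' v y w" x] by (simp add: isCont_def)
        then show ?thesis by (rule tendstoD[OF _ half_gt_zero[OF e]])
      qed
      show "\<forall>\<^sub>F y in nhds x. dist (f'' v y w) (f'' v x w) < e / 2" "\<forall>\<^sub>F y in nhds x. dist (f'' w y v) (f'' w x v) < e / 2"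
        by (rule *)+
    qed
    then obtain d where d: "d > 0" "\<And>y. dist y x < d \<Longrightarrow> y \<in> S"
        "\<And>y. dist y x < d \<Longrightarrow> \<bar>f'' v y w - f'' v x w\<bar> < e / 2"
        "\<And>y. dist y x < d \<Longrightarrow> \<bar>f'' w y v - f'' w x v\<bar> < e / 2"
      unfolding eventually_nhds_metric by (auto simp: dist_real_def)
    \<comment> \<open>Small enough for the parallelogram spanned at \<open>x\<close> by the
      multiples of \<open>v\<close> and \<open>w\<close> to stay within distance \<open>d\<close>;
      the summand 1 covers \<open>v = w = 0\<close>.\<close>
    define h where "h = d / (norm v + norm w + 1)"
    have h: "h > 0" unfolding h_def using d by (intro divide_pos_pos) (auto intro: add_nonneg_pos)
    have near: "dist (x + s *\<^sub>R v + t *\<^sub>R w) x < d" if "s \<in> {0..h}" "t \<in> {0..h}" for s t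
    proof -
      have "dist (x + s *\<^sub>R v + t *\<^sub>R w) x = norm (s *\<^sub>R v + t *\<^sub>R w)" by (simp add: dist_norm)
      also have "\<dots> \<le> s * norm v + t * norm w" using norm_triangle_ineq[of "s *\<^sub>R v" "t *\<^sub>R w"] that by simp
      also have "\<dots> \<le> h * norm v + h * norm w" using that by (intro add_mono mult_right_mono) auto
      also have "\<dots> < h * (norm v + norm w + 1)" using h by (simp add: algebra_simps)
      also have "\<dots> = d" by (simp add: h_def add_nonneg_pos less_imp_neq[symmetric] add_pos_nonneg)
      finally show ?thesis .
    qed
    obtain s t where st: "s \<in> {0..h}" "t \<in> {0..h}"
      "f (x + h *\<^sub>R v + h *\<^sub>R w) - f (x + h *\<^sub>R v) - f (x + h *\<^sub>R w) + f x = h * h * f'' v (x + s *\<^sub>R v + t *\<^sub>R w) w"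
      by (rule second_difference_mvt[OF h, of f f' x v w "f'' v"]) (use near d(2) f f' in blast)+
    have near': "dist (x + s *\<^sub>R w + t *\<^sub>R v) x < d" if "s \<in> {0..h}" "t \<in> {0..h}" for s t
      using near[OF that(2,1)] by (simp add: add_ac)
    obtain s' t' where st': "s' \<in> {0..h}" "t' \<in> {0..h}"
      "f (x + h *\<^sub>R w + h *\<^sub>R v) - f (x + h *\<^sub>R w) - f (x + h *\<^sub>R v) + f x = h * h * f'' w (x + s' *\<^sub>R w + t' *\<^sub>R v) v"
      by (rule second_difference_mvt[OF h, of f f' x w v "f'' w"]) (use near' d(2) f f' in blast)+
    have "h * h * f'' v (x + s *\<^sub>R v + t *\<^sub>R w) w = h * h * f'' w (x + s' *\<^sub>R w + t' *\<^sub>R v) v"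
      using st(3) st'(3) by (simp add: algebra_simps)
    then have "f'' v (x + s *\<^sub>R v + t *\<^sub>R w) w = f'' w (x + s' *\<^sub>R w + t' *\<^sub>R v) v" using h by simp
    then show ?thesis
      using d(3)[OF near[OF st(1,2)]] d(4)[OF near'[OF st'(1,2)]] by linarith
  qed
  then have "\<bar>f'' v x w - f'' w x v\<bar> \<le> 0" by (rule field_le_epsilon[of _ 0, simplified])
  then show ?thesis by (simp add: f''_def f'_def)
qed

section \<open>Tangent vectors in charts\<close>

text \<open>Charts are pairs; quantifiers over charts should not be split.\<close>

declare split_paired_All [simp del] split_paired_Ex [simp del]

lemma tvec_apply [simp]:
  "tadd v w c = v c + w c" "tdiff v w c = v c - w c" "tscale r v c = r *\<^sub>R v c" "tzero c = 0"
  by (simp_all add: tadd_def tdiff_def tscale_def tzero_def)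

locale smooth_manifold =
  fixes A :: "('m::topological_space, 'n::finite) chart set"
  assumes atlas: "smooth_atlas A"
begin

lemma chart_domain_open: "c \<in> A \<Longrightarrow> open (cdom c)"
  using atlas by (auto simp: smooth_atlas_def)

lemma chart_homeomorphism: "c \<in> A \<Longrightarrow> homeomorphism (cdom c) (cmap c ` cdom c) (cmap c) (cinv c)"
  using atlas by (auto simp: smooth_atlas_def)

lemma chart_image_open:
  assumes "c \<in> A" "open U" shows "open (cmap c ` (U \<inter> cdom c))"
proof -
  have "openin (top_of_set (cdom c)) (U \<inter> cdom c)"
    using assms(2) by (metis Int_commute openin_open_Int)
  then have "openin (top_of_set (cmap c ` cdom c)) (cmap c ` (U \<inter> cdom c))"
    using homeomorphism_imp_open_map[OF chart_homeomorphism[OF assms(1)]] by blast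
  moreover have "open (cmap c ` cdom c)" using atlas assms(1) by (auto simp: smooth_atlas_def)
  ultimately show ?thesis using openin_open_eq by blast
qed

lemma chart_image_open': "c \<in> A \<Longrightarrow> open (cmap c ` cdom c)"
  using chart_image_open[of c "cdom c"] chart_domain_open by simp

lemma chart_image_open_Int: "c \<in> A \<Longrightarrow> d \<in> A \<Longrightarrow> open (cmap c ` (cdom c \<inter> cdom d))"
  using chart_image_open[of c "cdom d"] chart_domain_open by (simp add: Int_commute)

lemma cinv_cmap [simp]: "c \<in> A \<Longrightarrow> p \<in> cdom c \<Longrightarrow> cinv c (cmap c p) = p"
  using chart_homeomorphism by (auto simp: homeomorphism_def)

lemma continuous_on_cmap: "c \<in> A \<Longrightarrow> continuous_on (cdom c) (cmap c)"
  using chart_homeomorphism by (auto simp: homeomorphism_def)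

lemma continuous_on_cinv: "c \<in> A \<Longrightarrow> continuous_on (cmap c ` cdom c) (cinv c)"
  using chart_homeomorphism by (auto simp: homeomorphism_def)

lemma transition_smooth:
  "c \<in> A \<Longrightarrow> d \<in> A \<Longrightarrow> Cinf_on (cmap c ` (cdom c \<inter> cdom d)) (\<lambda>x. cmap d (cinv c x))"
  using atlas by (auto simp: smooth_atlas_def)

lemma charts_at_iff: "c \<in> charts_at A p \<longleftrightarrow> c \<in> A \<and> p \<in> cdom c"
  by (simp add: charts_at_def)

lemma chart_at: "chart_at A p \<in> A" "p \<in> cdom (chart_at A p)"
proof -
  have "p \<in> (\<Union>c\<in>A. cdom c)" using atlas by (simp add: smooth_atlas_def)
  then have "\<exists>c. c \<in> charts_at A p" by (auto simp: charts_at_def)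
  then have "chart_at A p \<in> charts_at A p" unfolding chart_at_def by (rule someI_ex)
  then show "chart_at A p \<in> A" "p \<in> cdom (chart_at A p)" by (auto simp: charts_at_def)
qed

lemma trans_deriv:
  assumes "c \<in> A" "d \<in> A" "p \<in> cdom c" "p \<in> cdom d"
  shows "((\<lambda>x. cmap d (cinv c x)) has_derivative trans_deriv c d p) (at (cmap c p))"
  unfolding trans_deriv_def
  by (rule Cinf_on_has_derivative[OF transition_smooth]) (use assms in auto)

lemma trans_deriv_linear:
  assumes "c \<in> A" "d \<in> A" "p \<in> cdom c" "p \<in> cdom d"
  shows "linear (trans_deriv c d p)"
  using has_derivative_linear[OF trans_deriv[OF assms]] .

lemma trans_deriv_self:
  assumes "c \<in> A" "p \<in> cdom c"
  shows "trans_deriv c c p = (\<lambda>x. x)"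
  unfolding trans_deriv_def
proof (rule frechet_derivative_eq)
  show "((\<lambda>x. cmap c (cinv c x)) has_derivative (\<lambda>x. x)) (at (cmap c p))"
    by (rule has_derivative_transform_within_open[OF has_derivative_ident chart_image_open'])
      (use assms in auto)
qed

lemma has_derivative_change_chart:
  assumes c: "c \<in> A" "p \<in> cdom c" and d: "d \<in> A" "p \<in> cdom d"
    and f: "((\<lambda>x. f (cinv c x)) has_derivative F) (at (cmap c p))"
  shows "((\<lambda>x. f (cinv d x)) has_derivative (\<lambda>v. F (trans_deriv d c p v))) (at (cmap d p))"
proof -
  have "((\<lambda>x. f (cinv c x)) has_derivative F) (at (cmap c (cinv d (cmap d p))))"
    using f d by simp
  from diff_chain_at[OF trans_deriv[OF d(1) c(1) d(2) c(2)] this]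
  have "((\<lambda>x. f (cinv c (cmap c (cinv d x)))) has_derivative (\<lambda>v. F (trans_deriv d c p v))) (at (cmap d p))"
    by (simp add: o_def)
  then show ?thesis
    by (rule has_derivative_transform_within_open[OF _ chart_image_open_Int[OF d(1) c(1)]])
      (use c d in auto)
qed

lemma trans_deriv_cocycle:
  assumes "c \<in> A" "p \<in> cdom c" "d \<in> A" "p \<in> cdom d" "e \<in> A" "p \<in> cdom e"
  shows "trans_deriv d e p (trans_deriv c d p v) = trans_deriv c e p v"
proof -
  have "((\<lambda>x. cmap e (cinv c x)) has_derivative (\<lambda>v. trans_deriv d e p (trans_deriv c d p v))) (at (cmap c p))"
    by (rule has_derivative_change_chart[OF assms(3,4,1,2) trans_deriv]) (use assms in auto)
  from frechet_derivative_eq[OF this] show ?thesis unfolding trans_deriv_def[of c e] by simp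
qed

lemma coord_vec_apply [simp]:
  assumes "c \<in> A" "p \<in> cdom c" shows "coord_vec A c p \<xi> c = \<xi>"
  using assms by (simp add: coord_vec_def charts_at_iff trans_deriv_self)

lemma coord_vec_tangent:
  assumes "c \<in> A" "p \<in> cdom c" shows "coord_vec A c p \<xi> \<in> tangent_space A p"
  using assms by (auto simp: tangent_space_def coord_vec_def charts_at_iff trans_deriv_cocycle)

lemma tangent_space_iff:
  "v \<in> tangent_space A p \<longleftrightarrow> (\<forall>c. \<not> (c \<in> A \<and> p \<in> cdom c) \<longrightarrow> v c = 0) \<and>
    (\<forall>c d. c \<in> A \<longrightarrow> p \<in> cdom c \<longrightarrow> d \<in> A \<longrightarrow> p \<in> cdom d \<longrightarrow> v d = trans_deriv c d p (v c))"
  unfolding tangent_space_def by (auto simp: charts_at_iff)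

lemma tangent_change:
  assumes "v \<in> tangent_space A p" "c \<in> A" "p \<in> cdom c" "d \<in> A" "p \<in> cdom d"
  shows "v d = trans_deriv c d p (v c)"
  using assms unfolding tangent_space_iff by blast

lemma tangent_eqI:
  assumes "v \<in> tangent_space A p" "w \<in> tangent_space A p" "c \<in> A" "p \<in> cdom c" "v c = w c"
  shows "v = w"
proof
  fix d
  show "v d = w d"
  proof (cases "d \<in> A \<and> p \<in> cdom d")
    case True
    then show ?thesis using tangent_change[OF assms(1,3,4)] tangent_change[OF assms(2,3,4)] assms(5) by simp
  next
    case False
    then show ?thesis using assms(1,2) unfolding tangent_space_iff by simp
  qed
qed

lemma coord_vec_of_tangent:
  assumes "v \<in> tangent_space A p" "c \<in> A" "p \<in> cdom c"
  shows "coord_vec A c p (v c) = v"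
  using assms by (intro tangent_eqI[OF coord_vec_tangent]) auto

lemma tangent_zero_outside:
  "v \<in> tangent_space A p \<Longrightarrow> \<not> (c \<in> A \<and> p \<in> cdom c) \<Longrightarrow> v c = 0"
  unfolding tangent_space_iff by blast

lemma tangent_spaceI:
  assumes "\<And>c. \<not> (c \<in> A \<and> p \<in> cdom c) \<Longrightarrow> v c = 0"
    "\<And>c d. c \<in> A \<Longrightarrow> p \<in> cdom c \<Longrightarrow> d \<in> A \<Longrightarrow> p \<in> cdom d \<Longrightarrow> v d = trans_deriv c d p (v c)"
  shows "v \<in> tangent_space A p"
  unfolding tangent_space_iff using assms by blast

lemma tangent_space_closed:
  assumes v: "v \<in> tangent_space A p" and w: "w \<in> tangent_space A p"
  shows "tadd v w \<in> tangent_space A p" "tdiff v w \<in> tangent_space A p"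
proof (rule_tac [!] tangent_spaceI)
  fix c d assume cd: "c \<in> A" "p \<in> cdom c" "d \<in> A" "p \<in> cdom d"
  note lin = trans_deriv_linear[OF cd(1,3,2,4)]
  note eq = tangent_change[OF v cd] tangent_change[OF w cd]
  show "tadd v w d = trans_deriv c d p (tadd v w c)" "tdiff v w d = trans_deriv c d p (tdiff v w c)"
    unfolding tvec_apply eq by (simp_all add: linear_add[OF lin] linear_diff[OF lin])
qed (simp_all add: tangent_zero_outside[OF v] tangent_zero_outside[OF w])

lemma tangent_tscale:
  assumes v: "v \<in> tangent_space A p" shows "tscale r v \<in> tangent_space A p"
proof (rule tangent_spaceI)
  fix c d assume cd: "c \<in> A" "p \<in> cdom c" "d \<in> A" "p \<in> cdom d"
  show "tscale r v d = trans_deriv c d p (tscale r v c)"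
    unfolding tvec_apply tangent_change[OF v cd] by (simp add: linear_cmul[OF trans_deriv_linear[OF cd(1,3,2,4)]])
qed (simp add: tangent_zero_outside[OF v])

lemma tzero_tangent: "tzero \<in> tangent_space A p"
  by (rule tangent_spaceI) (simp_all add: linear_0[OF trans_deriv_linear])

lemma coord_vec_linear:
  assumes "c \<in> A" "p \<in> cdom c"
  shows "coord_vec A c p (\<xi> + \<eta>) = tadd (coord_vec A c p \<xi>) (coord_vec A c p \<eta>)"
    "coord_vec A c p (r *\<^sub>R \<xi>) = tscale r (coord_vec A c p \<xi>)"
    "coord_vec A c p 0 = tzero"
  using assms
  by (auto intro!: tangent_eqI[OF _ _ assms] coord_vec_tangent tangent_space_closed tangent_tscale tzero_tangent)

text \<open>Any chart around \<open>p\<close> may replace the arbitrary one in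
  \<open>dir_deriv\<close>: changing the chart puts \<open>trans_deriv\<close> inside the
  derivative, and \<open>tangent_change\<close> absorbs it into the components of
  \<open>v\<close>.\<close>

lemma dir_deriv_eq:
  assumes "c \<in> A" "p \<in> cdom c" "v \<in> tangent_space A p"
    and f: "((\<lambda>x. f (cinv c x)) has_derivative F) (at (cmap c p))"
  shows "dir_deriv A p v f = F (v c)"
proof -
  let ?e = "chart_at A p"
  have "((\<lambda>x. f (cinv ?e x)) has_derivative (\<lambda>v. F (trans_deriv ?e c p v))) (at (cmap ?e p))"
    by (rule has_derivative_change_chart[OF assms(1,2) chart_at f])
  from frechet_derivative_eq[OF this] show ?thesis
    unfolding dir_deriv_def Let_def
    using tangent_change[OF assms(3) chart_at(1)[of p] chart_at(2)[of p] assms(1,2)] by simp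
qed

subsection \<open>Smoothness\<close>

lemma smooth_fun_chartI:
  assumes "c \<in> A" "open U" "U \<subseteq> cdom c" "Cinf_on (cmap c ` U) (\<lambda>x. f (cinv c x))"
  shows "smooth_fun A U f"
  unfolding smooth_fun_def
proof
  fix d assume d: "d \<in> A"
  let ?S = "cmap d ` (U \<inter> cdom d)"
  have S: "open ?S" using chart_image_open d assms(2) by blast
  have "Cinf_on ?S (\<lambda>x. f (cinv c (cmap c (cinv d x))))"
  proof (rule Cinf_on_compose[OF S _ _ _ assms(4)])
    show "open (cmap c ` U)" using chart_image_open[OF assms(1,2)] assms(3) by (simp add: Int_absorb2)
    show "Cinf_on ?S (\<lambda>x. cmap c (cinv d x))"
      by (rule Cinf_on_subset[OF transition_smooth[OF d assms(1)]]) (use assms in auto)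
  qed (use d in auto)
  then show "Cinf_on ?S (\<lambda>x. f (cinv d x))"
    by (rule Cinf_on_cong[OF S, rotated]) (use d assms in auto)
qed

lemma smooth_vfieldD:
  "smooth_vfield A U X \<Longrightarrow> p \<in> U \<Longrightarrow> X p \<in> tangent_space A p"
  "smooth_vfield A U X \<Longrightarrow> c \<in> A \<Longrightarrow> Cinf_on (cmap c ` (U \<inter> cdom c)) (\<lambda>x. X (cinv c x) c)"
  by (auto simp: smooth_vfield_def)

lemma smooth_vfield_chartI:
  assumes c: "c \<in> A" and U: "open U" "U \<subseteq> cdom c"
    and X: "\<And>p. p \<in> U \<Longrightarrow> X p \<in> tangent_space A p" "Cinf_on (cmap c ` U) (\<lambda>x. X (cinv c x) c)"
  shows "smooth_vfield A U X"
  unfolding smooth_vfield_def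
proof (intro conjI ballI)
  fix d assume d: "d \<in> A"
  let ?S = "cmap d ` (U \<inter> cdom d)"
  let ?\<phi> = "\<lambda>x. cmap c (cinv d x)"
  have S: "open ?S" by (rule chart_image_open[OF d U(1)])
  have \<phi>: "Cinf_on ?S ?\<phi>"
    by (rule Cinf_on_subset[OF transition_smooth[OF d c]]) (use U in auto)
  \<comment> \<open>The components in \<open>d\<close> are a derivative at a moving point applied to
    a moving vector; smoothness is known for fixed directions, hence the basis expansion.\<close>
  have "Cinf_on ?S (\<lambda>x. \<Sum>b\<in>Basis. (X (cinv c (?\<phi> x)) c \<bullet> b) *\<^sub>R frechet_derivative (\<lambda>x. cmap d (cinv c x)) (at (?\<phi> x)) b)"
  proof (intro Cinf_on_sum Cinf_on_scaleR Cinf_on_linear_compose[OF _ bounded_linear_inner_left] S)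
    show "Cinf_on ?S (\<lambda>x. X (cinv c (?\<phi> x)) c)"
    proof (rule Cinf_on_compose[OF S _ _ \<phi> X(2)])
      show "open (cmap c ` U)" using chart_image_open[OF c U(1)] U(2) by (simp add: Int_absorb2)
    qed (use d in auto)
    fix b
    show "Cinf_on ?S (\<lambda>x. frechet_derivative (\<lambda>x. cmap d (cinv c x)) (at (?\<phi> x)) b)"
      by (rule Cinf_on_compose[OF S chart_image_open_Int[OF c d] _ \<phi> Cinf_on_frechet_derivative[OF transition_smooth[OF c d]]])
        (use d U in auto)
  qed
  then show "Cinf_on ?S (\<lambda>x. X (cinv d x) d)"
  proof (rule Cinf_on_cong[OF S, rotated])
    fix x assume "x \<in> ?S"
    then obtain p where p: "p \<in> U" "p \<in> cdom d" "p \<in> cdom c" "x = cmap d p" using U by auto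
    have "X p d = trans_deriv c d p (X p c)"
      using tangent_change[OF X(1)[OF p(1)] c p(3) d p(2)] .
    also have "\<dots> = (\<Sum>b\<in>Basis. (X p c \<bullet> b) *\<^sub>R trans_deriv c d p b)"
      by (rule linear_Basis_expand[OF trans_deriv_linear]) (use p c d in auto)
    finally show "(\<Sum>b\<in>Basis. (X (cinv c (?\<phi> x)) c \<bullet> b) *\<^sub>R frechet_derivative (\<lambda>x. cmap d (cinv c x)) (at (?\<phi> x)) b) =
        X (cinv d x) d"
      using p c d by (simp add: trans_deriv_def)
  qed
qed (use X in auto)

lemma coord_field_smooth:
  assumes "c \<in> A" "open U" "U \<subseteq> cdom c"
  shows "smooth_vfield A U (coord_field A c \<xi>)"
proof (rule smooth_vfield_chartI[OF assms])
  show "coord_field A c \<xi> p \<in> tangent_space A p" if "p \<in> U" for p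
    using that assms by (auto simp: coord_field_def intro: coord_vec_tangent)
  have S: "open (cmap c ` U)" using chart_image_open[OF assms(1,2)] assms(3) by (simp add: Int_absorb2)
  show "Cinf_on (cmap c ` U) (\<lambda>x. coord_field A c \<xi> (cinv c x) c)"
    by (rule Cinf_on_cong[OF S _ Cinf_on_const[of _ \<xi>]]) (use assms in \<open>auto simp: coord_field_def\<close>)
qed

lemma smooth_vfield_tadd:
  assumes "open U" "smooth_vfield A U X" "smooth_vfield A U Y"
  shows "smooth_vfield A U (\<lambda>p. tadd (X p) (Y p))"
  using assms unfolding smooth_vfield_def
  by (auto intro!: tangent_space_closed Cinf_on_add chart_image_open)

lemma smooth_vfield_tdiff:
  assumes "open U" "smooth_vfield A U X" "smooth_vfield A U Y"
  shows "smooth_vfield A U (\<lambda>p. tdiff (X p) (Y p))"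
  using assms unfolding smooth_vfield_def
  by (auto intro!: tangent_space_closed Cinf_on_diff chart_image_open)

lemma smooth_vfield_tscale:
  assumes "open U" "smooth_fun A U f" "smooth_vfield A U X"
  shows "smooth_vfield A U (\<lambda>p. tscale (f p) (X p))"
  using assms unfolding smooth_vfield_def smooth_fun_def
  by (auto intro!: tangent_tscale Cinf_on_scaleR chart_image_open)

lemma smooth_vfield_subset:
  "smooth_vfield A U X \<Longrightarrow> V \<subseteq> U \<Longrightarrow> smooth_vfield A V X"
  unfolding smooth_vfield_def by (blast intro: Cinf_on_subset)

lemma smooth_fun_const: "smooth_fun A U (\<lambda>p. r)"
  by (simp add: smooth_fun_def)

lemma smooth_vfield_tzero: "smooth_vfield A U (\<lambda>p. tzero)"
  by (simp add: smooth_vfield_def tzero_tangent)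

lemma coord_field_apply [simp]:
  "c \<in> A \<Longrightarrow> p \<in> cdom c \<Longrightarrow> coord_field A c \<xi> p c = \<xi>"
  by (simp add: coord_field_def)

end

section \<open>Connections in charts\<close>

locale manifold_connection = smooth_manifold A for A :: "('m::topological_space, 'n::finite) chart set" +
  fixes D :: "('m, 'n) connection"
  assumes connection: "affine_connection A D"
begin

lemma
  assumes "open U" "smooth_vfield A U Y" "p \<in> U" "v \<in> tangent_space A p"
  shows D_tangent: "D p v Y \<in> tangent_space A p"
    and D_add_dir: "w \<in> tangent_space A p \<Longrightarrow> D p (tadd v w) Y = tadd (D p v Y) (D p w Y)"
    and D_scale_dir: "D p (tscale r v) Y = tscale r (D p v Y)"
    and D_add: "smooth_vfield A U Z \<Longrightarrow> D p v (\<lambda>q. tadd (Y q) (Z q)) = tadd (D p v Y) (D p v Z)"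
    and D_leibniz: "smooth_fun A U f \<Longrightarrow> D p v (\<lambda>q. tscale (f q) (Y q)) =
      tadd (tscale (dir_deriv A p v f) (Y p)) (tscale (f p) (D p v Y))"
    and D_local: "(\<And>q. q \<in> U \<Longrightarrow> Z q = Y q) \<Longrightarrow> D p v Z = D p v Y"
proof -
  note * = connection[unfolded affine_connection_def, THEN spec, THEN spec, THEN mp, OF conjI[OF assms(1,2)],
      THEN conjunct1, THEN bspec, OF assms(3), THEN bspec, OF assms(4)]
  note 1 = conjunct2[OF *] note 2 = conjunct2[OF 1] note 3 = conjunct2[OF 2] note 4 = conjunct2[OF 3]
  show "D p v Y \<in> tangent_space A p" by (rule conjunct1[OF *])
  show "w \<in> tangent_space A p \<Longrightarrow> D p (tadd v w) Y = tadd (D p v Y) (D p w Y)"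
    by (rule bspec[OF conjunct1[OF 1]])
  show "D p (tscale r v) Y = tscale r (D p v Y)" by (rule spec[OF conjunct1[OF 2]])
  show "smooth_vfield A U Z \<Longrightarrow> D p v (\<lambda>q. tadd (Y q) (Z q)) = tadd (D p v Y) (D p v Z)"
    by (rule mp[OF spec[OF conjunct1[OF 3]]])
  show "smooth_fun A U f \<Longrightarrow> D p v (\<lambda>q. tscale (f q) (Y q)) =
      tadd (tscale (dir_deriv A p v f) (Y p)) (tscale (f p) (D p v Y))"
    by (rule mp[OF spec[OF conjunct1[OF 4]]])
  show "(\<And>q. q \<in> U \<Longrightarrow> Z q = Y q) \<Longrightarrow> D p v Z = D p v Y"
    by (rule mp[OF spec[OF conjunct2[OF 4]]]) simp
qed

lemma D_smooth:
  assumes "open U" "smooth_vfield A U Y" "smooth_vfield A U X"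
  shows "smooth_vfield A U (\<lambda>p. D p (X p) Y)"
  by (rule connection[unfolded affine_connection_def, THEN spec, THEN spec, THEN mp, OF conjI[OF assms(1,2)],
      THEN conjunct2, THEN spec, THEN mp, OF assms(3)])

lemma dir_deriv_const:
  assumes "v \<in> tangent_space A p" shows "dir_deriv A p v (\<lambda>q. k) = 0"
  using dir_deriv_eq[OF chart_at assms, of "\<lambda>q. k" "\<lambda>_. 0"] by simp

text \<open>The Christoffel symbols as a bilinear map in chart coordinates, with k-th component the
  sum of Gamma^k_ij xi^i eta^j; \<open>\<xi>\<close> is the direction and \<open>\<eta>\<close> the
  constant field that is differentiated.\<close>

definition christoffel :: "('m, 'n) chart \<Rightarrow> real^'n \<Rightarrow> real^'n \<Rightarrow> real^'n \<Rightarrow> real^'n" where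
  "christoffel c x \<xi> \<eta> = D (cinv c x) (coord_vec A c (cinv c x) \<xi>) (coord_field A c \<eta>) c"

lemma christoffel_eq:
  assumes "c \<in> A" "p \<in> cdom c" "v \<in> tangent_space A p"
  shows "D p v (coord_field A c \<eta>) c = christoffel c (cmap c p) (v c) \<eta>"
  using assms by (simp add: christoffel_def coord_vec_of_tangent)

lemma coord_field_linear:
  assumes "c \<in> A" "p \<in> cdom c"
  shows "coord_field A c (\<xi> + \<eta>) p = tadd (coord_field A c \<xi> p) (coord_field A c \<eta> p)"
    "coord_field A c (r *\<^sub>R \<xi>) p = tscale r (coord_field A c \<xi> p)"
  unfolding coord_field_def by (rule coord_vec_linear[OF assms])+

lemma christoffel_linear:
  assumes "c \<in> A" "x \<in> cmap c ` cdom c"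
  shows "linear (\<lambda>\<xi>. christoffel c x \<xi> \<eta>)" "linear (christoffel c x \<xi>)"
proof -
  obtain p where p: "p \<in> cdom c" "x = cmap c p" using assms by auto
  note U = chart_domain_open[OF assms(1)]
  note sm = coord_field_smooth[OF assms(1) U order_refl]
  note cv = coord_vec_tangent[OF assms(1) p(1)]
  have inv: "cinv c x = p" using p assms by simp
  show "linear (\<lambda>\<xi>. christoffel c x \<xi> \<eta>)"
    unfolding christoffel_def inv
    by (rule linearI)
      (simp_all add: coord_vec_linear[OF assms(1) p(1)] D_add_dir[OF U sm p(1) cv cv] D_scale_dir[OF U sm p(1) cv])
  show "linear (christoffel c x \<xi>)"
    unfolding christoffel_def inv
  proof (rule linearI)
    fix \<eta> \<zeta> r
    have "D p (coord_vec A c p \<xi>) (coord_field A c (\<eta> + \<zeta>)) =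
        D p (coord_vec A c p \<xi>) (\<lambda>q. tadd (coord_field A c \<eta> q) (coord_field A c \<zeta> q))"
      by (rule D_local[OF U smooth_vfield_tadd[OF U sm sm] p(1) cv]) (rule coord_field_linear[OF assms(1)])
    then show "D p (coord_vec A c p \<xi>) (coord_field A c (\<eta> + \<zeta>)) c =
        D p (coord_vec A c p \<xi>) (coord_field A c \<eta>) c + D p (coord_vec A c p \<xi>) (coord_field A c \<zeta>) c"
      using D_add[OF U sm p(1) cv sm] by simp
    \<comment> \<open>Homogeneity in the field is the Leibniz rule for the constant function
      \<open>r\<close>, whose directional derivative vanishes.\<close>
    have "D p (coord_vec A c p \<xi>) (coord_field A c (r *\<^sub>R \<eta>)) =
        D p (coord_vec A c p \<xi>) (\<lambda>q. tscale r (coord_field A c \<eta> q))"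
      by (rule D_local[OF U smooth_vfield_tscale[OF U smooth_fun_const sm] p(1) cv]) (rule coord_field_linear[OF assms(1)])
    then show "D p (coord_vec A c p \<xi>) (coord_field A c (r *\<^sub>R \<eta>)) c = r *\<^sub>R D p (coord_vec A c p \<xi>) (coord_field A c \<eta>) c"
      using D_leibniz[OF U sm p(1) cv smooth_fun_const[of _ r], of \<xi> \<eta>]
      by (simp add: dir_deriv_const[OF cv])
  qed
qed

lemma christoffel_smooth:
  assumes "c \<in> A" shows "Cinf_on (cmap c ` cdom c) (\<lambda>x. christoffel c x \<xi> \<eta>)"
proof -
  note U = chart_domain_open[OF assms]
  note sm = coord_field_smooth[OF assms U order_refl]
  show ?thesis
    using smooth_vfieldD(2)[OF D_smooth[OF U sm[of \<eta>] sm[of \<xi>]] assms]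
    by (simp add: christoffel_def coord_field_def)
qed

lemma D_tzero:
  assumes "v \<in> tangent_space A p" shows "D p v (\<lambda>q. tzero) = tzero"
proof -
  have "D p v (\<lambda>q. tscale 0 tzero) = tadd (tscale (dir_deriv A p v (\<lambda>q. 0)) tzero) (tscale 0 (D p v (\<lambda>q. tzero)))"
    by (rule D_leibniz[of UNIV]) (simp_all add: smooth_vfield_tzero smooth_fun_const assms)
  moreover have "(\<lambda>q::'m. tscale 0 (tzero::('m, 'n) tvec)) = (\<lambda>q. tzero)" by (auto simp: fun_eq_iff)
  ultimately show ?thesis by (auto simp: fun_eq_iff)
qed

text \<open>Near \<open>p\<close> the field is a combination of coordinate fields with smooth
  coefficients, so locality, additivity and the Leibniz rule reduce \<open>D\<close> to the
  Christoffel symbols.\<close>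

theorem D_in_chart:
  assumes U: "open U" "smooth_vfield A U Y" "p \<in> U" and c: "c \<in> A" "p \<in> cdom c"
    and v: "v \<in> tangent_space A p"
    and F: "((\<lambda>x. Y (cinv c x) c) has_derivative F) (at (cmap c p))"
  shows "D p v Y c = F (v c) + christoffel c (cmap c p) (v c) (Y p c)"
proof -
  define W where "W = U \<inter> cdom c"
  have W: "open W" "W \<subseteq> cdom c" "p \<in> W" "W \<subseteq> U"
    using U c chart_domain_open[OF c(1)] by (auto simp: W_def)
  have YW: "smooth_vfield A W Y" by (rule smooth_vfield_subset[OF U(2) W(4)])
  have S: "open (cmap c ` W)" using chart_image_open[OF c(1) W(1)] W(2) by (simp add: Int_absorb2)
  define y where "y = (\<lambda>b q. Y q c \<bullet> b)"
  have y: "smooth_fun A W (y b)" for b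
    unfolding y_def
    by (intro smooth_fun_chartI[OF c(1) W(1,2)] Cinf_on_linear_compose[OF S bounded_linear_inner_left])
      (use smooth_vfieldD(2)[OF YW c(1)] W(2) in \<open>simp add: Int_absorb2\<close>)
  note sm = coord_field_smooth[OF c(1) W(1,2)]
  have dy: "dir_deriv A p v (y b) = F (v c) \<bullet> b" for b
    using has_derivative_inner_left[OF F, of b] by (intro dir_deriv_eq[OF c v]) (simp add: y_def)
  \<comment> \<open>Partial sums over a set \<open>B\<close> of basis vectors, so that additivity of
    \<open>D\<close>, an axiom for two summands, extends by induction on \<open>B\<close>.\<close>
  define Z where "Z = (\<lambda>B q d. \<Sum>b\<in>B. y b q *\<^sub>R coord_field A c b q d)"
  have Z: "smooth_vfield A W (Z B) \<and> D p v (Z B) c = (\<Sum>b\<in>B. (F (v c) \<bullet> b) *\<^sub>R b + y b p *\<^sub>R christoffel c (cmap c p) (v c) b)"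
    if "finite B" for B
    using that
  proof induction
    case empty
    have Z0: "Z {} = (\<lambda>q. tzero)" by (auto simp: Z_def fun_eq_iff)
    show ?case unfolding Z0 D_tzero[OF v] by (simp add: smooth_vfield_tzero del: tvec_apply) simp
  next
    case (insert b B)
    have eq: "Z (insert b B) = (\<lambda>q. tadd (tscale (y b q) (coord_field A c b q)) (Z B q))"
      by (simp only: Z_def sum.insert[OF insert.hyps] tadd_def tscale_def)
    note sm1 = smooth_vfield_tscale[OF W(1) y[of b] sm[of b]]
    have "D p v (Z (insert b B)) = tadd (D p v (\<lambda>q. tscale (y b q) (coord_field A c b q))) (D p v (Z B))"
      unfolding eq by (rule D_add[OF W(1) sm1 W(3) v]) (use insert.IH in blast)
    also have "D p v (\<lambda>q. tscale (y b q) (coord_field A c b q)) =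
        tadd (tscale (F (v c) \<bullet> b) (coord_field A c b p)) (tscale (y b p) (D p v (coord_field A c b)))"
      unfolding D_leibniz[OF W(1) sm[of b] W(3) v y[of b]] dy ..
    finally have "D p v (Z (insert b B)) c = (F (v c) \<bullet> b) *\<^sub>R b + y b p *\<^sub>R christoffel c (cmap c p) (v c) b + D p v (Z B) c"
      using christoffel_eq[OF c v] c by simp
    moreover have "smooth_vfield A W (Z (insert b B))"
      unfolding eq by (rule smooth_vfield_tadd[OF W(1) sm1]) (use insert.IH in blast)
    ultimately show ?case using insert by simp
  qed
  have ZY: "Z Basis q = Y q" if "q \<in> W" for q
  proof (rule tangent_eqI)
    show "Z Basis q \<in> tangent_space A q" using Z[of Basis] smooth_vfieldD(1)[of W "Z Basis"] that by simp
    show "Y q \<in> tangent_space A q" by (rule smooth_vfieldD(1)[OF YW that])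
    show "c \<in> A" "q \<in> cdom c" using c W that by auto
    then show "Z Basis q c = Y q c" by (simp add: Z_def y_def euclidean_representation)
  qed
  have "D p v Y c = D p v (Z Basis) c"
    using D_local[OF W(1) YW W(3) v, of "Z Basis"] ZY by simp
  also have "\<dots> = F (v c) + (\<Sum>b\<in>Basis. (Y p c \<bullet> b) *\<^sub>R christoffel c (cmap c p) (v c) b)"
    using Z[of Basis] by (simp add: sum.distrib euclidean_representation y_def)
  also have "\<dots> = F (v c) + christoffel c (cmap c p) (v c) (Y p c)"
    using linear_Basis_expand[OF christoffel_linear(2)[OF c(1)], of "cmap c p" "v c" "Y p c"] c(2) by auto
  finally show ?thesis .
qed

lemma christoffel_symmetric:
  assumes "torsion_free A D" "c \<in> A" "x \<in> cmap c ` cdom c"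
  shows "christoffel c x \<xi> \<eta> = christoffel c x \<eta> \<xi>"
proof -
  obtain p where p: "p \<in> cdom c" "x = cmap c p" using assms by auto
  note U = chart_domain_open[OF assms(2)]
  note sm = coord_field_smooth[OF assms(2) U order_refl]
  \<comment> \<open>Coordinate fields have constant components in their own chart, so both terms of
    their bracket vanish there.\<close>
  have *: "dir_deriv A p v (\<lambda>q. coord_field A c \<zeta> q c) = 0" if "v \<in> tangent_space A p" for v \<zeta>
  proof -
    have "((\<lambda>x. coord_field A c \<zeta> (cinv c x) c) has_derivative (\<lambda>_. 0)) (at (cmap c p))"
      by (rule has_derivative_transform_within_open[OF has_derivative_const[of \<zeta>] chart_image_open'[OF assms(2)]])
        (use p assms(2) in auto)
    from dir_deriv_eq[OF assms(2) p(1) that this] show ?thesis by simp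
  qed
  have t: "coord_field A c \<zeta> p \<in> tangent_space A p" for \<zeta>
    unfolding coord_field_def by (rule coord_vec_tangent[OF assms(2) p(1)])
  have "tdiff (D p (coord_field A c \<xi> p) (coord_field A c \<eta>)) (D p (coord_field A c \<eta> p) (coord_field A c \<xi>)) =
      lie_bracket A (coord_field A c \<xi>) (coord_field A c \<eta>) p"
    using assms(1) U sm p(1) unfolding torsion_free_def by blast
  from fun_cong[OF this, of c] show ?thesis
    using p assms(2) by (simp add: lie_bracket_def charts_at_iff *[OF t] christoffel_eq[OF assms(2) p(1) t])
qed

text \<open>Torsion freeness rewrites the bracket as a difference of covariant derivatives. That
  difference is known to be a tangent vector, so its vanishing in the single chart \<open>c\<close>
  carries over to all charts.\<close>

lemma lie_bracket_coord_field:
  assumes "torsion_free A D" "c \<in> A" "p \<in> cdom c"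
  shows "lie_bracket A (coord_field A c \<xi>) (coord_field A c \<eta>) p = tzero"
proof -
  note U = chart_domain_open[OF assms(2)]
  note sm = coord_field_smooth[OF assms(2) U order_refl]
  have t: "coord_field A c \<zeta> p \<in> tangent_space A p" for \<zeta>
    unfolding coord_field_def by (rule coord_vec_tangent[OF assms(2,3)])
  have "lie_bracket A (coord_field A c \<xi>) (coord_field A c \<eta>) p =
      tdiff (D p (coord_field A c \<xi> p) (coord_field A c \<eta>)) (D p (coord_field A c \<eta> p) (coord_field A c \<xi>))"
    using assms(1,3) U sm unfolding torsion_free_def by metis
  moreover have "\<dots> = tzero"
  proof (rule tangent_eqI[OF _ tzero_tangent assms(2,3)])
    show "tdiff (D p (coord_field A c \<xi> p) (coord_field A c \<eta>)) (D p (coord_field A c \<eta> p) (coord_field A c \<xi>)) \<in> tangent_space A p"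
      by (intro tangent_space_closed D_tangent[OF U sm assms(3) t])
    show "tdiff (D p (coord_field A c \<xi> p) (coord_field A c \<eta>)) (D p (coord_field A c \<eta> p) (coord_field A c \<xi>)) c = tzero c"
      using christoffel_symmetric[OF assms(1,2), of "cmap c p" \<xi> \<eta>] assms(2,3)
      by (simp add: christoffel_eq[OF assms(2,3) t])
  qed
  ultimately show ?thesis by simp
qed

end

section \<open>The weighted connection\<close>

text \<open>The correction by \<open>\<alpha>\<close> is tensorial in both arguments, so the
  derivative term of the Leibniz rule comes from \<open>D\<close> alone.\<close>

lemma weighted_connection_affine:
  assumes "smooth_atlas A" "affine_connection A D" "one_form A \<alpha>"
  shows "affine_connection A (weighted_connection D \<alpha>)"
proof -
  interpret manifold_connection A D by unfold_locales (use assms in auto)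
  have \<alpha>: "\<alpha> p (tadd v w) = \<alpha> p v + \<alpha> p w" "\<alpha> p (tscale r v) = r * \<alpha> p v"
    if "v \<in> tangent_space A p" "w \<in> tangent_space A p" for p v w r
    using assms(3)[unfolded one_form_def, THEN conjunct1, THEN spec, THEN bspec, OF that(1), THEN bspec, OF that(2)]
    by simp_all
  have \<alpha>s: "smooth_fun A U (\<lambda>p. \<alpha> p (X p))" if "open U" "smooth_vfield A U X" for U X
    using assms(3)[unfolded one_form_def, THEN conjunct2, THEN spec, THEN spec, THEN mp, OF conjI[OF that]] .
  show ?thesis
    unfolding affine_connection_def
  proof (intro allI impI conjI ballI; (elim conjE)?)
    fix U Y assume U: "open U" "smooth_vfield A U Y"
    show "smooth_vfield A U (\<lambda>p. weighted_connection D \<alpha> p (X p) Y)" if "smooth_vfield A U X" for X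
      unfolding weighted_connection_def using U that
      by (intro smooth_vfield_tdiff smooth_vfield_tscale D_smooth \<alpha>s)
    fix p v assume p: "p \<in> U" "v \<in> tangent_space A p"
    note Yp = smooth_vfieldD(1)[OF U(2) p(1)]
    show "weighted_connection D \<alpha> p v Y \<in> tangent_space A p"
      unfolding weighted_connection_def
      by (intro tangent_space_closed tangent_tscale D_tangent[OF U p] Yp p)
    show "weighted_connection D \<alpha> p (tadd v w) Y = tadd (weighted_connection D \<alpha> p v Y) (weighted_connection D \<alpha> p w Y)"
      if "w \<in> tangent_space A p" for w
      unfolding weighted_connection_def
      by (auto simp: fun_eq_iff D_add_dir[OF U p that] \<alpha>[OF p(2) that] algebra_simps)
    show "weighted_connection D \<alpha> p (tscale r v) Y = tscale r (weighted_connection D \<alpha> p v Y)" for r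
      unfolding weighted_connection_def
      by (auto simp: fun_eq_iff D_scale_dir[OF U p] \<alpha>[OF p(2,2)] algebra_simps)
    show "weighted_connection D \<alpha> p v (\<lambda>q. tadd (Y q) (Z q)) =
        tadd (weighted_connection D \<alpha> p v Y) (weighted_connection D \<alpha> p v Z)" if "smooth_vfield A U Z" for Z
      unfolding weighted_connection_def
      by (auto simp: fun_eq_iff D_add[OF U p that] \<alpha>[OF Yp smooth_vfieldD(1)[OF that p(1)]] algebra_simps)
    show "weighted_connection D \<alpha> p v (\<lambda>q. tscale (f q) (Y q)) =
        tadd (tscale (dir_deriv A p v f) (Y p)) (tscale (f p) (weighted_connection D \<alpha> p v Y))" if "smooth_fun A U f" for f
      unfolding weighted_connection_def
      by (auto simp: fun_eq_iff D_leibniz[OF U p that] \<alpha>[OF Yp Yp] algebra_simps)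
    show "weighted_connection D \<alpha> p v Z = weighted_connection D \<alpha> p v Y" if "\<forall>q\<in>U. Z q = Y q" for Z
      unfolding weighted_connection_def using D_local[OF U p, of Z] that p(1) by simp
  qed
qed

text \<open>The correction is symmetric in the two fields and cancels in the difference.\<close>

lemma weighted_connection_torsion_free:
  assumes "torsion_free A D"
  shows "torsion_free A (weighted_connection D \<alpha>)"
  unfolding torsion_free_def
proof (intro allI impI ballI)
  fix U X Y p assume H: "open U \<and> smooth_vfield A U X \<and> smooth_vfield A U Y" "p \<in> U"
  have "tdiff (weighted_connection D \<alpha> p (X p) Y) (weighted_connection D \<alpha> p (Y p) X) =
      tdiff (D p (X p) Y) (D p (Y p) X)"
    unfolding weighted_connection_def by (rule ext) (simp only: tvec_apply, simp)
  also have "\<dots> = lie_bracket A X Y p"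
    by (rule assms[unfolded torsion_free_def, THEN spec, THEN spec, THEN spec, THEN mp, OF H(1), THEN bspec, OF H(2)])
  finally show "tdiff (weighted_connection D \<alpha> p (X p) Y) (weighted_connection D \<alpha> p (Y p) X) = lie_bracket A X Y p" .
qed

section \<open>Piecewise curves\<close>

text \<open>Inductive stand-in for partitions: concatenation becomes transitivity, and index
  bookkeeping is confined to \<open>pieces_iff_partition\<close>. A degenerate interval has zero
  pieces.\<close>

inductive pieces :: "(real \<Rightarrow> real \<Rightarrow> bool) \<Rightarrow> real \<Rightarrow> real \<Rightarrow> bool" for Q where
  pieces_refl: "pieces Q a a"
| pieces_step: "pieces Q a b \<Longrightarrow> b < c \<Longrightarrow> Q b c \<Longrightarrow> pieces Q a c"

lemma pieces_le: "pieces Q a b \<Longrightarrow> a \<le> b"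
  by (induction rule: pieces.induct) auto

lemma pieces_single: "a < b \<Longrightarrow> Q a b \<Longrightarrow> pieces Q a b"
  by (rule pieces_step[OF pieces_refl])

lemma pieces_trans: "pieces Q b c \<Longrightarrow> pieces Q a b \<Longrightarrow> pieces Q a c"
  by (induction rule: pieces.induct) (auto intro: pieces_step)

lemma pieces_mono:
  assumes "pieces Q a b" "\<And>s t. a \<le> s \<Longrightarrow> s < t \<Longrightarrow> t \<le> b \<Longrightarrow> Q s t \<Longrightarrow> R s t"
  shows "pieces R a b"
  using assms
proof (induction rule: pieces.induct)
  case (pieces_step a b c)
  have "pieces R a b" by (rule pieces_step.IH) (use pieces_step in auto)
  then show ?case by (rule pieces.pieces_step) (use pieces_step pieces_le in auto)
qed (rule pieces_refl)

lemma pieces_affine: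
  assumes "pieces Q a b" "m > 0"
    "\<And>s t. a \<le> s \<Longrightarrow> s < t \<Longrightarrow> t \<le> b \<Longrightarrow> Q s t \<Longrightarrow> R (m * s + k) (m * t + k)"
  shows "pieces R (m * a + k) (m * b + k)"
  using assms(1,3)
proof (induction rule: pieces.induct)
  case (pieces_step a b c)
  have "pieces R (m * a + k) (m * b + k)" by (rule pieces_step.IH) (use pieces_step in auto)
  then show ?case by (rule pieces.pieces_step) (use pieces_step pieces_le assms(2) in auto)
qed (rule pieces_refl)

lemma pieces_iff_partition:
  "pieces Q a b \<longleftrightarrow> (\<exists>k \<tau>. \<tau> 0 = a \<and> \<tau> k = b \<and> (\<forall>i<k. \<tau> i < \<tau> (Suc i) \<and> Q (\<tau> i) (\<tau> (Suc i))))"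
proof
  assume "pieces Q a b"
  then show "\<exists>k \<tau>. \<tau> 0 = a \<and> \<tau> k = b \<and> (\<forall>i<k. \<tau> i < \<tau> (Suc i) \<and> Q (\<tau> i) (\<tau> (Suc i)))"
  proof (induction rule: pieces.induct)
    case (pieces_refl a)
    show ?case by (rule exI[of _ 0]) auto
  next
    case (pieces_step a b c)
    then obtain k \<tau> where "\<tau> 0 = a" "\<tau> k = b" "\<forall>i<k. \<tau> i < \<tau> (Suc i) \<and> Q (\<tau> i) (\<tau> (Suc i))" by blast
    then show ?case using pieces_step
      by (intro exI[of _ "Suc k"] exI[of _ "\<tau>(Suc k := c)"]) (auto simp: less_Suc_eq)
  qed
next
  assume "\<exists>k \<tau>. \<tau> 0 = a \<and> \<tau> k = b \<and> (\<forall>i<k. \<tau> i < \<tau> (Suc i) \<and> Q (\<tau> i) (\<tau> (Suc i)))"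
  then obtain k \<tau> where \<tau>: "\<tau> 0 = a" "\<tau> k = b" "\<And>i. i < k \<Longrightarrow> \<tau> i < \<tau> (Suc i) \<and> Q (\<tau> i) (\<tau> (Suc i))" by blast
  have "j \<le> k \<Longrightarrow> pieces Q a (\<tau> j)" for j
  proof (induction j)
    case (Suc j)
    then show ?case using \<tau>(3)[of j] by (auto intro: pieces_step)
  qed (simp add: \<tau> pieces_refl)
  then show "pieces Q a b" using \<tau>(2) by blast
qed

text \<open>Heredity of \<open>Q\<close> gives one piece ending and one piece beginning at
  \<open>x\<close>, whether or not \<open>x\<close> is a break point. Bisection arguments need
  exactly this local form.\<close>

lemma pieces_local:
  assumes "pieces Q a b" and sub: "\<And>s t s' t'. Q s t \<Longrightarrow> s \<le> s' \<Longrightarrow> s' < t' \<Longrightarrow> t' \<le> t \<Longrightarrow> Q s' t'"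
    and "a \<le> x" "x \<le> b"
  shows "\<exists>d>0. (\<forall>s. a \<le> s \<longrightarrow> s < x \<longrightarrow> x - s < d \<longrightarrow> Q s x) \<and>
    (\<forall>t. x < t \<longrightarrow> t \<le> b \<longrightarrow> t - x < d \<longrightarrow> Q x t)"
  using assms(1,3,4)
proof (induction rule: pieces.induct)
  case (pieces_refl a)
  then show ?case by (intro exI[of _ 1]) auto
next
  case (pieces_step a b c)
  consider "x < b" | "x = b" | "x > b" by linarith
  then show ?case
  proof cases
    case 1
    then obtain d where d: "d > 0" "\<forall>s. a \<le> s \<longrightarrow> s < x \<longrightarrow> x - s < d \<longrightarrow> Q s x"
        "\<forall>t. x < t \<longrightarrow> t \<le> b \<longrightarrow> t - x < d \<longrightarrow> Q x t"
      using pieces_step by auto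
    then show ?thesis using 1 by (intro exI[of _ "min d (b - x)"]) auto
  next
    case 2
    then obtain d where d: "d > 0" "\<forall>s. a \<le> s \<longrightarrow> s < x \<longrightarrow> x - s < d \<longrightarrow> Q s x"
      using pieces_step by auto
    then show ?thesis using 2 sub[OF pieces_step(3)] by (intro exI[of _ d]) auto
  next
    case 3
    then show ?thesis using sub[OF pieces_step(3)] pieces_step.prems by (intro exI[of _ "x - b"]) auto
  qed
qed

section \<open>Curves and their velocities\<close>

lemma curve_stays_near:
  fixes \<gamma> :: "real \<Rightarrow> 'm::topological_space"
  assumes "continuous_on {a..b} \<gamma>" "t \<in> {a..b}" "open W" "\<gamma> t \<in> W"
  obtains d where "d > 0" "\<And>s. s \<in> {a..b} \<Longrightarrow> dist s t < d \<Longrightarrow> \<gamma> s \<in> W"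
proof -
  have "(\<gamma> \<longlongrightarrow> \<gamma> t) (at t within {a..b})" using assms(1,2) by (simp add: continuous_on)
  then have "\<forall>\<^sub>F s in at t within {a..b}. \<gamma> s \<in> W" using assms(3,4) by (rule topological_tendstoD)
  then obtain d where "d > 0" "\<And>s. s \<in> {a..b} \<Longrightarrow> s \<noteq> t \<Longrightarrow> dist s t < d \<Longrightarrow> \<gamma> s \<in> W"
    by (auto simp: eventually_at)
  then show ?thesis using that[of d] assms(4) by metis
qed

lemma has_vector_derivative_compose_at:
  assumes "(f has_vector_derivative f') (at x within S)" "(g has_derivative g') (at (f x))"
  shows "((\<lambda>s. g (f s)) has_vector_derivative g' f') (at x within S)"
  using vector_derivative_diff_chain_within[OF assms(1) has_derivative_at_withinI[OF assms(2)]]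
  by (simp add: o_def)

lemma has_vector_derivative_affine_within:
  assumes "(f has_vector_derivative f') (at (m * t + k) within {a'..b'})" "m > 0"
    "a' \<le> m * a + k" "m * b + k \<le> b'" "t \<in> {a..b}"
    and h: "\<And>s. s \<in> {a..b} \<Longrightarrow> h s = f (m * s + k)"
  shows "(h has_vector_derivative m *\<^sub>R f') (at t within {a..b})"
proof -
  have sub: "(\<lambda>s. m * s + k) ` {a..b} \<subseteq> {a'..b'}"
  proof safe
    fix s assume "s \<in> {a..b}"
    then have "m * a \<le> m * s" "m * s \<le> m * b" using assms(2) by auto
    then show "m * s + k \<in> {a'..b'}" using assms(3,4) by auto
  qed
  have "((\<lambda>s. m * s + k) has_vector_derivative m) (at t within {a..b})"
    by (auto intro!: derivative_eq_intros)
  from vector_diff_chain_within[OF this has_vector_derivative_within_subset[OF assms(1) sub]]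
  have "((\<lambda>s. f (m * s + k)) has_vector_derivative m *\<^sub>R f') (at t within {a..b})" by (simp add: o_def)
  then show ?thesis by (rule has_vector_derivative_transform[OF assms(5), rotated]) (rule h)
qed

context smooth_manifold
begin

lemma C1_curve_continuous: "C1_curve A \<gamma> a b \<Longrightarrow> continuous_on {a..b} \<gamma>"
  by (simp add: C1_curve_def)

lemma C1_curve_velocity:
  assumes "C1_curve A \<gamma> a b" "c \<in> A" "t \<in> {a..b}" "\<gamma> t \<in> cdom c"
  shows "((\<lambda>s. cmap c (\<gamma> s)) has_vector_derivative velocity A \<gamma> a b t c) (at t within {a..b})"
proof -
  have "(\<lambda>s. cmap c (\<gamma> s)) differentiable (at t within {a..b})"
    using assms by (simp add: C1_curve_def Let_def)
  then show ?thesis using assms by (simp add: velocity_def charts_at_iff vector_derivative_works)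
qed

lemma C1_curve_velocity_continuous:
  assumes "C1_curve A \<gamma> a b" "c \<in> A" "T \<subseteq> {a..b}" "\<And>t. t \<in> T \<Longrightarrow> \<gamma> t \<in> cdom c"
  shows "continuous_on T (\<lambda>t. velocity A \<gamma> a b t c)"
proof -
  have "continuous_on {t \<in> {a..b}. \<gamma> t \<in> cdom c} (\<lambda>t. vector_derivative (\<lambda>s. cmap c (\<gamma> s)) (at t within {a..b}))"
    using assms by (simp add: C1_curve_def Let_def)
  then have "continuous_on T (\<lambda>t. vector_derivative (\<lambda>s. cmap c (\<gamma> s)) (at t within {a..b}))"
    by (rule continuous_on_subset) (use assms in auto)
  then show ?thesis
    by (rule continuous_on_eq) (use assms in \<open>simp add: velocity_def charts_at_iff\<close>)
qed

lemma C1_curveI: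
  assumes ab: "a < b" and cont: "continuous_on {a..b} \<gamma>"
    and d: "\<And>c t. c \<in> A \<Longrightarrow> t \<in> {a..b} \<Longrightarrow> \<gamma> t \<in> cdom c \<Longrightarrow>
      ((\<lambda>s. cmap c (\<gamma> s)) has_vector_derivative w c t) (at t within {a..b})"
    and w: "\<And>c. c \<in> A \<Longrightarrow> continuous_on {t \<in> {a..b}. \<gamma> t \<in> cdom c} (w c)"
  shows "C1_curve A \<gamma> a b"
  unfolding C1_curve_def Let_def
proof (intro conjI ballI)
  show "continuous_on {a..b} \<gamma>" by (rule cont)
  fix c assume c: "c \<in> A"
  show "(\<lambda>s. cmap c (\<gamma> s)) differentiable (at t within {a..b})" if "t \<in> {t \<in> {a..b}. \<gamma> t \<in> cdom c}" for t
    using d[OF c] that by (auto intro: differentiableI_vector)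
  show "continuous_on {t \<in> {a..b}. \<gamma> t \<in> cdom c} (\<lambda>t. vector_derivative (\<lambda>s. cmap c (\<gamma> s)) (at t within {a..b}))"
    by (rule continuous_on_eq[OF w[OF c]])
      (use vector_derivative_within_closed_interval[OF ab _ d[OF c]] in auto)
qed

text \<open>A derivative within the interval is local in \<open>t\<close>, and continuity keeps the
  curve in \<open>cdom c\<close> and \<open>W\<close> near \<open>t\<close>; a coordinate formula
  for \<open>h\<close> valid only there is therefore enough.\<close>

lemma transition_along_curve:
  assumes \<gamma>: "continuous_on {a..b} \<gamma>" "t \<in> {a..b}" and c: "c \<in> A" "\<gamma> t \<in> cdom c"
    and f: "((\<lambda>s. f (cmap c (\<gamma> s)) s) has_vector_derivative f') (at t within {a..b})"
    and h: "\<And>s. s \<in> {a..b} \<Longrightarrow> \<gamma> s \<in> cdom c \<Longrightarrow> \<gamma> s \<in> W \<Longrightarrow> h s = f (cmap c (\<gamma> s)) s"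
    and W: "open W" "\<gamma> t \<in> W"
  shows "(h has_vector_derivative f') (at t within {a..b})"
proof -
  obtain d where d: "d > 0" "\<And>s. s \<in> {a..b} \<Longrightarrow> dist s t < d \<Longrightarrow> \<gamma> s \<in> W \<inter> cdom c"
    using curve_stays_near[OF \<gamma>, of "W \<inter> cdom c"] W c chart_domain_open[OF c(1)] by auto
  show ?thesis
    by (rule has_vector_derivative_transform_within[OF f d(1) \<gamma>(2)]) (use d h in auto)
qed

lemma velocity_tangent:
  assumes "a < b" "C1_curve A \<gamma> a b" "t \<in> {a..b}"
  shows "velocity A \<gamma> a b t \<in> tangent_space A (\<gamma> t)"
proof (rule tangent_spaceI)
  fix c d assume cd: "c \<in> A" "\<gamma> t \<in> cdom c" "d \<in> A" "\<gamma> t \<in> cdom d"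
  have "((\<lambda>s. cmap d (cinv c (cmap c (\<gamma> s)))) has_vector_derivative
      trans_deriv c d (\<gamma> t) (velocity A \<gamma> a b t c)) (at t within {a..b})"
    by (rule has_vector_derivative_compose_at[OF C1_curve_velocity[OF assms(2) cd(1) assms(3) cd(2)] trans_deriv])
      (use cd in auto)
  then have "((\<lambda>s. cmap d (\<gamma> s)) has_vector_derivative trans_deriv c d (\<gamma> t) (velocity A \<gamma> a b t c)) (at t within {a..b})"
    by (rule transition_along_curve[OF C1_curve_continuous[OF assms(2)] assms(3) cd(1,2),
          of "\<lambda>x s. cmap d (cinv c x)" _ UNIV]) (use cd in auto)
  from vector_derivative_within_closed_interval[OF assms(1,3) this] cd
  show "velocity A \<gamma> a b t d = trans_deriv c d (\<gamma> t) (velocity A \<gamma> a b t c)"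
    by (simp add: velocity_def charts_at_iff)
qed (auto simp: velocity_def charts_at_iff)

lemma velocity_eqI:
  assumes "a < b" "C1_curve A \<gamma> a b" "t \<in> {a..b}" "v \<in> tangent_space A (\<gamma> t)" "c \<in> A" "\<gamma> t \<in> cdom c"
    "((\<lambda>s. cmap c (\<gamma> s)) has_vector_derivative v c) (at t within {a..b})"
  shows "velocity A \<gamma> a b t = v"
  using vector_derivative_within_closed_interval[OF assms(1,3,7)] assms
  by (intro tangent_eqI[OF velocity_tangent]) (auto simp: velocity_def charts_at_iff)

text \<open>Besides rescaling and shifting, this covers restriction to a subinterval
  (\<open>m = 1\<close>, \<open>k = 0\<close>) and replacement of the curve by one that agrees with
  it on the interval.\<close>

lemma C1_curve_reparam:
  assumes ab: "a < b" "m > 0" "a' \<le> m * a + k" "m * b + k \<le> b'" and \<gamma>: "C1_curve A \<gamma> a' b'"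
    and \<delta>: "\<And>s. s \<in> {a..b} \<Longrightarrow> \<delta> s = \<gamma> (m * s + k)"
  shows "C1_curve A \<delta> a b" "\<And>t. t \<in> {a..b} \<Longrightarrow> velocity A \<delta> a b t = tscale m (velocity A \<gamma> a' b' (m * t + k))"
proof -
  have sub: "m * s + k \<in> {a'..b'}" if "s \<in> {a..b}" for s
  proof -
    have "m * a \<le> m * s" "m * s \<le> m * b" using that ab by auto
    then show ?thesis using ab(3,4) unfolding atLeastAtMost_iff by linarith
  qed
  have ab': "a' < b'" using mult_strict_left_mono[OF ab(1,2)] ab(3,4) by linarith
  have d: "((\<lambda>s. cmap c (\<delta> s)) has_vector_derivative m *\<^sub>R velocity A \<gamma> a' b' (m * t + k) c) (at t within {a..b})"
    if "c \<in> A" "t \<in> {a..b}" "\<delta> t \<in> cdom c" for c t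
    by (rule has_vector_derivative_affine_within[OF C1_curve_velocity[OF \<gamma>] ab(2-4)])
      (use that \<delta> sub in auto)
  have aff: "continuous_on X (\<lambda>s. m * s + k)" for X by (intro continuous_intros)
  show C: "C1_curve A \<delta> a b"
  proof (rule C1_curveI[OF ab(1) _ d])
    have "continuous_on {a..b} (\<lambda>s. \<gamma> (m * s + k))"
      by (rule continuous_on_compose2[OF C1_curve_continuous[OF \<gamma>] aff]) (use sub in auto)
    then show "continuous_on {a..b} \<delta>" by (rule continuous_on_eq) (use \<delta> in auto)
    show "continuous_on {t \<in> {a..b}. \<delta> t \<in> cdom c} (\<lambda>t. m *\<^sub>R velocity A \<gamma> a' b' (m * t + k) c)" if "c \<in> A" for c
      by (intro continuous_intros continuous_on_compose2[OF C1_curve_velocity_continuous[OF \<gamma> that, of "{t \<in> {a'..b'}. \<gamma> t \<in> cdom c}"] aff])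
        (use sub \<delta> in auto)
  qed auto
  show "velocity A \<delta> a b t = tscale m (velocity A \<gamma> a' b' (m * t + k))" if "t \<in> {a..b}" for t
  proof (rule velocity_eqI[OF ab(1) C that _ chart_at(1)[of "\<delta> t"] chart_at(2)])
    show "tscale m (velocity A \<gamma> a' b' (m * t + k)) \<in> tangent_space A (\<delta> t)"
      using velocity_tangent[OF ab' \<gamma> sub[OF that]] \<delta>[OF that] by (simp add: tangent_tscale)
    show "((\<lambda>s. cmap (chart_at A (\<delta> t)) (\<delta> s)) has_vector_derivative tscale m (velocity A \<gamma> a' b' (m * t + k)) (chart_at A (\<delta> t))) (at t within {a..b})"
      using d[OF chart_at(1) that chart_at(2)] by simp
  qed
qed

lemma C1_chart_segment:
  assumes c: "c \<in> A" and ab: "a < b" and seg: "\<And>t. t \<in> {a..b} \<Longrightarrow> x + t *\<^sub>R h \<in> cmap c ` cdom c"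
  shows "C1_curve A (\<lambda>t. cinv c (x + t *\<^sub>R h)) a b"
    "\<And>t. t \<in> {a..b} \<Longrightarrow> velocity A (\<lambda>t. cinv c (x + t *\<^sub>R h)) a b t c = h"
proof -
  let ?\<gamma> = "\<lambda>t. cinv c (x + t *\<^sub>R h)"
  have \<gamma>: "?\<gamma> t \<in> cdom c" "cmap c (?\<gamma> t) = x + t *\<^sub>R h" if "t \<in> {a..b}" for t
    using seg[OF that] c by auto
  have lin: "((\<lambda>t. x + t *\<^sub>R h) has_vector_derivative h) (at t within {a..b})" for t
    by (auto intro!: derivative_eq_intros)
  have d: "((\<lambda>s. cmap d (?\<gamma> s)) has_vector_derivative frechet_derivative (\<lambda>x. cmap d (cinv c x)) (at (x + t *\<^sub>R h)) h) (at t within {a..b})"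
    if "d \<in> A" "t \<in> {a..b}" "?\<gamma> t \<in> cdom d" for d t
    by (rule has_vector_derivative_compose_at[OF lin Cinf_on_has_derivative[OF transition_smooth[OF c that(1)]]])
      (use \<gamma>[OF that(2)] that(3) c in \<open>auto intro!: image_eqI[of _ _ "?\<gamma> t"]\<close>)
  show C: "C1_curve A ?\<gamma> a b"
  proof (rule C1_curveI[OF ab _ d])
    show "continuous_on {a..b} ?\<gamma>"
      by (rule continuous_on_compose2[OF continuous_on_cinv[OF c]]) (use seg in \<open>auto intro!: continuous_intros\<close>)
    fix d assume d: "d \<in> A"
    show "continuous_on {t \<in> {a..b}. ?\<gamma> t \<in> cdom d} (\<lambda>t. frechet_derivative (\<lambda>x. cmap d (cinv c x)) (at (x + t *\<^sub>R h)) h)"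
    proof (rule continuous_on_compose2[OF Cinf_on_continuous[OF Cinf_on_frechet_derivative[OF transition_smooth[OF c d]]]])
      show "continuous_on {t \<in> {a..b}. ?\<gamma> t \<in> cdom d} (\<lambda>t. x + t *\<^sub>R h)" by (intro continuous_intros)
      show "(\<lambda>t. x + t *\<^sub>R h) ` {t \<in> {a..b}. ?\<gamma> t \<in> cdom d} \<subseteq> cmap c ` (cdom c \<inter> cdom d)"
      proof safe
        fix t assume t: "t \<in> {a..b}" "?\<gamma> t \<in> cdom d"
        show "x + t *\<^sub>R h \<in> cmap c ` (cdom c \<inter> cdom d)"
          by (rule image_eqI[of _ _ "?\<gamma> t"]) (use \<gamma>[OF t(1)] t(2) in auto)
      qed
    qed
  qed auto
  show "velocity A ?\<gamma> a b t c = h" if t: "t \<in> {a..b}" for t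
  proof -
    have "((\<lambda>s. cmap c (?\<gamma> s)) has_vector_derivative h) (at t within {a..b})"
      by (rule has_vector_derivative_transform[OF t _ lin]) (rule \<gamma>(2))
    from vector_derivative_within_closed_interval[OF ab t this] show ?thesis
      using \<gamma>[OF t] c by (simp add: velocity_def charts_at_iff)
  qed
qed

end

section \<open>Parallel translation\<close>

context manifold_connection
begin

lemma parallel_onD:
  assumes "a < b" "C1_curve A \<gamma> a b" "parallel_on A D \<gamma> a b V" "t \<in> {a..b}"
  shows "V t \<in> tangent_space A (\<gamma> t)"
    "c \<in> A \<Longrightarrow> \<gamma> t \<in> cdom c \<Longrightarrow> ((\<lambda>s. V s c) has_vector_derivative
      - christoffel c (cmap c (\<gamma> t)) (velocity A \<gamma> a b t c) (V t c)) (at t within {a..b})"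
proof -
  show "V t \<in> tangent_space A (\<gamma> t)" using assms by (simp add: parallel_on_def)
  assume c: "c \<in> A" "\<gamma> t \<in> cdom c"
  have "((\<lambda>s. V s c) has_vector_derivative
      - D (\<gamma> t) (velocity A \<gamma> a b t) (coord_field A c (V t c)) c) (at t within {a..b})"
    using assms c by (simp add: parallel_on_def charts_at_iff)
  then show "((\<lambda>s. V s c) has_vector_derivative
      - christoffel c (cmap c (\<gamma> t)) (velocity A \<gamma> a b t c) (V t c)) (at t within {a..b})"
    by (simp add: christoffel_eq[OF c velocity_tangent[OF assms(1,2,4)]])
qed

lemma parallel_onI:
  assumes "a < b" "C1_curve A \<gamma> a b" "\<And>t. t \<in> {a..b} \<Longrightarrow> V t \<in> tangent_space A (\<gamma> t)"
    "\<And>c t. t \<in> {a..b} \<Longrightarrow> c \<in> A \<Longrightarrow> \<gamma> t \<in> cdom c \<Longrightarrow> ((\<lambda>s. V s c) has_vector_derivative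
      - christoffel c (cmap c (\<gamma> t)) (velocity A \<gamma> a b t c) (V t c)) (at t within {a..b})"
  shows "parallel_on A D \<gamma> a b V"
  unfolding parallel_on_def
proof (intro ballI conjI)
  fix t assume t: "t \<in> {a..b}"
  show "V t \<in> tangent_space A (\<gamma> t)" by (rule assms(3)[OF t])
  fix c assume "c \<in> charts_at A (\<gamma> t)"
  then have c: "c \<in> A" "\<gamma> t \<in> cdom c" by (auto simp: charts_at_iff)
  show "((\<lambda>s. V s c) has_vector_derivative
      - D (\<gamma> t) (velocity A \<gamma> a b t) (coord_field A c (V t c)) c) (at t within {a..b})"
    unfolding christoffel_eq[OF c velocity_tangent[OF assms(1,2) t]] by (rule assms(4)[OF t c])
qed

definition parallel_segment :: "(real \<Rightarrow> 'm) \<Rightarrow> (real \<Rightarrow> ('m, 'n) tvec) \<Rightarrow> real \<Rightarrow> real \<Rightarrow> bool" where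
  "parallel_segment \<gamma> V a b \<longleftrightarrow> C1_curve A \<gamma> a b \<and> parallel_on A D \<gamma> a b V"

text \<open>The factor \<open>m\<close> from the chain rule matches the factor of the velocity,
  because the Christoffel term is linear in the velocity.\<close>

lemma parallel_segment_reparam:
  assumes ab: "a < b" "m > 0" "a' \<le> m * a + k" "m * b + k \<le> b'" and \<gamma>: "parallel_segment \<gamma> V a' b'"
    and \<delta>: "\<And>s. s \<in> {a..b} \<Longrightarrow> \<delta> s = \<gamma> (m * s + k)" and W: "\<And>s. s \<in> {a..b} \<Longrightarrow> W s = V (m * s + k)"
  shows "parallel_segment \<delta> W a b"
proof -
  have C: "C1_curve A \<gamma> a' b'" and P: "parallel_on A D \<gamma> a' b' V" using \<gamma> by (auto simp: parallel_segment_def)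
  note r = C1_curve_reparam[OF ab C, of \<delta>, OF \<delta>]
  have sub: "m * s + k \<in> {a'..b'}" if "s \<in> {a..b}" for s
  proof -
    have "m * a \<le> m * s" "m * s \<le> m * b" using that ab by auto
    then show ?thesis using ab(3,4) unfolding atLeastAtMost_iff by linarith
  qed
  have ab': "a' < b'" using mult_strict_left_mono[OF ab(1,2)] ab(3,4) by linarith
  have "parallel_on A D \<delta> a b W"
  proof (rule parallel_onI[OF ab(1) r(1)])
    fix t assume t: "t \<in> {a..b}"
    show "W t \<in> tangent_space A (\<delta> t)"
      using parallel_onD(1)[OF ab' C P sub[OF t]] t \<delta> W by simp
    fix c assume c: "c \<in> A" "\<delta> t \<in> cdom c"
    have lin: "linear (\<lambda>\<xi>. christoffel c (cmap c (\<delta> t)) \<xi> (W t c))"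
      by (rule christoffel_linear) (use c in auto)
    have "((\<lambda>s. W s c) has_vector_derivative m *\<^sub>R
      - christoffel c (cmap c (\<gamma> (m * t + k))) (velocity A \<gamma> a' b' (m * t + k) c) (V (m * t + k) c)) (at t within {a..b})"
      by (rule has_vector_derivative_affine_within[OF parallel_onD(2)[OF ab' C P sub[OF t] c(1)] ab(2-4) t])
        (use c \<delta> W t in auto)
    then show "((\<lambda>s. W s c) has_vector_derivative
      - christoffel c (cmap c (\<delta> t)) (velocity A \<delta> a b t c) (W t c)) (at t within {a..b})"
      using r(2)[OF _ t] \<delta> t W linear_cmul[OF lin, of m] by simp
  qed (use \<delta> in auto)
  then show ?thesis using r(1) \<delta> by (simp add: parallel_segment_def)
qed

lemma parallel_segment_sub:
  "parallel_segment \<gamma> V a b \<Longrightarrow> a \<le> s \<Longrightarrow> s < t \<Longrightarrow> t \<le> b \<Longrightarrow> parallel_segment \<gamma> V s t"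
  by (rule parallel_segment_reparam[of s t 1 a 0 b \<gamma> V]) auto

section \<open>Parallel fields inside one chart: existence and uniqueness\<close>

lemma christoffel_curve:
  assumes "C1_curve A \<gamma> a b" "c \<in> A" "\<gamma> ` {a..b} \<subseteq> cdom c"
  shows "t \<in> {a..b} \<Longrightarrow> linear (christoffel c (cmap c (\<gamma> t)) (velocity A \<gamma> a b t c))"
    "continuous_on {a..b} (\<lambda>t. christoffel c (cmap c (\<gamma> t)) (velocity A \<gamma> a b t c) \<eta>)"
proof -
  have dom: "\<gamma> t \<in> cdom c" if "t \<in> {a..b}" for t
    using assms(3) that by blast
  show "t \<in> {a..b} \<Longrightarrow> linear (christoffel c (cmap c (\<gamma> t)) (velocity A \<gamma> a b t c))"
    by (rule christoffel_linear[OF assms(2) imageI[OF dom]])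
  show "continuous_on {a..b} (\<lambda>t. christoffel c (cmap c (\<gamma> t)) (velocity A \<gamma> a b t c) \<eta>)"
  proof (rule continuous_on_linear_family[where L = "\<lambda>t \<xi>. christoffel c (cmap c (\<gamma> t)) \<xi> \<eta>"
        and f = "\<lambda>t. velocity A \<gamma> a b t c"])
    show "linear (\<lambda>\<xi>. christoffel c (cmap c (\<gamma> t)) \<xi> \<eta>)" if "t \<in> {a..b}" for t
      by (rule christoffel_linear[OF assms(2) imageI[OF dom[OF that]]])
    show "continuous_on {a..b} (\<lambda>t. velocity A \<gamma> a b t c)"
      by (rule C1_curve_velocity_continuous[OF assms(1,2) order_refl dom])
    fix \<xi>
    have "continuous_on {a..b} (\<lambda>t. cmap c (\<gamma> t))"
      by (rule continuous_on_compose2[OF continuous_on_cmap[OF assms(2)] C1_curve_continuous[OF assms(1)] assms(3)])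
    then show "continuous_on {a..b} (\<lambda>t. christoffel c (cmap c (\<gamma> t)) \<xi> \<eta>)"
      by (rule continuous_on_compose2[OF Cinf_on_continuous[OF christoffel_smooth[OF assms(2)]]])
        (use dom in blast)
  qed
qed

text \<open>Transformation law of the Christoffel symbols, with \<open>F\<close> carrying the second
  derivatives of the coordinate change. Both sides are the \<open>d\<close>-components of
  \<open>D p v (coord_field A c \<eta>)\<close>: once transformed from \<open>c\<close>, once
  computed by \<open>D_in_chart\<close>.\<close>

lemma christoffel_change:
  assumes c: "c \<in> A" "p \<in> cdom c" and d: "d \<in> A" "p \<in> cdom d" and v: "v \<in> tangent_space A p"
    and F: "((\<lambda>x. frechet_derivative (\<lambda>x. cmap d (cinv c x)) (at x) \<eta>) has_derivative F) (at (cmap c p))"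
  shows "trans_deriv c d p (christoffel c (cmap c p) (v c) \<eta>) =
    F (v c) + christoffel d (cmap d p) (v d) (trans_deriv c d p \<eta>)"
proof -
  note U = chart_domain_open[OF c(1)]
  note sm = coord_field_smooth[OF c(1) U order_refl]
  have "((\<lambda>x. coord_field A c \<eta> (cinv c x) d) has_derivative F) (at (cmap c p))"
  proof (rule has_derivative_transform_within_open[OF F chart_image_open_Int[OF c(1) d(1)]])
    show "cmap c p \<in> cmap c ` (cdom c \<inter> cdom d)" using c d by auto
    fix x assume "x \<in> cmap c ` (cdom c \<inter> cdom d)"
    then obtain q where "q \<in> cdom c" "q \<in> cdom d" "x = cmap c q" by auto
    then show "frechet_derivative (\<lambda>x. cmap d (cinv c x)) (at x) \<eta> = coord_field A c \<eta> (cinv c x) d"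
      using c d by (simp add: coord_field_def coord_vec_def charts_at_iff trans_deriv_def)
  qed
  from has_derivative_change_chart[OF c d this]
  have F': "((\<lambda>x. coord_field A c \<eta> (cinv d x) d) has_derivative (\<lambda>v. F (trans_deriv d c p v))) (at (cmap d p))" .
  have "D p v (coord_field A c \<eta>) d = F (trans_deriv d c p (v d)) + christoffel d (cmap d p) (v d) (coord_field A c \<eta> p d)"
    by (rule D_in_chart[OF U sm c(2) d v F'])
  moreover have "trans_deriv d c p (v d) = v c" using tangent_change[OF v d c] by simp
  moreover have "coord_field A c \<eta> p d = trans_deriv c d p \<eta>"
    using c d by (simp add: coord_field_def coord_vec_def charts_at_iff)
  moreover have "D p v (coord_field A c \<eta>) d = trans_deriv c d p (D p v (coord_field A c \<eta>) c)"
    by (rule tangent_change[OF D_tangent[OF U sm c(2) v] c d])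
  ultimately show ?thesis by (simp add: christoffel_eq[OF c v])
qed

text \<open>The equation is solved in the chart \<open>c\<close>, but \<open>parallel_on\<close>
  demands it in every chart met by the curve; the transformation law of the Christoffel symbols
  carries it over.\<close>

lemma parallel_in_chart_exists:
  assumes ab: "a < b" and \<gamma>: "C1_curve A \<gamma> a b" and sub: "\<gamma> ` {a..b} \<subseteq> cdom c" and c: "c \<in> A"
    and v: "v \<in> tangent_space A (\<gamma> a)"
  obtains V where "parallel_segment \<gamma> V a b" "V a = v"
proof -
  have \<gamma>c: "\<gamma> t \<in> cdom c" if "t \<in> {a..b}" for t using sub that by auto
  let ?u = "\<lambda>t. cmap c (\<gamma> t)" and ?w = "\<lambda>t. velocity A \<gamma> a b t"
  note chr = christoffel_curve[OF \<gamma> c sub]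
  obtain f where f: "f a = v c" "\<And>t. t \<in> {a..b} \<Longrightarrow>
      (f has_vector_derivative - christoffel c (?u t) (?w t c) (f t)) (at t within {a..b})"
  proof (rule linear_ode_exists[of a b "\<lambda>t \<eta>. - christoffel c (?u t) (?w t c) \<eta>" "v c"])
    show "linear (\<lambda>\<eta>. - christoffel c (?u t) (?w t c) \<eta>)" if "t \<in> {a..b}" for t
      using chr(1)[OF that] by (rule linear_compose_neg)
    show "continuous_on {a..b} (\<lambda>t. - christoffel c (?u t) (?w t c) i)" for i
      by (intro continuous_on_minus chr(2))
  qed (use ab in auto)
  define V where "V = (\<lambda>t. coord_vec A c (\<gamma> t) (f t))"
  have VT: "V t \<in> tangent_space A (\<gamma> t)" if "t \<in> {a..b}" for t
    unfolding V_def by (rule coord_vec_tangent[OF c \<gamma>c[OF that]])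
  have "parallel_on A D \<gamma> a b V"
  proof (rule parallel_onI[OF ab \<gamma> VT])
    fix d t assume t: "t \<in> {a..b}" and d: "d \<in> A" "\<gamma> t \<in> cdom d"
    let ?T = "\<lambda>\<eta> x. frechet_derivative (\<lambda>x. cmap d (cinv c x)) (at x) \<eta>"
    let ?T' = "\<lambda>\<eta>. frechet_derivative (?T \<eta>) (at (?u t))"
    have ut: "?u s \<in> cmap c ` (cdom c \<inter> cdom d)" if "s \<in> {a..b}" "\<gamma> s \<in> cdom d" for s using \<gamma>c that by auto
    have dT: "(?T \<eta> has_derivative ?T' \<eta>) (at (?u t))" for \<eta>
      by (rule Cinf_on_has_derivative[OF Cinf_on_frechet_derivative[OF transition_smooth[OF c d(1)]] ut[OF t d(2)]])
    have linT: "linear (trans_deriv c d (\<gamma> s))" if "s \<in> {a..b}" "\<gamma> s \<in> cdom d" for s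
      by (rule trans_deriv_linear[OF c d(1) \<gamma>c[OF that(1)] that(2)])
    have Teq: "?T \<eta> (?u s) = trans_deriv c d (\<gamma> s) \<eta>" for s \<eta> by (simp add: trans_deriv_def)
    have expand: "trans_deriv c d (\<gamma> s) \<eta> = (\<Sum>i\<in>Basis. (\<eta> \<bullet> i) *\<^sub>R ?T i (?u s))"
      if "s \<in> {a..b}" "\<gamma> s \<in> cdom d" for s \<eta>
      unfolding Teq by (rule linear_Basis_expand[OF linT[OF that]])
    have F: "((\<lambda>x. ?T (f t) x) has_derivative (\<lambda>w. \<Sum>i\<in>Basis. (f t \<bullet> i) *\<^sub>R ?T' i w)) (at (?u t))"
    proof (rule has_derivative_transform_within_open[OF _ chart_image_open_Int[OF c d(1)] ut[OF t d(2)]])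
      show "((\<lambda>x. \<Sum>i\<in>Basis. (f t \<bullet> i) *\<^sub>R ?T i x) has_derivative (\<lambda>w. \<Sum>i\<in>Basis. (f t \<bullet> i) *\<^sub>R ?T' i w)) (at (?u t))"
        by (intro has_derivative_sum has_derivative_scaleR_right dT)
      fix x assume "x \<in> cmap c ` (cdom c \<inter> cdom d)"
      then have "linear (\<lambda>\<eta>. ?T \<eta> x)"
        using has_derivative_linear[OF Cinf_on_has_derivative[OF transition_smooth[OF c d(1)]]] by blast
      from linear_Basis_expand[OF this] show "(\<Sum>i\<in>Basis. (f t \<bullet> i) *\<^sub>R ?T i x) = ?T (f t) x" by (rule sym)
    qed
    have wT: "?w t \<in> tangent_space A (\<gamma> t)" by (rule velocity_tangent[OF ab \<gamma> t])
    have "((\<lambda>s. \<Sum>i\<in>Basis. (f s \<bullet> i) *\<^sub>R ?T i (?u s)) has_vector_derivative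
        (\<Sum>i\<in>Basis. (f t \<bullet> i) *\<^sub>R ?T' i (?w t c) + (- christoffel c (?u t) (?w t c) (f t) \<bullet> i) *\<^sub>R ?T i (?u t))) (at t within {a..b})"
    proof (intro has_vector_derivative_sum has_vector_derivative_scaleR)
      fix i :: "real^'n"
      show "((\<lambda>s. f s \<bullet> i) has_real_derivative - christoffel c (?u t) (?w t c) (f t) \<bullet> i) (at t within {a..b})"
        unfolding has_real_derivative_iff_has_vector_derivative
        by (rule bounded_linear.has_vector_derivative[OF bounded_linear_inner_left f(2)[OF t]])
      show "((\<lambda>s. ?T i (?u s)) has_vector_derivative ?T' i (?w t c)) (at t within {a..b})"
        by (rule has_vector_derivative_compose_at[OF C1_curve_velocity[OF \<gamma> c t \<gamma>c[OF t]] dT])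
    qed
    \<comment> \<open>The second derivatives of the coordinate change appear twice, from
      differentiating \<open>?T\<close> along the curve and from \<open>christoffel_change\<close>,
      with opposite signs.\<close>
    moreover have "(\<Sum>i\<in>Basis. (f t \<bullet> i) *\<^sub>R ?T' i (?w t c) + (- christoffel c (?u t) (?w t c) (f t) \<bullet> i) *\<^sub>R ?T i (?u t))
        = - christoffel d (cmap d (\<gamma> t)) (?w t d) (V t d)"
    proof -
      have "(\<Sum>i\<in>Basis. (- christoffel c (?u t) (?w t c) (f t) \<bullet> i) *\<^sub>R ?T i (?u t))
          = trans_deriv c d (\<gamma> t) (- christoffel c (?u t) (?w t c) (f t))"
        by (rule expand[OF t d(2), symmetric])
      also have "\<dots> = - trans_deriv c d (\<gamma> t) (christoffel c (?u t) (?w t c) (f t))"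
        by (rule linear_neg[OF linT[OF t d(2)]])
      also have "\<dots> = - ((\<Sum>i\<in>Basis. (f t \<bullet> i) *\<^sub>R ?T' i (?w t c)) + christoffel d (cmap d (\<gamma> t)) (?w t d) (trans_deriv c d (\<gamma> t) (f t)))"
        by (subst christoffel_change[OF c \<gamma>c[OF t] d wT F]) simp
      finally have e: "(\<Sum>i\<in>Basis. (- christoffel c (?u t) (?w t c) (f t) \<bullet> i) *\<^sub>R ?T i (?u t)) =
         - ((\<Sum>i\<in>Basis. (f t \<bullet> i) *\<^sub>R ?T' i (?w t c)) + christoffel d (cmap d (\<gamma> t)) (?w t d) (trans_deriv c d (\<gamma> t) (f t)))" .
      have "V t d = trans_deriv c d (\<gamma> t) (f t)"
        using d by (simp add: V_def coord_vec_def charts_at_iff)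
      then show ?thesis unfolding sum.distrib e by simp
    qed
    ultimately have "((\<lambda>s. \<Sum>i\<in>Basis. (f s \<bullet> i) *\<^sub>R ?T i (?u s)) has_vector_derivative
        - christoffel d (cmap d (\<gamma> t)) (?w t d) (V t d)) (at t within {a..b})" by simp
    then show "((\<lambda>s. V s d) has_vector_derivative
        - christoffel d (cmap d (\<gamma> t)) (?w t d) (V t d)) (at t within {a..b})"
    proof (rule transition_along_curve[OF C1_curve_continuous[OF \<gamma>] t c \<gamma>c[OF t],
          of "\<lambda>x s. \<Sum>i\<in>Basis. (f s \<bullet> i) *\<^sub>R ?T i x" _ "cdom d"])
      show "open (cdom d)" by (rule chart_domain_open[OF d(1)])
      fix s assume s: "s \<in> {a..b}" "\<gamma> s \<in> cdom d"
      have "V s d = trans_deriv c d (\<gamma> s) (f s)"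
        using d s by (simp add: V_def coord_vec_def charts_at_iff)
      then show "V s d = (\<Sum>i\<in>Basis. (f s \<bullet> i) *\<^sub>R ?T i (?u s))" using expand[OF s] by simp
    qed (use d in auto)
  qed
  moreover have "V a = v" unfolding V_def f(1)
    by (rule coord_vec_of_tangent[OF v c]) (use \<gamma>c ab in auto)
  ultimately show ?thesis using that[of V] \<gamma> by (simp add: parallel_segment_def)
qed

text \<open>The difference of both sides solves the same linear system, so by Gronwall it vanishes
  everywhere once it vanishes at \<open>s\<close>. Suitable \<open>r\<close> and \<open>r'\<close>
  give uniqueness, additivity, homogeneity and, as \<open>s\<close> and \<open>t\<close> may be in
  any order, injectivity of parallel translation.\<close>

lemma parallel_combination_in_chart:
  assumes ab: "a < b" and sub: "\<gamma> ` {a..b} \<subseteq> cdom c" and c: "c \<in> A"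
    and V: "parallel_segment \<gamma> V a b" "parallel_segment \<gamma> W a b" "parallel_segment \<gamma> X a b"
    and st: "s \<in> {a..b}" "t \<in> {a..b}"
    and eq: "X s = tadd (tscale r (V s)) (tscale r' (W s))"
  shows "X t = tadd (tscale r (V t)) (tscale r' (W t))"
proof -
  have \<gamma>: "\<gamma> t \<in> cdom c" if "t \<in> {a..b}" for t using sub that by auto
  let ?L = "\<lambda>t. christoffel c (cmap c (\<gamma> t)) (velocity A \<gamma> a b t c)"
  have C: "C1_curve A \<gamma> a b" and P: "parallel_on A D \<gamma> a b V" "parallel_on A D \<gamma> a b W" "parallel_on A D \<gamma> a b X"
    using V by (auto simp: parallel_segment_def)
  note chr = christoffel_curve[OF C c sub]
  obtain M where M: "\<And>t x. t \<in> {a..b} \<Longrightarrow> norm (?L t x) \<le> M * norm x"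
    by (rule compact_basis_expansion_bound[of "{a..b}" ?L, OF compact_Icc chr]) auto
  define U where "U = (\<lambda>t. X t c - (r *\<^sub>R V t c + r' *\<^sub>R W t c))"
  have U: "(U has_vector_derivative - ?L t (U t)) (at t within {a..b})" if t: "t \<in> {a..b}" for t
  proof -
    have "(U has_vector_derivative - ?L t (X t c) - (r *\<^sub>R - ?L t (V t c) + r' *\<^sub>R - ?L t (W t c))) (at t within {a..b})"
      unfolding U_def
      by (intro has_vector_derivative_diff has_vector_derivative_add
          bounded_linear.has_vector_derivative[OF bounded_linear_scaleR_right]
          parallel_onD(2)[OF ab C] P t c \<gamma>[OF t])
    moreover have "- ?L t (X t c) - (r *\<^sub>R - ?L t (V t c) + r' *\<^sub>R - ?L t (W t c)) = - ?L t (U t)"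
      by (simp add: U_def linear_diff[OF chr(1)[OF t]] linear_add[OF chr(1)[OF t]] linear_cmul[OF chr(1)[OF t]])
    ultimately show ?thesis by simp
  qed
  have "U s = 0" using eq by (simp add: U_def)
  moreover have "norm (U t) \<le> exp (M * \<bar>t - s\<bar>) * norm (U s)"
    by (rule gronwall_linear[OF U _ st]) (use M in auto)
  ultimately have "U t = 0" by simp
  then show ?thesis
    using parallel_onD(1)[OF ab C P(1) st(2)] parallel_onD(1)[OF ab C P(2) st(2)] parallel_onD(1)[OF ab C P(3) st(2)] c \<gamma>[OF st(2)]
    by (intro tangent_eqI[of _ "\<gamma> t" _ c] tangent_space_closed tangent_tscale) (auto simp: U_def)
qed

section \<open>From one chart to whole curves by bisection\<close>

lemma parallel_segment_tangent:
  "parallel_segment \<gamma> V a b \<Longrightarrow> t \<in> {a..b} \<Longrightarrow> V t \<in> tangent_space A (\<gamma> t)"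
  by (simp add: parallel_segment_def parallel_on_def)

text \<open>Short subintervals stay in one chart, and an equivalence between the two ends chains
  across adjacent intervals, as bisection requires.\<close>

lemma parallel_combination_segment:
  assumes ab: "a < b"
    and V: "parallel_segment \<gamma> V a b" "parallel_segment \<gamma> W a b" "parallel_segment \<gamma> X a b"
  shows "X a = tadd (tscale r (V a)) (tscale r' (W a)) \<longleftrightarrow> X b = tadd (tscale r (V b)) (tscale r' (W b))"
proof -
  let ?L = "\<lambda>t. X t = tadd (tscale r (V t)) (tscale r' (W t))"
  have \<gamma>: "continuous_on {a..b} \<gamma>"
    using V(1) by (auto simp: parallel_segment_def intro: C1_curve_continuous)
  have "a \<le> a \<longrightarrow> b \<le> b \<longrightarrow> (?L a \<longleftrightarrow> ?L b)"
  proof (rule Bolzano[where P = "\<lambda>s t. a \<le> s \<longrightarrow> t \<le> b \<longrightarrow> (?L s \<longleftrightarrow> ?L t)" and a = a and b = b])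
    show "a \<le> b" using ab by simp
    fix x assume x: "a \<le> x" "x \<le> b"
    let ?c = "chart_at A (\<gamma> x)"
    obtain d where d: "d > 0" "\<And>s. s \<in> {a..b} \<Longrightarrow> dist s x < d \<Longrightarrow> \<gamma> s \<in> cdom ?c"
      using curve_stays_near[OF \<gamma>, of x "cdom ?c"] x chart_domain_open[OF chart_at(1)] chart_at(2) by auto
    show "\<exists>d>0. \<forall>s t. s \<le> x \<and> x \<le> t \<and> t - s < d \<longrightarrow> a \<le> s \<longrightarrow> t \<le> b \<longrightarrow> (?L s \<longleftrightarrow> ?L t)"
    proof (intro exI[of _ d] conjI allI impI)
      fix s t assume st: "s \<le> x \<and> x \<le> t \<and> t - s < d" "a \<le> s" "t \<le> b"
      show "?L s \<longleftrightarrow> ?L t"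
      proof (cases "s = t")
        case False
        then have lt: "s < t" using st by simp
        have sub: "\<gamma> ` {s..t} \<subseteq> cdom ?c" using d(2) st by (auto simp: dist_real_def)
        note * = parallel_combination_in_chart[OF lt sub chart_at(1) parallel_segment_sub[OF V(1) st(2) lt st(3)]
            parallel_segment_sub[OF V(2) st(2) lt st(3)] parallel_segment_sub[OF V(3) st(2) lt st(3)]]
        have "s \<in> {s..t}" "t \<in> {s..t}" using lt by auto
        then show ?thesis using *[of s t] *[of t s] by blast
      qed simp
    qed (rule d(1))
  qed auto
  then show ?thesis by simp
qed

text \<open>The three fields may come with different partitions; the bisection argument avoids a common
  refinement.\<close>

lemma parallel_combination_pieces:
  assumes V: "pieces (parallel_segment \<gamma> V) a b" "pieces (parallel_segment \<gamma> W) a b" "pieces (parallel_segment \<gamma> X) a b"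
  shows "X a = tadd (tscale r (V a)) (tscale r' (W a)) \<longleftrightarrow> X b = tadd (tscale r (V b)) (tscale r' (W b))"
proof -
  let ?L = "\<lambda>t. X t = tadd (tscale r (V t)) (tscale r' (W t))"
  have "a \<le> a \<longrightarrow> b \<le> b \<longrightarrow> (?L a \<longleftrightarrow> ?L b)"
  proof (rule Bolzano[where P = "\<lambda>s t. a \<le> s \<longrightarrow> t \<le> b \<longrightarrow> (?L s \<longleftrightarrow> ?L t)" and a = a and b = b])
    show "a \<le> b" using pieces_le V by blast
    fix x assume x: "a \<le> x" "x \<le> b"
    have loc: "\<exists>d>0. (\<forall>s. a \<le> s \<longrightarrow> s < x \<longrightarrow> x - s < d \<longrightarrow> parallel_segment \<gamma> Y s x) \<and>
        (\<forall>t. x < t \<longrightarrow> t \<le> b \<longrightarrow> t - x < d \<longrightarrow> parallel_segment \<gamma> Y x t)"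
      if "pieces (parallel_segment \<gamma> Y) a b" for Y
      by (rule pieces_local[OF that _ x]) (rule parallel_segment_sub)
    obtain d1 where d1: "d1 > 0" "\<And>s. a \<le> s \<Longrightarrow> s < x \<Longrightarrow> x - s < d1 \<Longrightarrow> parallel_segment \<gamma> V s x"
        "\<And>t. x < t \<Longrightarrow> t \<le> b \<Longrightarrow> t - x < d1 \<Longrightarrow> parallel_segment \<gamma> V x t"
      using loc[OF V(1)] by blast
    obtain d2 where d2: "d2 > 0" "\<And>s. a \<le> s \<Longrightarrow> s < x \<Longrightarrow> x - s < d2 \<Longrightarrow> parallel_segment \<gamma> W s x"
        "\<And>t. x < t \<Longrightarrow> t \<le> b \<Longrightarrow> t - x < d2 \<Longrightarrow> parallel_segment \<gamma> W x t"
      using loc[OF V(2)] by blast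
    obtain d3 where d3: "d3 > 0" "\<And>s. a \<le> s \<Longrightarrow> s < x \<Longrightarrow> x - s < d3 \<Longrightarrow> parallel_segment \<gamma> X s x"
        "\<And>t. x < t \<Longrightarrow> t \<le> b \<Longrightarrow> t - x < d3 \<Longrightarrow> parallel_segment \<gamma> X x t"
      using loc[OF V(3)] by blast
    show "\<exists>d>0. \<forall>s t. s \<le> x \<and> x \<le> t \<and> t - s < d \<longrightarrow> a \<le> s \<longrightarrow> t \<le> b \<longrightarrow> (?L s \<longleftrightarrow> ?L t)"
    proof (intro exI[of _ "min d1 (min d2 d3)"] conjI allI impI)
      fix s t assume st: "s \<le> x \<and> x \<le> t \<and> t - s < min d1 (min d2 d3)" "a \<le> s" "t \<le> b"
      have "?L s \<longleftrightarrow> ?L x"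
      proof (cases "s = x")
        case False
        then have "s < x" using st by simp
        then show ?thesis by (rule parallel_combination_segment[of _ _ \<gamma>]) (use \<open>s < x\<close> st d1(2) d2(2) d3(2) in auto)
      qed simp
      also have "?L x \<longleftrightarrow> ?L t"
      proof (cases "x = t")
        case False
        then have "x < t" using st by simp
        then show ?thesis by (rule parallel_combination_segment[of _ _ \<gamma>]) (use \<open>x < t\<close> st d1(3) d2(3) d3(3) in auto)
      qed simp
      finally show "?L s \<longleftrightarrow> ?L t" .
    qed (use d1(1) d2(1) d3(1) in auto)
  qed auto
  then show ?thesis by simp
qed

lemma pieces_parallel_cong:
  assumes "pieces (parallel_segment \<gamma> V) a b" "\<And>t. t \<in> {a..b} \<Longrightarrow> \<delta> t = \<gamma> t" "\<And>t. t \<in> {a..b} \<Longrightarrow> W t = V t"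
  shows "pieces (parallel_segment \<delta> W) a b"
  by (rule pieces_mono[OF assms(1)], rule parallel_segment_reparam[where m = 1 and k = 0]) (use assms(2,3) in auto)

lemma pieces_tangent:
  assumes "pieces (parallel_segment \<gamma> V) a b" "V a \<in> tangent_space A (\<gamma> a)"
  shows "V b \<in> tangent_space A (\<gamma> b)"
  using assms(1)
proof (cases rule: pieces.cases)
  case (pieces_step c)
  then show ?thesis using parallel_segment_tangent[of \<gamma> V c b b] by simp
qed (use assms in simp)

lemma pieces_parallel_glue:
  assumes "pieces (parallel_segment \<gamma> V) a b" "pieces (parallel_segment \<gamma> W) b c" "V b = W b"
  obtains U where "pieces (parallel_segment \<gamma> U) a c" "U a = V a" "U c = W c"
proof -
  define U where "U = (\<lambda>t. if t \<le> b then V t else W t)"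
  have le: "a \<le> b" "b \<le> c" using assms pieces_le by blast+
  have "pieces (parallel_segment \<gamma> U) a b"
    by (rule pieces_parallel_cong[OF assms(1)]) (auto simp: U_def)
  moreover have "pieces (parallel_segment \<gamma> U) b c"
    by (rule pieces_parallel_cong[OF assms(2)]) (auto simp: U_def assms(3))
  ultimately have "pieces (parallel_segment \<gamma> U) a c" using pieces_trans by blast
  then show ?thesis by (rule that) (use le assms(3) in \<open>auto simp: U_def\<close>)
qed

text \<open>The bisected property quantifies over all start vectors, so that the second half can
  start from whatever vector the first half delivers.\<close>

lemma C1_parallel_exists:
  assumes ab: "a \<le> b" and \<gamma>: "C1_curve A \<gamma> a b" and v: "v \<in> tangent_space A (\<gamma> a)"
  obtains V where "pieces (parallel_segment \<gamma> V) a b" "V a = v"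
proof -
  let ?P = "\<lambda>s t. a \<le> s \<longrightarrow> t \<le> b \<longrightarrow> (\<forall>v\<in>tangent_space A (\<gamma> s). \<exists>V. pieces (parallel_segment \<gamma> V) s t \<and> V s = v)"
  have "?P a b"
  proof (rule Bolzano[where P = ?P, OF ab])
    fix s t u assume P: "?P s t" "?P t u" and st: "s \<le> t" "t \<le> u"
    show "?P s u"
    proof (intro impI ballI)
      fix v assume "a \<le> s" "u \<le> b" "v \<in> tangent_space A (\<gamma> s)"
      then obtain V where V: "pieces (parallel_segment \<gamma> V) s t" "V s = v" using P(1) st by fastforce
      then have "V t \<in> tangent_space A (\<gamma> t)" using pieces_tangent \<open>v \<in> _\<close> by blast
      then obtain W where W: "pieces (parallel_segment \<gamma> W) t u" "W t = V t"
        using P(2) st \<open>a \<le> s\<close> \<open>u \<le> b\<close> by fastforce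
      obtain U where "pieces (parallel_segment \<gamma> U) s u" "U s = V s" "U u = W u"
        by (rule pieces_parallel_glue[OF V(1) W(1)]) (use W(2) in auto)
      then show "\<exists>V. pieces (parallel_segment \<gamma> V) s u \<and> V s = v" using V(2) by auto
    qed
  next
    fix x assume x: "a \<le> x" "x \<le> b"
    let ?c = "chart_at A (\<gamma> x)"
    obtain d where d: "d > 0" "\<And>s. s \<in> {a..b} \<Longrightarrow> dist s x < d \<Longrightarrow> \<gamma> s \<in> cdom ?c"
      using curve_stays_near[OF C1_curve_continuous[OF \<gamma>], of x "cdom ?c"] x chart_domain_open[OF chart_at(1)] chart_at(2) by auto
    show "\<exists>d>0. \<forall>s t. s \<le> x \<and> x \<le> t \<and> t - s < d \<longrightarrow> ?P s t"
    proof (intro exI[of _ d] conjI allI impI ballI)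
      fix s t v assume st: "s \<le> x \<and> x \<le> t \<and> t - s < d" "a \<le> s" "t \<le> b" and v: "v \<in> tangent_space A (\<gamma> s)"
      show "\<exists>V. pieces (parallel_segment \<gamma> V) s t \<and> V s = v"
      proof (cases "s = t")
        case True
        then show ?thesis using pieces_refl by (intro exI[of _ "\<lambda>_. v"]) auto
      next
        case False
        then have lt: "s < t" using st by simp
        have sub: "\<gamma> ` {s..t} \<subseteq> cdom ?c" using d(2) st by (auto simp: dist_real_def)
        have "C1_curve A \<gamma> s t"
          by (rule C1_curve_reparam(1)[OF lt _ _ _ \<gamma>, of 1 0]) (use st in auto)
        from parallel_in_chart_exists[OF lt this sub chart_at(1) v]
        show ?thesis using pieces_single[OF lt] by metis
      qed
    qed (rule d(1))
  qed
  then show ?thesis using v that by blast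
qed

lemma pieces_parallel_exists:
  assumes "pieces (C1_curve A \<gamma>) a b" "v \<in> tangent_space A (\<gamma> a)"
  obtains V where "pieces (parallel_segment \<gamma> V) a b" "V a = v"
proof -
  have "\<exists>V. pieces (parallel_segment \<gamma> V) a b \<and> V a = v"
    using assms
  proof (induction rule: pieces.induct)
    case (pieces_refl a)
    then show ?case using pieces.pieces_refl by (intro exI[of _ "\<lambda>_. v"]) auto
  next
    case (pieces_step a b c)
    then obtain V where V: "pieces (parallel_segment \<gamma> V) a b" "V a = v" by blast
    then have "V b \<in> tangent_space A (\<gamma> b)" using pieces_tangent pieces_step.prems by blast
    with pieces_step obtain W where W: "pieces (parallel_segment \<gamma> W) b c" "W b = V b"
      using C1_parallel_exists[of b c \<gamma> "V b"] by auto
    obtain U where "pieces (parallel_segment \<gamma> U) a c" "U a = V a" "U c = W c"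
      by (rule pieces_parallel_glue[OF V(1) W(1)]) (use W(2) in auto)
    then show ?case using V(2) by auto
  qed
  then show ?thesis using that by blast
qed

subsection \<open>Translation along loops and paths\<close>

lemma pw_C1_curve_iff: "pw_C1_curve A \<gamma> \<longleftrightarrow> pieces (C1_curve A \<gamma>) 0 1"
  unfolding pw_C1_curve_def unit_partition_def pieces_iff_partition by blast

lemma parallel_along_iff: "parallel_along A D \<gamma> V \<longleftrightarrow> pieces (parallel_segment \<gamma> V) 0 1"
  unfolding parallel_along_def unit_partition_def pieces_iff_partition parallel_segment_def by blast

lemma parallel_translation_eq:
  assumes "pieces (parallel_segment \<gamma> V) 0 1"
  shows "parallel_translation A D \<gamma> (V 0) = V 1"
  unfolding parallel_translation_def parallel_along_iff
proof (rule the_equality)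
  show "\<exists>Va. pieces (parallel_segment \<gamma> Va) 0 1 \<and> Va 0 = V 0 \<and> Va 1 = V 1" using assms by blast
  fix w assume "\<exists>Va. pieces (parallel_segment \<gamma> Va) 0 1 \<and> Va 0 = V 0 \<and> Va 1 = w"
  then obtain W where W: "pieces (parallel_segment \<gamma> W) 0 1" "W 0 = V 0" "W 1 = w" by blast
  have "W 1 = tadd (tscale 1 (V 1)) (tscale 0 (V 1))"
    using parallel_combination_pieces[OF assms assms W(1), of 1 0] W(2) by (auto simp: fun_eq_iff)
  then show "w = V 1" using W(3) by (auto simp: fun_eq_iff)
qed

text \<open>Holonomy between two different points, restricted to the tangent space as in
  \<open>holonomy_group\<close>, so that \<open>joined p p\<close> is membership in that
  group.\<close>

definition joined :: "'m \<Rightarrow> 'm \<Rightarrow> (('m, 'n) tvec \<Rightarrow> ('m, 'n) tvec) \<Rightarrow> bool" where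
  "joined p q T \<longleftrightarrow> (\<exists>\<gamma>. pw_C1_curve A \<gamma> \<and> \<gamma> 0 = p \<and> \<gamma> 1 = q \<and>
    T = restrict (parallel_translation A D \<gamma>) (tangent_space A p))"

lemma holonomy_group_joined: "holonomy_group A D p = {T. joined p p T}"
  unfolding holonomy_group_def joined_def by auto

lemma joined_tangent:
  assumes "joined p q T" "v \<in> tangent_space A p" shows "T v \<in> tangent_space A q"
proof -
  obtain \<gamma> where \<gamma>: "pieces (C1_curve A \<gamma>) 0 1" "\<gamma> 0 = p" "\<gamma> 1 = q"
      "T = restrict (parallel_translation A D \<gamma>) (tangent_space A p)"
    using assms(1) by (auto simp: joined_def pw_C1_curve_iff)
  obtain V where V: "pieces (parallel_segment \<gamma> V) 0 1" "V 0 = v"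
    using pieces_parallel_exists[OF \<gamma>(1)] assms(2) \<gamma>(2) by metis
  then show ?thesis
    using parallel_translation_eq[OF V(1)] pieces_tangent[OF V(1)] assms(2) \<gamma> by simp
qed

lemma joined_combination:
  assumes T: "joined p q T" and v: "v \<in> tangent_space A p" "w \<in> tangent_space A p" "x \<in> tangent_space A p"
  shows "x = tadd (tscale r v) (tscale r' w) \<longleftrightarrow> T x = tadd (tscale r (T v)) (tscale r' (T w))"
proof -
  obtain \<gamma> where \<gamma>: "pieces (C1_curve A \<gamma>) 0 1" "\<gamma> 0 = p" "\<gamma> 1 = q"
      "T = restrict (parallel_translation A D \<gamma>) (tangent_space A p)"
    using T by (auto simp: joined_def pw_C1_curve_iff)
  obtain V where V: "pieces (parallel_segment \<gamma> V) 0 1" "V 0 = v"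
    using pieces_parallel_exists[OF \<gamma>(1)] v(1) \<gamma>(2) by metis
  obtain W where W: "pieces (parallel_segment \<gamma> W) 0 1" "W 0 = w"
    using pieces_parallel_exists[OF \<gamma>(1)] v(2) \<gamma>(2) by metis
  obtain X where X: "pieces (parallel_segment \<gamma> X) 0 1" "X 0 = x"
    using pieces_parallel_exists[OF \<gamma>(1)] v(3) \<gamma>(2) by metis
  show ?thesis
    using parallel_combination_pieces[OF V(1) W(1) X(1), of r r'] V(2) W(2) X(2) \<gamma>(4) v
      parallel_translation_eq[OF V(1)] parallel_translation_eq[OF W(1)] parallel_translation_eq[OF X(1)] by simp
qed

text \<open>Translation is parametrised over the unit interval; an affine change of parameter, under
  which parallel fields stay parallel, gives access to curves on any interval and describes
  \<open>T\<close> by its effect on parallel fields.\<close>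

lemma pieces_parallel_joined:
  assumes "a < b" "pieces (C1_curve A \<gamma>) a b"
  obtains T where "joined (\<gamma> a) (\<gamma> b) T"
    "\<And>V. pieces (parallel_segment \<gamma> V) a b \<Longrightarrow> V a \<in> tangent_space A (\<gamma> a) \<Longrightarrow> T (V a) = V b"
proof -
  define m where "m = inverse (b - a)"
  define \<delta> where "\<delta> = (\<lambda>s. \<gamma> ((b - a) * s + a))"
  have m: "m > 0" using assms by (simp add: m_def)
  have bm: "(b - a) * m = 1" using assms(1) by (simp add: m_def)
  have e: "m * a + (- m * a) = 0" "m * b + (- m * a) = 1"
    using bm by (simp_all add: algebra_simps)
  have inv: "(b - a) * (m * s + - m * a) + a = s" for s
  proof -
    have "(b - a) * (m * s + - m * a) + a = ((b - a) * m) * (s - a) + a" by (simp only: algebra_simps)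
    then show ?thesis by (simp add: bm)
  qed
  have \<delta>: "pieces (C1_curve A \<delta>) (m * a + (- m * a)) (m * b + (- m * a))"
  proof (rule pieces_affine[OF assms(2) m])
    fix s t assume st: "s < t" "C1_curve A \<gamma> s t"
    show "C1_curve A \<delta> (m * s + - m * a) (m * t + - m * a)"
      by (rule C1_curve_reparam(1)[OF _ _ _ _ st(2), where m = "b - a" and k = a])
        (use st m assms(1) inv in \<open>auto simp: \<delta>_def\<close>)
  qed
  have W: "pieces (parallel_segment \<delta> (\<lambda>s. V ((b - a) * s + a))) (m * a + (- m * a)) (m * b + (- m * a))"
    if V: "pieces (parallel_segment \<gamma> V) a b" for V
  proof (rule pieces_affine[OF V m])
    fix s t assume st: "s < t" "parallel_segment \<gamma> V s t"
    show "parallel_segment \<delta> (\<lambda>s. V ((b - a) * s + a)) (m * s + - m * a) (m * t + - m * a)"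
      by (rule parallel_segment_reparam[OF _ _ _ _ st(2), where m = "b - a" and k = a])
        (use st m assms(1) inv in \<open>auto simp: \<delta>_def\<close>)
  qed
  show ?thesis
  proof (rule that)
    show "joined (\<gamma> a) (\<gamma> b) (restrict (parallel_translation A D \<delta>) (tangent_space A (\<gamma> a)))"
      unfolding joined_def pw_C1_curve_iff using \<delta> e by (intro exI[of _ \<delta>]) (auto simp: \<delta>_def)
    fix V assume V: "pieces (parallel_segment \<gamma> V) a b" "V a \<in> tangent_space A (\<gamma> a)"
    show "restrict (parallel_translation A D \<delta>) (tangent_space A (\<gamma> a)) (V a) = V b"
      using parallel_translation_eq[OF W[OF V(1), unfolded e]] V(2) by simp
  qed
qed

text \<open>The second curve is shifted to run over [1,2] after the first one;
  \<open>pieces_parallel_joined\<close> rescales the result to the unit interval.\<close>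

lemma joined_compose:
  assumes T: "joined p q T" and S: "joined q r S"
  obtains R where "joined p r R" "\<And>v. v \<in> tangent_space A p \<Longrightarrow> R v = S (T v)"
proof -
  obtain \<gamma> where \<gamma>: "pieces (C1_curve A \<gamma>) 0 1" "\<gamma> 0 = p" "\<gamma> 1 = q"
      "T = restrict (parallel_translation A D \<gamma>) (tangent_space A p)"
    using T by (auto simp: joined_def pw_C1_curve_iff)
  obtain \<delta> where \<delta>: "pieces (C1_curve A \<delta>) 0 1" "\<delta> 0 = q" "\<delta> 1 = r" "S = restrict (parallel_translation A D \<delta>) (tangent_space A q)"
    using S by (auto simp: joined_def pw_C1_curve_iff)
  define \<epsilon> where "\<epsilon> = (\<lambda>t. if t \<le> 1 then \<gamma> t else \<delta> (t - 1))"
  have \<epsilon>_hi: "\<epsilon> t = \<delta> (t - 1)" if "1 \<le> t" for t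
    using that \<gamma>(3) \<delta>(2) by (cases "t = 1") (auto simp: \<epsilon>_def)
  have e1: "pieces (C1_curve A \<epsilon>) 0 1"
    by (rule pieces_mono[OF \<gamma>(1)], rule C1_curve_reparam(1)[where m = 1 and k = 0]) (auto simp: \<epsilon>_def)
  have e2: "pieces (C1_curve A \<epsilon>) (1 * 0 + 1) (1 * 1 + 1)"
  proof (rule pieces_affine[OF \<delta>(1)])
    fix s t assume st: "0 \<le> s" "s < t" "C1_curve A \<delta> s t"
    show "C1_curve A \<epsilon> (1 * s + 1) (1 * t + 1)"
      by (rule C1_curve_reparam(1)[OF _ _ _ _ st(3), where m = 1 and k = "-1"])
        (use st in \<open>auto simp: \<epsilon>_hi\<close>)
  qed simp
  have "pieces (C1_curve A \<epsilon>) 0 2" using pieces_trans[OF e2] e1 by simp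
  from pieces_parallel_joined[OF _ this] obtain R where R: "joined (\<epsilon> 0) (\<epsilon> 2) R"
    "\<And>V. pieces (parallel_segment \<epsilon> V) 0 2 \<Longrightarrow> V 0 \<in> tangent_space A (\<epsilon> 0) \<Longrightarrow> R (V 0) = V 2" by auto
  show ?thesis
  proof (rule that)
    show "joined p r R" using R(1) \<gamma>(2) \<delta>(3) by (simp add: \<epsilon>_def)
    fix v assume v: "v \<in> tangent_space A p"
    obtain V where V: "pieces (parallel_segment \<gamma> V) 0 1" "V 0 = v"
      using pieces_parallel_exists[OF \<gamma>(1)] v \<gamma>(2) by metis
    have TV: "T v = V 1" using parallel_translation_eq[OF V(1)] V(2) \<gamma>(4) v by simp
    have V1: "V 1 \<in> tangent_space A q" using joined_tangent[OF T v] TV by simp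
    obtain W where W: "pieces (parallel_segment \<delta> W) 0 1" "W 0 = V 1"
      using pieces_parallel_exists[OF \<delta>(1)] V1 \<delta>(2) by metis
    have SW: "S (T v) = W 1" using parallel_translation_eq[OF W(1)] W(2) \<delta>(4) V1 TV by simp
    define X where "X = (\<lambda>t. if t \<le> 1 then V t else W (t - 1))"
    have X_hi: "X t = W (t - 1)" if "1 \<le> t" for t
      using that W(2) by (cases "t = 1") (auto simp: X_def)
    have x1: "pieces (parallel_segment \<epsilon> X) 0 1"
      by (rule pieces_parallel_cong[OF V(1)]) (auto simp: \<epsilon>_def X_def)
    have x2: "pieces (parallel_segment \<epsilon> X) (1 * 0 + 1) (1 * 1 + 1)"
    proof (rule pieces_affine[OF W(1)])
      fix s t assume st: "0 \<le> s" "s < t" "parallel_segment \<delta> W s t"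
      show "parallel_segment \<epsilon> X (1 * s + 1) (1 * t + 1)"
        by (rule parallel_segment_reparam[OF _ _ _ _ st(3), where m = 1 and k = "-1"])
          (use st in \<open>auto simp: \<epsilon>_hi X_hi\<close>)
    qed simp
    have "pieces (parallel_segment \<epsilon> X) 0 2" using pieces_trans[OF x2] x1 by simp
    from R(2)[OF this] show "R v = S (T v)"
      using v V(2) \<gamma>(2) SW by (simp add: X_def \<epsilon>_def)
  qed
qed

lemma joined_in_chart:
  assumes c: "c \<in> A" and seg: "\<And>t. t \<in> {0..1} \<Longrightarrow> x + t *\<^sub>R h \<in> cmap c ` cdom c"
  shows "\<exists>T. joined (cinv c x) (cinv c (x + h)) T"
proof -
  have "pieces (C1_curve A (\<lambda>t. cinv c (x + t *\<^sub>R h))) 0 1"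
    by (rule pieces_single[of 0 1, OF _ C1_chart_segment(1)[OF c _ seg]]) auto
  then show ?thesis by (rule pieces_parallel_joined[of 0 1, rotated]) auto
qed

text \<open>The relation is an equivalence with open classes, hence total on a connected space.
  Demanding paths both ways makes it symmetric by form; nearby points are joined by straight
  segments in a ball inside a chart.\<close>

lemma joined_exists:
  assumes "connected (UNIV :: 'm set)"
  shows "(\<exists>T. joined p q T) \<and> (\<exists>T. joined q p T)"
proof (rule connected_equivalence_relation[OF assms, of p q "\<lambda>p q. (\<exists>T. joined p q T) \<and> (\<exists>T. joined q p T)"])
  fix p q r assume "(\<exists>T. joined p q T) \<and> (\<exists>T. joined q p T)" "(\<exists>T. joined q r T) \<and> (\<exists>T. joined r q T)"
  then show "(\<exists>T. joined p r T) \<and> (\<exists>T. joined r p T)" using joined_compose by metis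
next
  fix p
  let ?c = "chart_at A p"
  note c = chart_at[of p]
  obtain e where e: "e > 0" "ball (cmap ?c p) e \<subseteq> cmap ?c ` cdom ?c"
    using chart_image_open'[OF c(1)] c(2) open_contains_ball by (metis imageI)
  define W where "W = {q \<in> cdom ?c. cmap ?c q \<in> ball (cmap ?c p) e}"
  have "open W"
    using continuous_open_preimage[OF continuous_on_cmap[OF c(1)] chart_domain_open[OF c(1)] open_ball]
    by (simp add: W_def vimage_def Int_def)
  moreover have "p \<in> W" using c(2) e(1) by (simp add: W_def)
  moreover have "(\<exists>T. joined p q T) \<and> (\<exists>T. joined q p T)" if "q \<in> W" for q
  proof -
    let ?x = "cmap ?c p" and ?y = "cmap ?c q"
    have q: "q \<in> cdom ?c" "?y \<in> ball ?x e" using that by (auto simp: W_def)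
    have seg: "x + t *\<^sub>R (y - x) \<in> cmap ?c ` cdom ?c"
      if "x \<in> ball ?x e" "y \<in> ball ?x e" "t \<in> {0..1}" for x y t
    proof -
      have "(1 - t) *\<^sub>R x + t *\<^sub>R y \<in> ball ?x e"
        using that convex_ball[of ?x e] unfolding convex_alt by auto
      moreover have "(1 - t) *\<^sub>R x + t *\<^sub>R y = x + t *\<^sub>R (y - x)" by (simp add: algebra_simps)
      ultimately show ?thesis using e(2) by auto
    qed
    have "\<exists>T. joined (cinv ?c ?x) (cinv ?c (?x + (?y - ?x))) T"
      by (rule joined_in_chart[OF c(1) seg]) (use q e in auto)
    moreover have "\<exists>T. joined (cinv ?c ?y) (cinv ?c (?y + (?x - ?y))) T"
      by (rule joined_in_chart[OF c(1) seg]) (use q e in auto)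
    ultimately show ?thesis using c q by simp
  qed
  ultimately show "\<exists>W. openin (top_of_set UNIV) W \<and> p \<in> W \<and>
      (\<forall>q\<in>W. (\<exists>T. joined p q T) \<and> (\<exists>T. joined q p T))" by auto
qed auto

end

section \<open>Invariant inner products of compact groups\<close>

text \<open>The point is the unique minimiser over \<open>K\<close> of the invariant function
  \<open>v \<mapsto> max {norm (h v) | h \<in> H}\<close>; uniqueness comes from the parallelogram law.\<close>

lemma compact_semigroup_fixed_point:
  fixes act :: "'g::topological_space \<Rightarrow> 'e::euclidean_space \<Rightarrow> 'e"
  assumes H: "compact H" "H \<noteq> {}"
    and lin: "\<And>h. h \<in> H \<Longrightarrow> linear (act h)" and inj: "\<And>h. h \<in> H \<Longrightarrow> inj (act h)"
    and cont: "\<And>v. continuous_on H (\<lambda>h. act h v)"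
    and mult: "\<And>h k. h \<in> H \<Longrightarrow> k \<in> H \<Longrightarrow> \<exists>l\<in>H. \<forall>v. act l v = act k (act h v)"
    and K: "compact K" "convex K" "K \<noteq> {}" "\<And>h v. h \<in> H \<Longrightarrow> v \<in> K \<Longrightarrow> act h v \<in> K"
  shows "\<exists>v\<in>K. \<forall>h\<in>H. act h v = v"
proof -
  have "\<exists>h\<in>H. \<forall>k\<in>H. norm (act k v) \<le> norm (act h v)" for v
    by (rule continuous_attains_sup[OF H]) (intro continuous_on_norm cont)
  then obtain m where m: "\<And>v. m v \<in> H" "\<And>v k. k \<in> H \<Longrightarrow> norm (act k v) \<le> norm (act (m v) v)" by metis
  define F where "F = (\<lambda>v. norm (act (m v) v))"
  have F: "norm (act h v) \<le> F v" if "h \<in> H" for h v using m(2)[OF that] by (simp add: F_def)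
  obtain L where L: "L \<ge> 0" "\<And>h v. h \<in> H \<Longrightarrow> norm (act h v) \<le> L * norm v"
    by (rule compact_basis_expansion_bound[OF H(1) lin cont]) auto
  have lip: "F v - F w \<le> L * norm (v - w)" for v w
  proof -
    have "norm (act (m v) v) \<le> norm (act (m v) w) + norm (act (m v) (v - w))"
      using norm_triangle_ineq[of "act (m v) w" "act (m v) (v - w)"] by (simp add: linear_diff[OF lin[OF m(1)]])
    then show ?thesis using F[OF m(1), of v w] L(2)[OF m(1), of v "v - w"] by (simp add: F_def)
  qed
  have "continuous_on K F"
  proof (rule continuous_onI)
    fix v e assume "v \<in> K" and e: "(e::real) > 0"
    show "\<exists>d>0. \<forall>w\<in>K. dist w v < d \<longrightarrow> dist (F w) (F v) \<le> e"
    proof (intro exI[of _ "e / (L + 1)"] conjI ballI impI)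
      show "e / (L + 1) > 0" using e L(1) by simp
      fix w assume "dist w v < e / (L + 1)"
      then have "(L + 1) * norm (w - v) \<le> e" using L(1) by (simp add: dist_norm field_simps)
      then have "L * norm (w - v) \<le> e" using norm_ge_zero[of "w - v"] unfolding distrib_right by linarith
      then show "dist (F w) (F v) \<le> e"
        using lip[of w v] lip[of v w] by (simp add: dist_real_def norm_minus_commute abs_le_iff)
    qed
  qed
  then obtain u where u: "u \<in> K" "\<And>v. v \<in> K \<Longrightarrow> F u \<le> F v"
    using continuous_attains_inf[OF K(1,3)] by blast
  have unique: "v = u" if v: "v \<in> K" "F v \<le> F u" for v
  proof (rule ccontr)
    assume ne: "v \<noteq> u"
    define w where "w = (1 / 2) *\<^sub>R u + (1 / 2) *\<^sub>R v"
    have w: "w \<in> K" unfolding w_def by (rule convexD[OF K(2) u(1) v(1)]) auto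
    let ?a = "act (m w) u" and ?b = "act (m w) v"
    \<comment> \<open>Injectivity keeps the images of two distinct minimisers distinct, so the
      parallelogram law makes their midpoint strictly better than both.\<close>
    have "?a - ?b \<noteq> 0" using inj[OF m(1)] ne by (metis eq_iff_diff_eq_0 injD)
    then have pos: "(norm (?a - ?b))\<^sup>2 > 0" by simp
    have aw: "act (m w) w = (1 / 2) *\<^sub>R (?a + ?b)"
      unfolding w_def by (simp add: linear_add[OF lin[OF m(1)]] linear_cmul[OF lin[OF m(1)]] scaleR_add_right)
    have "(F w)\<^sup>2 = (norm (?a + ?b))\<^sup>2 / 4" by (simp add: F_def aw power_divide)
    also have "\<dots> = ((norm ?a)\<^sup>2 + (norm ?b)\<^sup>2) / 2 - (norm (?a - ?b))\<^sup>2 / 4"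
      by (simp add: power2_norm_eq_inner inner_add_left inner_add_right inner_diff_left inner_diff_right inner_commute field_simps)
    also have "\<dots> < ((norm ?a)\<^sup>2 + (norm ?b)\<^sup>2) / 2" using pos by linarith
    also have "\<dots> \<le> ((F u)\<^sup>2 + (F u)\<^sup>2) / 2"
      using F[OF m(1), of w u] F[OF m(1), of w v] v(2)
      by (intro divide_right_mono add_mono power_mono) auto
    finally have "(F w)\<^sup>2 < (F u)\<^sup>2" by simp
    then have "F w < F u" by (rule power2_less_imp_less) (simp add: F_def)
    then show False using u(2)[OF w] by simp
  qed
  have "act h u = u" if h: "h \<in> H" for h
  proof (rule unique)
    show "act h u \<in> K" using K(4) h u(1) .
    \<comment> \<open>Acting by \<open>h\<close> and then by the maximising element is acting by one
      element of \<open>H\<close>, so \<open>F\<close> does not grow under \<open>H\<close>. Hence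
      \<open>act h u\<close> is again a minimiser and equals \<open>u\<close>.\<close>
    obtain l where "l \<in> H" "act l u = act (m (act h u)) (act h u)" using mult[OF h m(1)] by blast
    then show "F (act h u) \<le> F u" using F[of l u] by (simp add: F_def)
  qed
  then show ?thesis using u(1) by blast
qed

lemma transpose_inner: "(transpose M *v x) \<bullet> y = x \<bullet> (M *v y)" for M :: "real^'n^'m"
  by (simp add: transpose_matrix_vector dot_lmul_matrix)

text \<open>\<open>H\<close> acts on bilinear forms by pullback, and an invariant inner product is a
  fixed point of this action inside a compact convex set of inner products.\<close>

lemma invariant_inner_product:
  fixes H :: "(real^'n^'n) set"
  assumes H: "compact H" "H \<noteq> {}" and inj: "\<And>M. M \<in> H \<Longrightarrow> inj ((*v) M)"
    and mult: "\<And>M N. M \<in> H \<Longrightarrow> N \<in> H \<Longrightarrow> M ** N \<in> H"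
  obtains B :: "real^'n^'n" where "\<And>x y. x \<bullet> (B *v y) = y \<bullet> (B *v x)" "\<And>x. x \<noteq> 0 \<Longrightarrow> 0 < x \<bullet> (B *v x)"
    "\<And>M x y. M \<in> H \<Longrightarrow> (M *v x) \<bullet> (B *v (M *v y)) = x \<bullet> (B *v y)"
proof -
  define act where "act = (\<lambda>(M::real^'n^'n) (B::real^'n^'n). transpose M ** B ** M)"
  have act: "x \<bullet> (act M B *v y) = (M *v x) \<bullet> (B *v (M *v y))" for M B x y
  proof -
    have "x \<bullet> (act M B *v y) = (transpose M *v (B *v (M *v y))) \<bullet> x"
      by (simp add: act_def matrix_vector_mul_assoc[symmetric] inner_commute del: transpose_matrix_vector)
    also have "\<dots> = (B *v (M *v y)) \<bullet> (M *v x)" by (rule transpose_inner)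
    finally show ?thesis by (simp only: inner_commute[of "M *v x"])
  qed
  have lin: "linear (act M)" for M
    by (rule linearI) (simp_all add: act_def vec_eq_iff matrix_matrix_mult_def sum.distrib sum_distrib_left sum_distrib_right algebra_simps)
  define Q where "Q = {B :: real^'n^'n. (\<forall>x y. x \<bullet> (B *v y) = y \<bullet> (B *v x)) \<and> (\<forall>x. x \<noteq> 0 \<longrightarrow> 0 < x \<bullet> (B *v x))}"
  have Q: "convex Q"
  proof (rule convexI)
    fix B C u v assume B: "B \<in> Q" "C \<in> Q" and uv: "(u::real) \<ge> 0" "v \<ge> 0" "u + v = 1"
    have e: "x \<bullet> ((u *\<^sub>R B + v *\<^sub>R C) *v y) = u * (x \<bullet> (B *v y)) + v * (x \<bullet> (C *v y))" for x y
      by (simp add: matrix_vector_mult_add_rdistrib scaleR_matrix_vector_assoc[symmetric] inner_add_right)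
    have "0 < u * (x \<bullet> (B *v x)) + v * (x \<bullet> (C *v x))" if "x \<noteq> 0" for x
    proof -
      have p: "0 < x \<bullet> (B *v x)" "0 < x \<bullet> (C *v x)" using B that by (auto simp: Q_def)
      show ?thesis
      proof (cases "u = 0")
        case True
        then show ?thesis using uv p by simp
      next
        case False
        then show ?thesis using uv p by (intro add_pos_nonneg) auto
      qed
    qed
    then show "u *\<^sub>R B + v *\<^sub>R C \<in> Q" using B by (simp add: Q_def e)
  qed
  \<comment> \<open>The orbit of the standard inner product. Its convex hull is compact, stable
    under \<open>H\<close> and, as \<open>Q\<close> is convex, made of inner products.\<close>
  define S where "S = (\<lambda>M. act M (mat 1)) ` H"
  have cont: "continuous_on X (\<lambda>M. act M B)" for X B
    unfolding act_def matrix_matrix_mult_def transpose_def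
    by (intro continuous_intros)
  have "S \<subseteq> Q"
  proof
    fix B assume "B \<in> S"
    then obtain M where M: "M \<in> H" "B = act M (mat 1)" by (auto simp: S_def)
    have "M *v x \<noteq> 0" if "x \<noteq> 0" for x
      using inj[OF M(1)] that by (metis injD matrix_vector_mult_0_right)
    then show "B \<in> Q" unfolding Q_def M(2) by (simp add: act inner_commute)
  qed
  then have KQ: "convex hull S \<subseteq> Q" using Q by (rule hull_minimal)
  \<comment> \<open>Pullback reverses the order of composition, which closure of \<open>H\<close>
    under products in either order tolerates.\<close>
  have act_mult: "act N (act M B) = act (M ** N) B" for M N B
    by (simp add: act_def matrix_transpose_mul matrix_mul_assoc)
  have "\<exists>B\<in>convex hull S. \<forall>M\<in>H. act M B = B"
  proof (rule compact_semigroup_fixed_point[OF H lin])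
    show "inj (act M)" if M: "M \<in> H" for M
    proof -
      \<comment> \<open>An injective square matrix is invertible; pullback along the inverse undoes
        pullback along \<open>M\<close>.\<close>
      obtain N where "N ** M = mat 1" using inj[OF M] matrix_left_invertible_injective by blast
      then have "M ** N = mat 1" by (simp add: matrix_left_right_inverse)
      then have "act N (act M B) = B" for B
        unfolding act_mult by (simp add: act_def transpose_mat)
      then show ?thesis by (rule inj_on_inverseI)
    qed
    show "compact (convex hull S)"
      unfolding S_def by (intro compact_convex_hull compact_continuous_image cont H)
    show "convex hull S \<noteq> {}" using H by (simp add: S_def)
    show "\<exists>L\<in>H. \<forall>B. act L B = act N (act M B)" if "M \<in> H" "N \<in> H" for M N
      using mult[OF that] act_mult by metis
    fix M B assume M: "M \<in> H" and B: "B \<in> convex hull S"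
    have "act M ` (convex hull S) = convex hull (act M ` S)" by (rule convex_hull_linear_image[OF lin])
    moreover have "act M ` S \<subseteq> S" using mult M by (auto simp: S_def act_mult)
    ultimately show "act M B \<in> convex hull S" using B hull_mono by blast
  qed (use cont convex_convex_hull in auto)
  then obtain B where B: "B \<in> Q" "\<And>M. M \<in> H \<Longrightarrow> act M B = B" using KQ by blast
  show ?thesis
  proof (rule that)
    show "(M *v x) \<bullet> (B *v (M *v y)) = x \<bullet> (B *v y)" if "M \<in> H" for M x y
      using act[of x M B y] B(2)[OF that] by simp
  qed (use B(1) in \<open>auto simp: Q_def\<close>)
qed

section \<open>The parallel metric\<close>

context manifold_connection
begin

lemma joined_linear:
  assumes T: "joined p q T" and v: "v \<in> tangent_space A p" "w \<in> tangent_space A p"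
  shows "T (tadd v w) = tadd (T v) (T w)" "T (tscale r v) = tscale r (T v)"
proof -
  have e: "tadd (tscale 1 v) (tscale 1 w) = tadd v w" "tadd (tscale r v) (tscale 0 v) = tscale r v"
    "tadd (tscale 1 (T v)) (tscale 1 (T w)) = tadd (T v) (T w)" "tadd (tscale r (T v)) (tscale 0 (T v)) = tscale r (T v)"
    by (simp_all add: tadd_def tscale_def)
  show "T (tadd v w) = tadd (T v) (T w)"
    using joined_combination[OF T v tangent_space_closed(1)[OF v], of 1 1] unfolding e by simp
  show "T (tscale r v) = tscale r (T v)"
    using joined_combination[OF T v(1) v(1) tangent_tscale[OF v(1), of r], of r 0] unfolding e by simp
qed

lemma joined_inj:
  assumes T: "joined p q T" and v: "v \<in> tangent_space A p" "w \<in> tangent_space A p" and eq: "T v = T w"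
  shows "v = w"
proof -
  have e: "tadd (tscale 1 x) (tscale 0 x) = x" for x :: "('m, 'n) tvec" by (simp add: tadd_def tscale_def)
  show ?thesis using joined_combination[OF T v(2) v(2) v(1), of 1 0] eq unfolding e by simp
qed

text \<open>Read in charts, translation is an injective linear map between spaces of equal
  dimension; linear algebra thus supplies the inverse that the reversed path would give.\<close>

lemma joined_coordinates:
  assumes T: "joined p q T" and c: "c \<in> A" "p \<in> cdom c" and d: "d \<in> A" "q \<in> cdom d"
  shows "linear (\<lambda>\<xi>. T (coord_vec A c p \<xi>) d)" "inj (\<lambda>\<xi>. T (coord_vec A c p \<xi>) d)"
    "surj (\<lambda>\<xi>. T (coord_vec A c p \<xi>) d)"
proof -
  note cv = coord_vec_tangent[OF c]
  show l: "linear (\<lambda>\<xi>. T (coord_vec A c p \<xi>) d)"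
    by (rule linearI) (simp_all add: coord_vec_linear[OF c] joined_linear[OF T cv cv])
  show i: "inj (\<lambda>\<xi>. T (coord_vec A c p \<xi>) d)"
  proof (rule injI)
    fix \<xi> \<eta> assume "T (coord_vec A c p \<xi>) d = T (coord_vec A c p \<eta>) d"
    then have "T (coord_vec A c p \<xi>) = T (coord_vec A c p \<eta>)"
      by (intro tangent_eqI[OF joined_tangent[OF T cv] joined_tangent[OF T cv] d])
    then have "coord_vec A c p \<xi> = coord_vec A c p \<eta>" by (rule joined_inj[OF T cv cv])
    then have "coord_vec A c p \<xi> c = coord_vec A c p \<eta> c" by simp
    then show "\<xi> = \<eta>" using c by simp
  qed
  show "surj (\<lambda>\<xi>. T (coord_vec A c p \<xi>) d)"
    by (rule linear_injective_imp_surjective[OF l i refl])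
qed

lemma joined_surj:
  assumes T: "joined p q T" and w: "w \<in> tangent_space A q"
  obtains v where "v \<in> tangent_space A p" "T v = w"
proof -
  let ?c = "chart_at A p" and ?d = "chart_at A q"
  obtain \<xi> where \<xi>: "w ?d = T (coord_vec A ?c p \<xi>) ?d"
    using surjD[OF joined_coordinates(3)[OF T chart_at chart_at], of "w ?d"] by (rule exE)
  have cv: "coord_vec A ?c p \<xi> \<in> tangent_space A p" by (rule coord_vec_tangent[OF chart_at])
  have "T (coord_vec A ?c p \<xi>) = w"
    by (rule tangent_eqI[OF joined_tangent[OF T cv] w chart_at]) (simp add: \<xi>)
  then show ?thesis using that cv by blast
qed

end

text \<open>The assumptions are pointwise algebra and invariance under translation. Smoothness is
  absent on purpose: it is to be derived from the invariance.\<close>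

locale parallel_metric = manifold_connection A D
  for A :: "('m::topological_space, 'n::finite) chart set" and D :: "('m, 'n) connection" +
  fixes G :: "('m, 'n) metric"
  assumes G_add: "\<And>p u v w. u \<in> tangent_space A p \<Longrightarrow> v \<in> tangent_space A p \<Longrightarrow> w \<in> tangent_space A p \<Longrightarrow>
      G p (tadd u v) w = G p u w + G p v w"
    and G_scale: "\<And>p v w r. v \<in> tangent_space A p \<Longrightarrow> w \<in> tangent_space A p \<Longrightarrow> G p (tscale r v) w = r * G p v w"
    and G_sym: "\<And>p v w. v \<in> tangent_space A p \<Longrightarrow> w \<in> tangent_space A p \<Longrightarrow> G p v w = G p w v"
    and G_pos: "\<And>p v. v \<in> tangent_space A p \<Longrightarrow> v \<noteq> tzero \<Longrightarrow> 0 < G p v v"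
    and G_joined: "\<And>p q T v w. joined p q T \<Longrightarrow> v \<in> tangent_space A p \<Longrightarrow> w \<in> tangent_space A p \<Longrightarrow>
      G q (T v) (T w) = G p v w"

context manifold_connection
begin

theorem parallel_metric_exists:
  assumes conn: "connected (UNIV :: 'm set)" and comp: "compact_holonomy A D p\<^sub>0"
  obtains G where "parallel_metric A D G"
proof -
  let ?c = "chart_at A p\<^sub>0"
  note c = chart_at[of p\<^sub>0]
  define H where "H = tmatrix A p\<^sub>0 ` holonomy_group A D p\<^sub>0"
  have tm: "tmatrix A p\<^sub>0 T *v \<xi> = T (coord_vec A ?c p\<^sub>0 \<xi>) ?c" if "joined p\<^sub>0 p\<^sub>0 T" for T \<xi>
    using joined_coordinates(1)[OF that c c] by (simp add: tmatrix_def Let_def matrix_works linear_matrix_vector_mul_eq)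
  have Hne: "H \<noteq> {}" using joined_exists[OF conn, of p\<^sub>0 p\<^sub>0] by (auto simp: H_def holonomy_group_joined)
  have Hinj: "inj ((*v) M)" if "M \<in> H" for M
  proof -
    obtain T where T: "joined p\<^sub>0 p\<^sub>0 T" "M = tmatrix A p\<^sub>0 T" using \<open>M \<in> H\<close> by (auto simp: H_def holonomy_group_joined)
    then have "(*v) M = (\<lambda>\<xi>. T (coord_vec A ?c p\<^sub>0 \<xi>) ?c)" by (simp add: fun_eq_iff tm)
    then show ?thesis using joined_coordinates(2)[OF T(1) c c] by simp
  qed
  have Hmult: "M ** N \<in> H" if MN: "M \<in> H" "N \<in> H" for M N
  proof -
    obtain T where T: "joined p\<^sub>0 p\<^sub>0 T" "M = tmatrix A p\<^sub>0 T" using MN by (auto simp: H_def holonomy_group_joined)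
    obtain S where S: "joined p\<^sub>0 p\<^sub>0 S" "N = tmatrix A p\<^sub>0 S" using MN by (auto simp: H_def holonomy_group_joined)
    obtain R where R: "joined p\<^sub>0 p\<^sub>0 R" "\<And>v. v \<in> tangent_space A p\<^sub>0 \<Longrightarrow> R v = T (S v)"
      using joined_compose[OF S(1) T(1)] by blast
    note cv = coord_vec_tangent[OF c]
    have "tmatrix A p\<^sub>0 R *v \<xi> = (M ** N) *v \<xi>" for \<xi>
    proof -
      have "coord_vec A ?c p\<^sub>0 (S (coord_vec A ?c p\<^sub>0 \<xi>) ?c) = S (coord_vec A ?c p\<^sub>0 \<xi>)"
        by (rule coord_vec_of_tangent[OF joined_tangent[OF S(1) cv] c])
      then show ?thesis
        by (simp add: tm[OF R(1)] R(2)[OF cv] T(2) S(2) matrix_vector_mul_assoc[symmetric] tm[OF T(1)] tm[OF S(1)])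
    qed
    then have "tmatrix A p\<^sub>0 R = M ** N" by (simp add: matrix_eq)
    then show ?thesis using R(1) by (force simp: H_def holonomy_group_joined)
  qed
  obtain B where B: "\<And>x y. x \<bullet> (B *v y) = y \<bullet> (B *v x)" "\<And>x. x \<noteq> 0 \<Longrightarrow> 0 < x \<bullet> (B *v x)"
    "\<And>M x y. M \<in> H \<Longrightarrow> (M *v x) \<bullet> (B *v (M *v y)) = x \<bullet> (B *v y)"
    by (rule invariant_inner_product[OF _ Hne Hinj Hmult]) (use comp in \<open>auto simp: compact_holonomy_def H_def\<close>)
  define b where "b = (\<lambda>u v :: ('m, 'n) tvec. u ?c \<bullet> (B *v v ?c))"
  have b: "b (T u) (T v) = b u v" if "joined p\<^sub>0 p\<^sub>0 T" "u \<in> tangent_space A p\<^sub>0" "v \<in> tangent_space A p\<^sub>0" for T u v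
  proof -
    have "tmatrix A p\<^sub>0 T \<in> H" using that(1) by (auto simp: H_def holonomy_group_joined)
    from B(3)[OF this, of "u ?c" "v ?c"] show ?thesis
      by (simp add: b_def tm[OF that(1)] coord_vec_of_tangent[OF _ c] that)
  qed
  have "\<exists>P. joined p\<^sub>0 p P" for p using joined_exists[OF conn, of p\<^sub>0 p] by blast
  then obtain P where P: "\<And>p. joined p\<^sub>0 p (P p)" by metis
  \<comment> \<open>\<open>S p\<close> inverts the chosen translation \<open>P p\<close>. The form
    pulled back along it might depend on that choice; \<open>inv\<close> shows that translation
    along any other path preserves it as well.\<close>
  define S where "S = (\<lambda>p v. SOME v0. v0 \<in> tangent_space A p\<^sub>0 \<and> P p v0 = v)"
  have S: "S p v \<in> tangent_space A p\<^sub>0" "P p (S p v) = v" if "v \<in> tangent_space A p" for p v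
    using someI_ex[of "\<lambda>v0. v0 \<in> tangent_space A p\<^sub>0 \<and> P p v0 = v"] joined_surj[OF P that] unfolding S_def by blast+
  have Seq: "S p v = v0" if "v0 \<in> tangent_space A p\<^sub>0" "P p v0 = v" "v \<in> tangent_space A p" for p v v0
    by (rule joined_inj[OF P[of p] S(1)[OF that(3)] that(1)]) (simp add: S(2) that)
  have Sadd: "S p (tadd u v) = tadd (S p u) (S p v)" if "u \<in> tangent_space A p" "v \<in> tangent_space A p" for p u v
    by (rule Seq) (use that in \<open>simp_all add: S tangent_space_closed joined_linear[OF P]\<close>)
  have Sscale: "S p (tscale r v) = tscale r (S p v)" if "v \<in> tangent_space A p" for p r v
    by (rule Seq) (use that in \<open>simp_all add: S tangent_tscale joined_linear(2)[OF P S(1)[OF that] S(1)[OF that]]\<close>)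
  define G where "G = (\<lambda>p u v. b (S p u) (S p v))"
  have inv: "G q (T v) (T w) = G p v w"
    if T: "joined p q T" and v: "v \<in> tangent_space A p" "w \<in> tangent_space A p" for p q T v w
  proof -
    \<comment> \<open>With a return path \<open>R\<close> from \<open>q\<close>, both
      \<open>Y\<close> (\<open>P p\<close>, then \<open>T\<close>, then \<open>R\<close>) and
      \<open>Z\<close> (\<open>P q\<close>, then \<open>R\<close>) are translations around loops at
      \<open>p\<^sub>0\<close> and preserve \<open>b\<close>. They send \<open>S p v\<close> and
      \<open>S q (T v)\<close> to the same vector, so the two values of \<open>b\<close>
      agree.\<close>
    obtain R where R: "joined q p\<^sub>0 R" using joined_exists[OF conn, of q p\<^sub>0] by blast
    obtain X where X: "joined p\<^sub>0 q X" "\<And>v. v \<in> tangent_space A p\<^sub>0 \<Longrightarrow> X v = T (P p v)"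
      using joined_compose[OF P T] by blast
    obtain Y where Y: "joined p\<^sub>0 p\<^sub>0 Y" "\<And>v. v \<in> tangent_space A p\<^sub>0 \<Longrightarrow> Y v = R (X v)"
      using joined_compose[OF X(1) R] by blast
    obtain Z where Z: "joined p\<^sub>0 p\<^sub>0 Z" "\<And>v. v \<in> tangent_space A p\<^sub>0 \<Longrightarrow> Z v = R (P q v)"
      using joined_compose[OF P R] by blast
    have e: "Y (S p v) = Z (S q (T v))" if "v \<in> tangent_space A p" for v
      using that joined_tangent[OF T that] by (simp add: Y(2) Z(2) X(2) S)
    have "G p v w = b (Y (S p v)) (Y (S p w))" by (simp add: G_def b[OF Y(1)] S v)
    also have "\<dots> = G q (T v) (T w)"
      by (simp add: e v b[OF Z(1)] S joined_tangent[OF T] G_def)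
    finally show ?thesis by simp
  qed
  show ?thesis
  proof (rule that[of G], unfold_locales)
    fix p u v w r
    assume v: "v \<in> tangent_space A p"
    show "G p (tadd u v) w = G p u w + G p v w" if "u \<in> tangent_space A p" "w \<in> tangent_space A p"
      by (simp add: G_def b_def Sadd v that inner_add_left)
    show "G p (tscale r v) w = r * G p v w" if "w \<in> tangent_space A p"
      by (simp add: G_def b_def Sscale v)
    show "G p v w = G p w v" by (simp add: G_def b_def B(1))
    show "0 < G p v v" if "v \<noteq> tzero"
    proof -
      have "S p v ?c \<noteq> 0"
      proof
        assume "S p v ?c = 0"
        then have "S p v = tzero" by (intro tangent_eqI[OF S(1)[OF v] tzero_tangent c]) simp
        moreover have "P p tzero = tzero"
        proof -
          have "P p (tscale 0 tzero) = tscale 0 (P p tzero)" by (rule joined_linear(2)[OF P tzero_tangent tzero_tangent])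
          then show ?thesis by (simp add: tscale_def tzero_def)
        qed
        ultimately show False using S(2)[OF v] that by simp
      qed
      then show ?thesis by (simp add: G_def b_def B(2))
    qed
  qed (rule inv)
qed

end

section \<open>Smoothness of parallel bilinear forms\<close>

text \<open>The situation in one chart, stripped of the manifold. \<open>G_line0\<close> is the
  parallel equation read along straight lines, and the only link between the forms at different
  points; continuity and smoothness in the point have to be extracted from it.\<close>

locale parallel_form =
  fixes S :: "'a::euclidean_space set" and \<Gamma> :: "'a \<Rightarrow> 'a \<Rightarrow> 'a \<Rightarrow> 'a" and G :: "'a \<Rightarrow> 'a \<Rightarrow> 'a \<Rightarrow> real"
  assumes S: "open S"
    and \<Gamma>_linear: "\<And>x \<eta>. x \<in> S \<Longrightarrow> linear (\<lambda>\<xi>. \<Gamma> x \<xi> \<eta>)" "\<And>x \<xi>. x \<in> S \<Longrightarrow> linear (\<Gamma> x \<xi>)"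
    and \<Gamma>_smooth: "\<And>\<xi> \<eta>. Cinf_on S (\<lambda>x. \<Gamma> x \<xi> \<eta>)"
    and G_linear: "\<And>x \<eta>. x \<in> S \<Longrightarrow> linear (\<lambda>\<xi>. G x \<xi> \<eta>)" "\<And>x \<xi>. x \<in> S \<Longrightarrow> linear (G x \<xi>)"
    and G_line0: "\<And>x h \<xi> \<eta>. x \<in> S \<Longrightarrow> ((\<lambda>t. G (x + t *\<^sub>R h) \<xi> \<eta>) has_real_derivative
      (G x (\<Gamma> x h \<xi>) \<eta> + G x \<xi> (\<Gamma> x h \<eta>))) (at 0)"
begin

definition G' :: "'a \<Rightarrow> 'a \<Rightarrow> 'a \<Rightarrow> 'a \<Rightarrow> real" where
  "G' x h \<xi> \<eta> = G x (\<Gamma> x h \<xi>) \<eta> + G x \<xi> (\<Gamma> x h \<eta>)"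

lemma G_line:
  assumes "x + t *\<^sub>R h \<in> S"
  shows "((\<lambda>t. G (x + t *\<^sub>R h) \<xi> \<eta>) has_real_derivative G' (x + t *\<^sub>R h) h \<xi> \<eta>) (at t)"
proof -
  have "((\<lambda>s. G (x + t *\<^sub>R h + s *\<^sub>R h) \<xi> \<eta>) has_real_derivative G' (x + t *\<^sub>R h) h \<xi> \<eta>) (at 0)"
    unfolding G'_def by (rule G_line0[OF assms])
  then have "((\<lambda>s. G (x + (s + t) *\<^sub>R h) \<xi> \<eta>) has_real_derivative G' (x + t *\<^sub>R h) h \<xi> \<eta>) (at 0)"
    by (simp add: scaleR_add_left add_ac)
  then show ?thesis using DERIV_shift[of "\<lambda>s. G (x + s *\<^sub>R h) \<xi> \<eta>" _ 0 t] by simp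
qed

section \<open>Local bounds and continuity of the coefficients\<close>

lemma G_expand:
  assumes "x \<in> S"
  shows "G x \<xi> \<eta> = (\<Sum>k\<in>Basis. (\<xi> \<bullet> k) * G x k \<eta>)" "G x \<xi> \<eta> = (\<Sum>k\<in>Basis. (\<eta> \<bullet> k) * G x \<xi> k)"
  using linear_Basis_expand[OF G_linear(1)[OF assms], of \<xi> \<eta>] linear_Basis_expand[OF G_linear(2)[OF assms], of \<xi> \<eta>]
  by simp_all

text \<open>The system couples all coefficients, so growth is estimated for all of them
  together.\<close>

definition mass :: "'a \<Rightarrow> real" where
  "mass x = (\<Sum>p\<in>Basis \<times> Basis. \<bar>G x (fst p) (snd p)\<bar>)"

lemma mass_component: "i \<in> Basis \<Longrightarrow> j \<in> Basis \<Longrightarrow> \<bar>G x i j\<bar> \<le> mass x"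
  unfolding mass_def using member_le_sum[of "(i, j)" "Basis \<times> Basis" "\<lambda>p. \<bar>G x (fst p) (snd p)\<bar>"] by simp

lemma mass_nonneg: "0 \<le> mass x"
  unfolding mass_def by (intro sum_nonneg) auto

text \<open>\<open>\<Gamma>\<close> is bounded on a compact ball, and \<open>G'\<close> is linear in
  the coefficients. The factor \<open>norm h\<close> is kept explicit so that one \<open>K\<close>
  serves all rays.\<close>

lemma G'_bound:
  assumes "x \<in> S"
  obtains r K where "r > 0" "K \<ge> 0" "cball x r \<subseteq> S"
    "\<And>y h i j. y \<in> cball x r \<Longrightarrow> i \<in> Basis \<Longrightarrow> j \<in> Basis \<Longrightarrow> \<bar>G' y h i j\<bar> \<le> K * norm h * mass y"
proof -
  obtain r where r: "r > 0" "cball x r \<subseteq> S" using S assms open_contains_cball by blast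
  have "\<exists>M\<ge>0. \<forall>y\<in>cball x r. \<forall>h. norm (\<Gamma> y h j) \<le> M * norm h" for j
  proof -
    have "\<And>i. continuous_on (cball x r) (\<lambda>y. \<Gamma> y i j)"
      by (rule continuous_on_subset[OF Cinf_on_continuous[OF \<Gamma>_smooth] r(2)])
    then show ?thesis
      using compact_basis_expansion_bound[of "cball x r" "\<lambda>y h. \<Gamma> y h j"] \<Gamma>_linear(1) r(2)
      by (metis compact_cball subsetD)
  qed
  then obtain M where M: "\<And>j. M j \<ge> 0" "\<And>j y h. y \<in> cball x r \<Longrightarrow> norm (\<Gamma> y h j) \<le> M j * norm h" by metis
  define K where "K = (\<Sum>j\<in>Basis. M j)"
  have K0: "K \<ge> 0" unfolding K_def by (intro sum_nonneg M)
  have K: "norm (\<Gamma> y h j) \<le> K * norm h" if "y \<in> cball x r" "j \<in> Basis" for y h j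
  proof -
    have "M j \<le> K" unfolding K_def using M(1) that(2) by (intro member_le_sum) auto
    then have "M j * norm h \<le> K * norm h" by (rule mult_right_mono) simp
    then show ?thesis using M(2)[OF that(1), of h j] by linarith
  qed
  show ?thesis
  proof (rule that[OF r(1) _ r(2)])
    \<comment> \<open>\<open>G'\<close> has two terms, each expanding into \<open>DIM('a)\<close>
      summands of size at most \<open>K * norm h * mass y\<close>.\<close>
    show "2 * DIM('a) * K \<ge> 0" using K0 by simp
    fix y h and i j :: 'a assume y: "y \<in> cball x r" and ij: "i \<in> Basis" "j \<in> Basis"
    have yS: "y \<in> S" using y r by blast
    have c: "\<bar>\<Gamma> y h l \<bullet> k\<bar> \<le> K * norm h" if "l \<in> Basis" "k \<in> Basis" for l k
      using K[OF y that(1), of h] Basis_le_norm[OF that(2), of "\<Gamma> y h l"] by linarith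
    have "\<bar>G y (\<Gamma> y h i) j\<bar> \<le> (\<Sum>k\<in>(Basis::'a set). K * norm h * mass y)"
      unfolding G_expand(1)[OF yS, of "\<Gamma> y h i"]
      using c ij mass_component mass_nonneg K0
      by (intro order_trans[OF sum_abs] sum_mono) (auto simp: abs_mult intro!: mult_mono)
    moreover have "\<bar>G y i (\<Gamma> y h j)\<bar> \<le> (\<Sum>k\<in>(Basis::'a set). K * norm h * mass y)"
      unfolding G_expand(2)[OF yS, of i "\<Gamma> y h j"]
      using c ij mass_component mass_nonneg K0
      by (intro order_trans[OF sum_abs] sum_mono) (auto simp: abs_mult intro!: mult_mono)
    ultimately show "\<bar>G' y h i j\<bar> \<le> 2 * DIM('a) * K * norm h * mass y"
      unfolding G'_def by simp
  qed
qed

lemma segment_in_cball: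
  "norm h \<le> r \<Longrightarrow> t \<in> {0..1} \<Longrightarrow> x + t *\<^sub>R h \<in> cball x r"
  using mult_left_le_one_le[of "norm h" t] by (simp add: dist_norm)

text \<open>Gronwall's inequality for \<open>\<phi>\<close>, the sum of the squared coefficients, along the rays from \<open>x\<close>.\<close>

lemma mass_bound:
  assumes r: "r > 0" "K \<ge> 0" "cball x r \<subseteq> S"
    and K: "\<And>y h i j. y \<in> cball x r \<Longrightarrow> i \<in> Basis \<Longrightarrow> j \<in> Basis \<Longrightarrow> \<bar>G' y h i j\<bar> \<le> K * norm h * mass y"
  obtains C where "\<And>y. y \<in> cball x r \<Longrightarrow> mass y \<le> C"
proof -
  let ?I = "(Basis :: 'a set) \<times> (Basis :: 'a set)"
  define N where "N = real (card ?I)"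
  define \<phi> where "\<phi> y = (\<Sum>p\<in>?I. (G y (fst p) (snd p))\<^sup>2)" for y
  \<comment> \<open>Squares are differentiable where the absolute values in \<open>mass\<close> may
    fail to be; Cauchy-Schwarz over the \<open>N\<close> coefficients passes between them. With
    \<open>norm h \<le> r\<close> this yields the growth rate \<open>2 * K * r * N\<close> of
    \<open>\<phi>\<close>.\<close>
  have m\<phi>: "(mass y)\<^sup>2 \<le> N * \<phi> y" for y
    using sum_squared_le_sum_of_squares[of "\<lambda>p. \<bar>G y (fst p) (snd p)\<bar>" ?I]
    by (simp add: mass_def \<phi>_def N_def mult.commute)
  have \<phi>0: "\<phi> y \<ge> 0" for y unfolding \<phi>_def by (intro sum_nonneg) auto
  have bound: "\<phi> (x + h) \<le> exp (2 * K * r * N) * \<phi> x" if h: "norm h \<le> r" for h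
  proof -
    define \<phi>' where "\<phi>' t = (\<Sum>p\<in>?I. 2 * G (x + t *\<^sub>R h) (fst p) (snd p) * G' (x + t *\<^sub>R h) h (fst p) (snd p))" for t
    have "norm (\<phi> (x + 1 *\<^sub>R h)) \<le> exp ((2 * K * r * N) * \<bar>1 - 0\<bar>) * norm (\<phi> (x + 0 *\<^sub>R h))"
    proof (rule gronwall_linear[where f = "\<lambda>t. \<phi> (x + t *\<^sub>R h)" and f' = \<phi>' and a = 0 and b = 1])
      fix t :: real assume t: "t \<in> {0..1}"
      let ?y = "x + t *\<^sub>R h"
      have y: "?y \<in> cball x r" by (rule segment_in_cball[OF h t])
      then have yS: "?y \<in> S" using r(3) by blast
      have "((\<lambda>t. \<phi> (x + t *\<^sub>R h)) has_real_derivative \<phi>' t) (at t)"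
        unfolding \<phi>_def \<phi>'_def
      proof (rule DERIV_sum)
        fix p
        show "((\<lambda>t. (G (x + t *\<^sub>R h) (fst p) (snd p))\<^sup>2) has_real_derivative
            2 * G ?y (fst p) (snd p) * G' ?y h (fst p) (snd p)) (at t)"
          using DERIV_power[OF G_line[OF yS, of "fst p" "snd p"], of 2] by (simp add: mult_ac)
      qed
      then show "((\<lambda>t. \<phi> (x + t *\<^sub>R h)) has_vector_derivative \<phi>' t) (at t within {0..1})"
        by (auto simp: has_real_derivative_iff_has_vector_derivative intro: has_vector_derivative_at_within)
      have "\<bar>\<phi>' t\<bar> \<le> (\<Sum>p\<in>?I. \<bar>2 * G ?y (fst p) (snd p) * G' ?y h (fst p) (snd p)\<bar>)"
        unfolding \<phi>'_def by (rule sum_abs)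
      also have "\<dots> \<le> (\<Sum>p\<in>?I. 2 * \<bar>G ?y (fst p) (snd p)\<bar> * (K * r * mass ?y))"
      proof (rule sum_mono)
        fix p assume "p \<in> ?I"
        then have p: "fst p \<in> Basis" "snd p \<in> Basis" by auto
        have "K * norm h * mass ?y \<le> K * r * mass ?y"
          by (intro mult_right_mono mult_left_mono h r(2) mass_nonneg)
        then have "\<bar>G' ?y h (fst p) (snd p)\<bar> \<le> K * r * mass ?y"
          using K[OF y p, of h] by linarith
        then have "2 * \<bar>G ?y (fst p) (snd p)\<bar> * \<bar>G' ?y h (fst p) (snd p)\<bar> \<le> 2 * \<bar>G ?y (fst p) (snd p)\<bar> * (K * r * mass ?y)"
          by (intro mult_left_mono) auto
        then show "\<bar>2 * G ?y (fst p) (snd p) * G' ?y h (fst p) (snd p)\<bar> \<le> 2 * \<bar>G ?y (fst p) (snd p)\<bar> * (K * r * mass ?y)"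
          by (simp only: abs_mult abs_numeral)
      qed
      also have "\<dots> = 2 * K * r * (mass ?y)\<^sup>2"
        by (simp add: sum_distrib_right[symmetric] sum_distrib_left[symmetric] mass_def[symmetric] power2_eq_square)
      also have "\<dots> \<le> 2 * K * r * (N * \<phi> ?y)"
        using r by (intro mult_left_mono m\<phi>) auto
      finally show "norm (\<phi>' t) \<le> 2 * K * r * N * norm (\<phi> ?y)" using \<phi>0[of ?y] by simp
    qed auto
    then show ?thesis using \<phi>0 by simp
  qed
  show ?thesis
  proof (rule that)
    fix y assume "y \<in> cball x r"
    then have h: "norm (y - x) \<le> r" by (simp add: dist_norm norm_minus_commute)
    have "N * \<phi> (x + (y - x)) \<le> N * (exp (2 * K * r * N) * \<phi> x)"
      by (rule mult_left_mono[OF bound[OF h]]) (simp add: N_def)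
    then have "(mass y)\<^sup>2 \<le> N * (exp (2 * K * r * N) * \<phi> x)"
      using m\<phi>[of y] by (simp only: add_diff_eq add_diff_cancel_left')
    then show "mass y \<le> sqrt (N * (exp (2 * K * r * N) * \<phi> x))" by (rule real_le_rsqrt)
  qed
qed

text \<open>On the ball \<open>mass\<close> is bounded by \<open>C\<close>, so the mean value
  theorem along each ray gives a Lipschitz estimate at \<open>x\<close> with constant
  \<open>K * C\<close>, the same for all directions. Bilinearity extends continuity from basis
  vectors to all arguments.\<close>

lemma G_continuous: "continuous_on S (\<lambda>x. G x \<xi> \<eta>)"
proof -
  have basis: "continuous_on S (\<lambda>x. G x i j)" if ij: "i \<in> Basis" "j \<in> Basis" for i j
  proof (rule continuous_at_imp_continuous_on, rule ballI)
    fix x assume "x \<in> S"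
    then obtain r K where r: "r > 0" "K \<ge> 0" "cball x r \<subseteq> S"
      "\<And>y h i j. y \<in> cball x r \<Longrightarrow> i \<in> Basis \<Longrightarrow> j \<in> Basis \<Longrightarrow> \<bar>G' y h i j\<bar> \<le> K * norm h * mass y"
      using G'_bound by blast
    obtain C where C: "\<And>y. y \<in> cball x r \<Longrightarrow> mass y \<le> C" using mass_bound[OF r] by blast
    have C0: "C \<ge> 0" using C[of x] mass_nonneg[of x] r(1) by simp
    have lip: "\<bar>G (x + h) i j - G x i j\<bar> \<le> K * C * norm h" if h: "norm h \<le> r" for h
    proof -
      have "((\<lambda>t. G (x + t *\<^sub>R h) i j) has_real_derivative G' (x + t *\<^sub>R h) h i j) (at t)"
        if "0 \<le> t" "t \<le> 1" for t
        by (rule G_line) (use segment_in_cball[OF h, of t x] that r(3) in auto)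
      then obtain t where t: "0 < t" "t < 1" "G (x + 1 *\<^sub>R h) i j - G (x + 0 *\<^sub>R h) i j = (1 - 0) * G' (x + t *\<^sub>R h) h i j"
        using MVT2[of 0 1 "\<lambda>t. G (x + t *\<^sub>R h) i j" "\<lambda>t. G' (x + t *\<^sub>R h) h i j"] by auto
      have y: "x + t *\<^sub>R h \<in> cball x r" by (rule segment_in_cball[OF h]) (use t in auto)
      have "\<bar>G' (x + t *\<^sub>R h) h i j\<bar> \<le> K * norm h * mass (x + t *\<^sub>R h)" by (rule r(4)[OF y ij])
      also have "\<dots> \<le> K * norm h * C" using r(2) C[OF y] by (intro mult_left_mono) auto
      finally show ?thesis using t(3) by (simp add: mult_ac)
    qed
    have "((\<lambda>h. G (x + h) i j) \<longlongrightarrow> G x i j) (at 0)"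
    proof (rule LIM_zero_cancel)
      show "((\<lambda>h. G (x + h) i j - G x i j) \<longlongrightarrow> 0) (at 0)"
      proof (rule Lim_null_comparison)
        show "\<forall>\<^sub>F h in at 0. norm (G (x + h) i j - G x i j) \<le> K * C * norm h"
          using lip r(1) by (auto simp: eventually_at dist_norm intro!: exI[of _ r])
        show "((\<lambda>h. K * C * norm h) \<longlongrightarrow> 0) (at 0)"
          by (auto intro!: tendsto_eq_intros)
      qed
    qed
    then show "isCont (\<lambda>x. G x i j) x" by (simp add: isCont_iff)
  qed
  have "continuous_on S (\<lambda>x. G x \<xi> j)" if "j \<in> Basis" for j
    by (rule continuous_on_linear_family[where L = "\<lambda>x \<xi>. G x \<xi> j" and f = "\<lambda>_. \<xi>"])
      (use G_linear(1) basis that in auto)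
  then show ?thesis
    by (intro continuous_on_linear_family[where L = "\<lambda>x. G x \<xi>" and f = "\<lambda>_. \<eta>"])
      (use G_linear(2) in auto)
qed

section \<open>Differentiability and smoothness of the coefficients\<close>

lemma G'_expand:
  assumes "x \<in> S"
  shows "G' x h \<xi> \<eta> = (\<Sum>k\<in>Basis. (\<Gamma> x h \<xi> \<bullet> k) * G x k \<eta>) + (\<Sum>k\<in>Basis. (\<Gamma> x h \<eta> \<bullet> k) * G x \<xi> k)"
  unfolding G'_def using G_expand(1)[OF assms, of "\<Gamma> x h \<xi>" \<eta>] G_expand(2)[OF assms, of \<xi> "\<Gamma> x h \<eta>"] by simp

lemma G'_linear: "x \<in> S \<Longrightarrow> linear (\<lambda>h. G' x h \<xi> \<eta>)"
  unfolding G'_def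
  by (rule linearI)
    (simp_all add: linear_add[OF \<Gamma>_linear(1)] linear_cmul[OF \<Gamma>_linear(1)] linear_add[OF G_linear(1)] linear_add[OF G_linear(2)]
      linear_cmul[OF G_linear(1)] linear_cmul[OF G_linear(2)] algebra_simps)

lemma G_has_derivative:
  assumes "x \<in> S"
  shows "((\<lambda>x. G x \<xi> \<eta>) has_derivative (\<lambda>h. G' x h \<xi> \<eta>)) (at x)"
proof -
  have e: "(\<Sum>b\<in>Basis. (h \<bullet> b) * G' x b \<xi> \<eta>) = G' x h \<xi> \<eta>" if "x \<in> S" for x h
    using linear_Basis_expand[OF G'_linear[OF that], of h \<xi> \<eta>] by simp
  have "((\<lambda>x. G x \<xi> \<eta>) has_derivative (\<lambda>h. \<Sum>b\<in>Basis. (h \<bullet> b) * G' x b \<xi> \<eta>)) (at x)"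
  proof (rule has_derivative_of_directional[OF S assms])
    fix x h assume "x \<in> S"
    then show "((\<lambda>t. G (x + t *\<^sub>R h) \<xi> \<eta>) has_real_derivative (\<Sum>b\<in>Basis. (h \<bullet> b) * G' x b \<xi> \<eta>)) (at 0)"
      using G_line[of x 0 h \<xi> \<eta>] by (simp add: e)
  next
    fix b
    have "continuous_on S (\<lambda>x. (\<Sum>k\<in>Basis. (\<Gamma> x b \<xi> \<bullet> k) * G x k \<eta>) + (\<Sum>k\<in>Basis. (\<Gamma> x b \<eta> \<bullet> k) * G x \<xi> k))"
      by (intro continuous_intros G_continuous Cinf_on_continuous[OF \<Gamma>_smooth])
    then show "continuous_on S (\<lambda>x. G' x b \<xi> \<eta>)"
      by (rule continuous_on_eq) (simp add: G'_expand)
  qed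
  then show ?thesis by (simp add: e[OF assms])
qed

text \<open>The derivative is a sum of products of components of \<open>\<Gamma>\<close> with
  coefficients of \<open>G\<close> itself, so order \<open>k\<close> for \<open>G\<close> is order
  \<open>k\<close> for its derivative.\<close>

lemma G_smooth: "Cinf_on S (\<lambda>x. G x \<xi> \<eta>)"
proof -
  have "Ck_on k S (\<lambda>x. G x \<xi> \<eta>)" for k \<xi> \<eta>
  proof (induction k arbitrary: \<xi> \<eta>)
    case (Suc k)
    show ?case
    proof (rule Ck_on_SucI[OF S G_has_derivative])
      fix v
      have "Ck_on k S (\<lambda>x. (\<Sum>k\<in>Basis. (\<Gamma> x v \<xi> \<bullet> k) *\<^sub>R G x k \<eta>) + (\<Sum>k\<in>Basis. (\<Gamma> x v \<eta> \<bullet> k) *\<^sub>R G x \<xi> k))"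
        by (intro Ck_on_add Ck_on_sum Ck_on_scaleR S Suc.IH Ck_on_linear_compose[OF S bounded_linear_inner_left] Cinf_onD[OF \<Gamma>_smooth])
      then show "Ck_on k S (\<lambda>x. G' x v \<xi> \<eta>)"
        by (rule Ck_on_cong[OF S, rotated]) (simp add: G'_expand)
    qed
  qed (simp add: G_continuous)
  then show ?thesis by (simp add: Cinf_on_def)
qed

end

text \<open>Product rule for a map and an argument that both vary, from derivatives of the map at
  fixed arguments. Uniqueness of derivatives makes \<open>L'\<close> linear in the vector, so the
  basis expansion can be differentiated termwise and reassembled.\<close>

lemma has_derivative_linear_family:
  fixes L :: "'a::real_normed_vector \<Rightarrow> 'b::euclidean_space \<Rightarrow> 'c::real_normed_vector"
  assumes S: "open S" "x \<in> S" and lin: "\<And>y. y \<in> S \<Longrightarrow> linear (L y)"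
    and L': "\<And>\<eta>. ((\<lambda>y. L y \<eta>) has_derivative L' \<eta>) (at x)" and f: "(f has_derivative f') (at x)"
  shows "((\<lambda>y. L y (f y)) has_derivative (\<lambda>h. L' (f x) h + L x (f' h))) (at x)"
proof -
  have e: "L' \<eta> h = (\<Sum>b\<in>Basis. (\<eta> \<bullet> b) *\<^sub>R L' b h)" for \<eta> h
  proof -
    have "((\<lambda>y. \<Sum>b\<in>Basis. (\<eta> \<bullet> b) *\<^sub>R L y b) has_derivative (\<lambda>h. \<Sum>b\<in>Basis. (\<eta> \<bullet> b) *\<^sub>R L' b h)) (at x)"
      by (intro has_derivative_sum has_derivative_scaleR_right L')
    then have "((\<lambda>y. L y \<eta>) has_derivative (\<lambda>h. \<Sum>b\<in>Basis. (\<eta> \<bullet> b) *\<^sub>R L' b h)) (at x)"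
      by (rule has_derivative_transform_within_open[OF _ S]) (rule linear_Basis_expand[OF lin, symmetric])
    from has_derivative_unique[OF L' this] show ?thesis by (rule fun_cong)
  qed
  have "((\<lambda>y. \<Sum>b\<in>Basis. (f y \<bullet> b) *\<^sub>R L y b) has_derivative
      (\<lambda>h. \<Sum>b\<in>Basis. (f x \<bullet> b) *\<^sub>R L' b h + (f' h \<bullet> b) *\<^sub>R L x b)) (at x)"
    by (intro has_derivative_sum has_derivative_scaleR has_derivative_inner_left f L')
  then have "((\<lambda>y. \<Sum>b\<in>Basis. (f y \<bullet> b) *\<^sub>R L y b) has_derivative (\<lambda>h. L' (f x) h + L x (f' h))) (at x)"
    by (rule has_derivative_eq_rhs)
      (simp add: fun_eq_iff sum.distrib e[of "f x"] linear_Basis_expand[OF lin[OF S(2)], symmetric])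
  then show ?thesis
    by (rule has_derivative_transform_within_open[OF _ S]) (rule linear_Basis_expand[OF lin, symmetric])
qed

lemma (in parallel_form) G_has_derivative_compose:
  assumes x: "x \<in> S" and X: "(X has_derivative X') (at x)" and Y: "(Y has_derivative Y') (at x)"
  shows "((\<lambda>y. G y (X y) (Y y)) has_derivative
    (\<lambda>h. (G' x h (X x) (Y x) + G x (X' h) (Y x)) + G x (X x) (Y' h))) (at x)"
proof (rule has_derivative_linear_family[where L = "\<lambda>y. G y (X y)" and L' = "\<lambda>\<eta> h. G' x h (X x) \<eta> + G x (X' h) \<eta>", OF S x])
  show "linear (G y (X y))" if "y \<in> S" for y by (rule G_linear(2)[OF that])
  fix \<eta>
  show "((\<lambda>y. G y (X y) \<eta>) has_derivative (\<lambda>h. G' x h (X x) \<eta> + G x (X' h) \<eta>)) (at x)"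
    by (rule has_derivative_linear_family[where L = "\<lambda>y \<xi>. G y \<xi> \<eta>" and L' = "\<lambda>\<xi> h. G' x h \<xi> \<eta>", OF S x G_linear(1) G_has_derivative[OF x] X])
qed (rule Y)

section \<open>The connection is the Levi-Civita connection of the parallel metric\<close>

context parallel_metric
begin

definition gc :: "('m, 'n) chart \<Rightarrow> real^'n \<Rightarrow> real^'n \<Rightarrow> real^'n \<Rightarrow> real" where
  "gc c x \<xi> \<eta> = G (cinv c x) (coord_vec A c (cinv c x) \<xi>) (coord_vec A c (cinv c x) \<eta>)"

lemma gc_eq:
  assumes "c \<in> A" "p \<in> cdom c" "v \<in> tangent_space A p" "w \<in> tangent_space A p"
  shows "gc c (cmap c p) (v c) (w c) = G p v w"
  using assms by (simp add: gc_def coord_vec_of_tangent)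

lemma gc_sym:
  assumes "c \<in> A" "x \<in> cmap c ` cdom c" shows "gc c x \<xi> \<eta> = gc c x \<eta> \<xi>"
  unfolding gc_def using assms by (intro G_sym coord_vec_tangent) auto

lemma gc_linear:
  assumes "c \<in> A" "x \<in> cmap c ` cdom c"
  shows "linear (\<lambda>\<xi>. gc c x \<xi> \<eta>)" "linear (gc c x \<xi>)"
proof -
  have p: "cinv c x \<in> cdom c" using assms by auto
  note cv = coord_vec_tangent[OF assms(1) p]
  show l: "linear (\<lambda>\<xi>. gc c x \<xi> \<eta>)" for \<eta>
    unfolding gc_def by (rule linearI) (simp_all add: coord_vec_linear[OF assms(1) p] G_add[OF cv cv cv] G_scale[OF cv cv])
  have "gc c x \<xi> = (\<lambda>\<eta>. gc c x \<eta> \<xi>)" using gc_sym[OF assms] by (intro ext)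
  then show "linear (gc c x \<xi>)" using l[of \<xi>] by simp
qed

text \<open>The fields \<open>U j\<close> solve the transposed equation, so \<open>U j \<bullet> V\<close> is constant for every parallel \<open>V\<close>.
  Thus \<open>\<Psi> t\<close> is the backward parallel translation, and it is differentiable in \<open>t\<close>.\<close>

lemma gc_line:
  assumes c: "c \<in> A" and x: "x \<in> cmap c ` cdom c"
  shows "((\<lambda>t. gc c (x + t *\<^sub>R h) \<xi> \<eta>) has_real_derivative
    (gc c x (christoffel c x h \<xi>) \<eta> + gc c x \<xi> (christoffel c x h \<eta>))) (at 0)"
proof -
  let ?S = "cmap c ` cdom c"
  obtain r where r: "r > 0" "ball x r \<subseteq> ?S"
    using chart_image_open'[OF c] x open_contains_ball by blast
  define e where "e = r / (norm h + 1)"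
  have e: "e > 0" unfolding e_def using r(1) by (intro divide_pos_pos) (auto intro: add_nonneg_pos)
  have seg: "x + t *\<^sub>R h \<in> ?S" if "t \<in> {-e..e}" for t
  proof -
    have "\<bar>t\<bar> * norm h \<le> e * norm h" using that by (intro mult_right_mono) auto
    also have "\<dots> < e * (norm h + 1)" using e by simp
    also have "\<dots> = r" using norm_ge_zero[of h] by (simp add: e_def add_nonneg_eq_0_iff)
    finally show ?thesis using r(2) by (auto simp: dist_norm)
  qed
  let ?\<gamma> = "\<lambda>t. cinv c (x + t *\<^sub>R h)"
  let ?B = "\<lambda>t. christoffel c (x + t *\<^sub>R h) h"
  have Blin: "linear (?B t)" if "t \<in> {-e..e}" for t by (rule christoffel_linear(2)[OF c seg[OF that]])
  \<comment> \<open>The adjoint of \<open>?B t\<close> for the standard inner product, as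
    \<open>L_inner\<close> records.\<close>
  define L where "L = (\<lambda>t y. \<Sum>b\<in>Basis. (?B t b \<bullet> y) *\<^sub>R b)"
  have L_inner: "L t y \<bullet> z = ?B t z \<bullet> y" if "t \<in> {-e..e}" for t y z
  proof -
    have "?B t z \<bullet> y = (\<Sum>b\<in>Basis. (z \<bullet> b) *\<^sub>R ?B t b) \<bullet> y"
      by (rule arg_cong[OF linear_Basis_expand[OF Blin[OF that]]])
    then show ?thesis by (simp add: L_def inner_sum_left inner_sum_right inner_commute mult.commute)
  qed
  have "\<exists>f. f (-e) = j \<and> (\<forall>t\<in>{-e..e}. (f has_vector_derivative L t (f t)) (at t within {-e..e}))" for j
  proof (rule linear_ode_exists[of "-e" e L j])
    show "linear (L t)" for t
      unfolding L_def by (rule linearI) (simp_all add: inner_add_right scaleR_add_left sum.distrib scaleR_sum_right)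
    have "continuous_on {-e..e} (\<lambda>t. ?B t b)" for b
      by (rule continuous_on_compose2[OF Cinf_on_continuous[OF christoffel_smooth[OF c]]])
        (use seg in \<open>auto intro!: continuous_intros\<close>)
    then show "continuous_on {-e..e} (\<lambda>t. L t i)" for i
      unfolding L_def by (intro continuous_intros)
  qed (use e in auto)
  then obtain U where U: "\<And>j. U j (-e) = j"
      "\<And>j t. t \<in> {-e..e} \<Longrightarrow> (U j has_vector_derivative L t (U j t)) (at t within {-e..e})" by metis
  define \<Psi> where "\<Psi> = (\<lambda>t \<xi>. \<Sum>j\<in>Basis. (U j t \<bullet> \<xi>) *\<^sub>R j)"
  let ?x = "x + (- e) *\<^sub>R h"
  \<comment> \<open>Based at the end point \<open>-e\<close> instead of 0: all translations run
    forwards over \<open>{-e..t}\<close>, for \<open>t\<close> on either side of 0, which makes the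
    two-sided derivative at 0 accessible.\<close>
  have pull: "gc c (x + t *\<^sub>R h) \<xi> \<eta> = gc c ?x (\<Psi> t \<xi>) (\<Psi> t \<eta>)" if t: "- e < t" "t \<le> e" for t \<xi> \<eta>
  proof -
    have sub: "{-e..t} \<subseteq> {-e..e}" using t by auto
    note C = C1_chart_segment[OF c t(1), of x h]
    have C1: "C1_curve A ?\<gamma> (-e) t" and vel: "\<And>s. s \<in> {-e..t} \<Longrightarrow> velocity A ?\<gamma> (-e) t s c = h"
      using C seg sub by blast+
    have dom: "?\<gamma> s \<in> cdom c" "cmap c (?\<gamma> s) = x + s *\<^sub>R h" if "s \<in> {-e..t}" for s
      using seg[of s] sub that c by auto
    obtain T where T: "joined (?\<gamma> (-e)) (?\<gamma> t) T"
      "\<And>V. pieces (parallel_segment ?\<gamma> V) (-e) t \<Longrightarrow> V (-e) \<in> tangent_space A (?\<gamma> (-e)) \<Longrightarrow> T (V (-e)) = V t"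
      by (rule pieces_parallel_joined[OF t(1) pieces_single[where Q = "C1_curve A ?\<gamma>", OF t(1) C1]])
        (rule that, assumption, blast)
    have "\<exists>v\<in>tangent_space A (?\<gamma> (-e)). T v = coord_vec A c (?\<gamma> t) \<zeta> \<and> v c = \<Psi> t \<zeta>" for \<zeta>
    proof -
      have ct: "coord_vec A c (?\<gamma> t) \<zeta> \<in> tangent_space A (?\<gamma> t)" by (rule coord_vec_tangent[OF c dom(1)]) (use t in auto)
      obtain v where v: "v \<in> tangent_space A (?\<gamma> (-e))" "T v = coord_vec A c (?\<gamma> t) \<zeta>"
        by (rule joined_surj[OF T(1) ct])
      have im: "?\<gamma> ` {-e..t} \<subseteq> cdom c" using dom by auto
      obtain V where V: "parallel_segment ?\<gamma> V (-e) t" "V (-e) = v"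
        by (rule parallel_in_chart_exists[OF t(1) C1 im c v(1)])
      have Vt: "V t = coord_vec A c (?\<gamma> t) \<zeta>"
        using T(2)[OF pieces_single[where Q = "parallel_segment ?\<gamma> V", OF t(1) V(1)]] V(2) v by simp
      have dV: "((\<lambda>s. V s c) has_vector_derivative - ?B s (V s c)) (at s within {-e..t})" if "s \<in> {-e..t}" for s
        using parallel_onD(2)[OF t(1) C1 _ that c dom(1)[OF that], of V] V(1)
        unfolding parallel_segment_def vel[OF that] dom(2)[OF that] by simp
      have const: "U j t \<bullet> V t c = U j (-e) \<bullet> V (-e) c" for j
      proof -
        define k where "k = (\<lambda>s. U j s \<bullet> V s c - U j (-e) \<bullet> V (-e) c)"
        have "norm (k t) \<le> exp (0 * \<bar>t - (-e)\<bar>) * norm (k (-e))"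
        proof (rule gronwall_linear[where a = "-e" and b = t])
          fix s assume s: "s \<in> {-e..t}"
          have "(k has_vector_derivative (U j s \<bullet> - ?B s (V s c) + L s (U j s) \<bullet> V s c) - 0) (at s within {-e..t})"
            unfolding k_def
            by (intro has_vector_derivative_diff has_vector_derivative_const
                bounded_bilinear.has_vector_derivative[OF bounded_bilinear_inner]
                has_vector_derivative_within_subset[OF U(2) sub] dV s) (use s sub in auto)
          moreover have "(U j s \<bullet> - ?B s (V s c) + L s (U j s) \<bullet> V s c) - 0 = 0"
            using s sub by (subst L_inner) (auto simp: inner_commute)
          ultimately show "(k has_vector_derivative 0) (at s within {-e..t})" by simp
        qed (use t in auto)
        then show ?thesis by (simp add: k_def)
      qed
      have td: "?\<gamma> t \<in> cdom c" by (rule dom(1)) (use t in auto)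
      \<comment> \<open>At \<open>-e\<close> the fields \<open>U j\<close> are the basis vectors, so
        the conserved pairings are the components of \<open>v\<close>.\<close>
      have "v c = (\<Sum>j\<in>Basis. (U j (-e) \<bullet> V (-e) c) *\<^sub>R j)"
        by (simp add: U(1) V(2) inner_commute[of _ "v c"] euclidean_representation)
      also have "\<dots> = \<Psi> t \<zeta>" unfolding const[symmetric] \<Psi>_def Vt using c td by simp
      finally show ?thesis using v by blast
    qed
    then obtain w where w: "\<And>\<zeta>. w \<zeta> \<in> tangent_space A (?\<gamma> (-e))"
        "\<And>\<zeta>. T (w \<zeta>) = coord_vec A c (?\<gamma> t) \<zeta>" "\<And>\<zeta>. w \<zeta> c = \<Psi> t \<zeta>"
      by metis
    have "gc c (x + t *\<^sub>R h) \<xi> \<eta> = G (?\<gamma> t) (T (w \<xi>)) (T (w \<eta>))" by (simp add: gc_def w(2))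
    also have "\<dots> = G (?\<gamma> (-e)) (w \<xi>) (w \<eta>)" by (rule G_joined[OF T(1) w(1) w(1)])
    also have "\<dots> = gc c (cmap c (?\<gamma> (-e))) (w \<xi> c) (w \<eta> c)"
      by (rule gc_eq[OF c dom(1) w(1) w(1), symmetric]) (use t in auto)
    also have "cmap c (?\<gamma> (-e)) = ?x" by (rule dom(2)) (use t in auto)
    finally show ?thesis by (simp add: w(3))
  qed
  have d\<Psi>: "((\<lambda>t. \<Psi> t \<zeta>) has_vector_derivative \<Psi> 0 (?B 0 \<zeta>)) (at 0)" for \<zeta>
  proof -
    have at0: "at (0::real) within {-e..e} = at 0" by (rule at_within_Icc_at) (use e in auto)
    have 0: "0 \<in> {-e..e}" using e by auto
    have "((\<lambda>t. \<Psi> t \<zeta>) has_vector_derivative (\<Sum>j\<in>Basis. (L 0 (U j 0) \<bullet> \<zeta>) *\<^sub>R j)) (at 0)"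
      unfolding \<Psi>_def
      by (intro has_vector_derivative_sum bounded_linear.has_vector_derivative[OF bounded_linear_compose[OF bounded_linear_scaleR_left bounded_linear_inner_left]]
          U(2)[OF 0, unfolded at0])
    then show ?thesis unfolding L_inner[OF 0] by (simp add: \<Psi>_def inner_commute)
  qed
  have xS: "?x \<in> ?S" using seg[of "-e"] e by simp
  have bil: "bounded_bilinear (gc c ?x)"
    unfolding bilinear_conv_bounded_bilinear[symmetric] bilinear_def using gc_linear[OF c xS] by blast
  have "((\<lambda>t. gc c ?x (\<Psi> t \<xi>) (\<Psi> t \<eta>)) has_vector_derivative
      (gc c ?x (\<Psi> 0 \<xi>) (\<Psi> 0 (?B 0 \<eta>)) + gc c ?x (\<Psi> 0 (?B 0 \<xi>)) (\<Psi> 0 \<eta>))) (at 0)"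
    by (rule bounded_bilinear.has_vector_derivative[OF bil d\<Psi> d\<Psi>])
  then have "((\<lambda>t. gc c (x + t *\<^sub>R h) \<xi> \<eta>) has_vector_derivative
      (gc c ?x (\<Psi> 0 \<xi>) (\<Psi> 0 (?B 0 \<eta>)) + gc c ?x (\<Psi> 0 (?B 0 \<xi>)) (\<Psi> 0 \<eta>))) (at 0)"
    by (rule has_vector_derivative_transform_within_open[where S = "{-e<..<e}"]) (use e pull in auto)
  \<comment> \<open>\<open>pull\<close> at time 0 converts the fixed form at \<open>?x\<close> back
    into the form at \<open>x\<close>.\<close>
  moreover have "gc c ?x (\<Psi> 0 u) (\<Psi> 0 v) = gc c x u v" for u v using pull[of 0 u v] e by simp
  ultimately show ?thesis
    by (simp add: has_real_derivative_iff_has_vector_derivative add.commute)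
qed

lemma gc_parallel_form: "c \<in> A \<Longrightarrow> parallel_form (cmap c ` cdom c) (christoffel c) (gc c)"
  by (rule parallel_form.intro; (rule chart_image_open' christoffel_linear christoffel_smooth gc_linear gc_line; assumption))

lemma riemannian_metric: "riemannian_metric A G"
  unfolding riemannian_metric_def
proof (intro conjI allI ballI impI)
  fix U and X Y :: "('m, 'n) vfield"
  assume "open U \<and> smooth_vfield A U X \<and> smooth_vfield A U Y"
  then have U: "open U" and X: "smooth_vfield A U X" and Y: "smooth_vfield A U Y" by auto
  show "smooth_fun A U (\<lambda>p. G p (X p) (Y p))"
    unfolding smooth_fun_def
  proof
    fix c assume c: "c \<in> A"
    interpret pf: parallel_form "cmap c ` cdom c" "christoffel c" "gc c" by (rule gc_parallel_form[OF c])
    let ?S = "cmap c ` (U \<inter> cdom c)"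
    have S: "open ?S" by (rule chart_image_open[OF c U])
    have "Cinf_on ?S (\<lambda>x. \<Sum>i\<in>Basis. (X (cinv c x) c \<bullet> i) *\<^sub>R (\<Sum>j\<in>Basis. (Y (cinv c x) c \<bullet> j) *\<^sub>R gc c x i j))"
      by (intro Cinf_on_sum Cinf_on_scaleR S Cinf_on_linear_compose[OF S bounded_linear_inner_left]
          smooth_vfieldD(2)[OF X c] smooth_vfieldD(2)[OF Y c] Cinf_on_subset[OF pf.G_smooth]) auto
    then show "Cinf_on ?S (\<lambda>x. G (cinv c x) (X (cinv c x)) (Y (cinv c x)))"
    proof (rule Cinf_on_cong[OF S, rotated])
      fix x assume "x \<in> ?S"
      then obtain p where p: "p \<in> U" "p \<in> cdom c" "x = cmap c p" by auto
      then have xS: "x \<in> cmap c ` cdom c" by auto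
      have "G p (X p) (Y p) = gc c x (X p c) (Y p c)"
        using gc_eq[OF c p(2) smooth_vfieldD(1)[OF X p(1)] smooth_vfieldD(1)[OF Y p(1)]] p by simp
      also have "\<dots> = (\<Sum>i\<in>Basis. (X p c \<bullet> i) * gc c x i (Y p c))" by (rule pf.G_expand(1)[OF xS])
      also have "\<dots> = (\<Sum>i\<in>Basis. (X p c \<bullet> i) *\<^sub>R (\<Sum>j\<in>Basis. (Y p c \<bullet> j) *\<^sub>R gc c x i j))"
        unfolding real_scaleR_def
        by (intro sum.cong refl arg_cong2[where f = "(*)"] pf.G_expand(2)[OF xS])
      finally show "(\<Sum>i\<in>Basis. (X (cinv c x) c \<bullet> i) *\<^sub>R (\<Sum>j\<in>Basis. (Y (cinv c x) c \<bullet> j) *\<^sub>R gc c x i j)) =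
          G (cinv c x) (X (cinv c x)) (Y (cinv c x))"
        using p c by simp
    qed
  qed
qed (auto intro: G_add G_scale G_sym G_pos)

text \<open>The derivative \<open>pf.G'\<close> of the coefficients is precisely the Christoffel
  part of the two covariant derivatives; the other product rule terms are their derivative
  parts.\<close>

lemma metric_compatible: "metric_compatible A G D"
  unfolding metric_compatible_def
proof (intro allI ballI impI)
  fix U p v and X Y :: "('m, 'n) vfield"
  assume H: "open U \<and> smooth_vfield A U X \<and> smooth_vfield A U Y" and p: "p \<in> U" and v: "v \<in> tangent_space A p"
  then have U: "open U" and X: "smooth_vfield A U X" and Y: "smooth_vfield A U Y" by auto
  let ?c = "chart_at A p"
  note c = chart_at[of p]
  interpret pf: parallel_form "cmap ?c ` cdom ?c" "christoffel ?c" "gc ?c" by (rule gc_parallel_form[OF c(1)])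
  let ?x = "cmap ?c p"
  let ?X = "\<lambda>x. X (cinv ?c x) ?c" and ?Y = "\<lambda>x. Y (cinv ?c x) ?c"
  have x: "?x \<in> cmap ?c ` cdom ?c" "?x \<in> cmap ?c ` (U \<inter> cdom ?c)" using c p by auto
  obtain X' where X': "(?X has_derivative X') (at ?x)"
    using Cinf_on_has_derivative[OF smooth_vfieldD(2)[OF X c(1)] x(2)] by blast
  obtain Y' where Y': "(?Y has_derivative Y') (at ?x)"
    using Cinf_on_has_derivative[OF smooth_vfieldD(2)[OF Y c(1)] x(2)] by blast
  have "((\<lambda>y. G (cinv ?c y) (X (cinv ?c y)) (Y (cinv ?c y))) has_derivative
      (\<lambda>h. (pf.G' ?x h (?X ?x) (?Y ?x) + gc ?c ?x (X' h) (?Y ?x)) + gc ?c ?x (?X ?x) (Y' h))) (at ?x)"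
  proof (rule has_derivative_transform_within_open[OF pf.G_has_derivative_compose[OF x(1) X' Y'] chart_image_open[OF c(1) U] x(2)])
    fix y assume "y \<in> cmap ?c ` (U \<inter> cdom ?c)"
    then obtain q where q: "q \<in> U" "q \<in> cdom ?c" "y = cmap ?c q" by auto
    then show "gc ?c y (X (cinv ?c y) ?c) (Y (cinv ?c y) ?c) = G (cinv ?c y) (X (cinv ?c y)) (Y (cinv ?c y))"
      using gc_eq[OF c(1) q(2) smooth_vfieldD(1)[OF X q(1)] smooth_vfieldD(1)[OF Y q(1)]] c(1) by simp
  qed
  from dir_deriv_eq[OF c v, of "\<lambda>q. G q (X q) (Y q)", OF this]
  have "dir_deriv A p v (\<lambda>q. G q (X q) (Y q)) =
      pf.G' ?x (v ?c) (X p ?c) (Y p ?c) + gc ?c ?x (X' (v ?c)) (Y p ?c) + gc ?c ?x (X p ?c) (Y' (v ?c))"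
    using c by simp
  moreover have "G p (D p v X) (Y p) = gc ?c ?x (X' (v ?c) + christoffel ?c ?x (v ?c) (X p ?c)) (Y p ?c)"
    unfolding gc_eq[OF c D_tangent[OF U X p v] smooth_vfieldD(1)[OF Y p], symmetric]
      D_in_chart[OF U X p c v X'] ..
  moreover have "G p (X p) (D p v Y) = gc ?c ?x (X p ?c) (Y' (v ?c) + christoffel ?c ?x (v ?c) (Y p ?c))"
    unfolding gc_eq[OF c smooth_vfieldD(1)[OF X p] D_tangent[OF U Y p v], symmetric]
      D_in_chart[OF U Y p c v Y'] ..
  ultimately show "dir_deriv A p v (\<lambda>q. G q (X q) (Y q)) = G p (D p v X) (Y p) + G p (X p) (D p v Y)"
    by (simp add: linear_add[OF pf.G_linear(1)[OF x(1)]] linear_add[OF pf.G_linear(2)[OF x(1)]] pf.G'_def)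
qed

end

section \<open>Curvature of a parallel form\<close>

context parallel_form
begin

text \<open>The first vector is the direction of differentiation.\<close>

definition d\<Gamma> :: "'a \<Rightarrow> 'a \<Rightarrow> 'a \<Rightarrow> 'a \<Rightarrow> 'a" where
  "d\<Gamma> x \<xi> \<eta> \<zeta> = frechet_derivative (\<lambda>y. \<Gamma> y \<eta> \<zeta>) (at x) \<xi>"

text \<open>The curvature tensor in coordinates, evaluated on fields with constant components, whose
  bracket vanishes.\<close>

definition R :: "'a \<Rightarrow> 'a \<Rightarrow> 'a \<Rightarrow> 'a \<Rightarrow> 'a" where
  "R x \<xi> \<eta> \<zeta> = d\<Gamma> x \<xi> \<eta> \<zeta> - d\<Gamma> x \<eta> \<xi> \<zeta> + \<Gamma> x \<xi> (\<Gamma> x \<eta> \<zeta>) - \<Gamma> x \<eta> (\<Gamma> x \<xi> \<zeta>)"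

lemma \<Gamma>_has_derivative: "x \<in> S \<Longrightarrow> ((\<lambda>y. \<Gamma> y \<eta> \<zeta>) has_derivative (\<lambda>\<xi>. d\<Gamma> x \<xi> \<eta> \<zeta>)) (at x)"
  unfolding d\<Gamma>_def by (rule Cinf_on_has_derivative[OF \<Gamma>_smooth])

lemma d\<Gamma>_linear:
  assumes "x \<in> S"
  shows "linear (\<lambda>\<xi>. d\<Gamma> x \<xi> \<eta> \<zeta>)" "linear (\<lambda>\<eta>. d\<Gamma> x \<xi> \<eta> \<zeta>)" "linear (d\<Gamma> x \<xi> \<eta>)"
proof -
  show "linear (\<lambda>\<xi>. d\<Gamma> x \<xi> \<eta> \<zeta>)" by (rule has_derivative_linear[OF \<Gamma>_has_derivative[OF assms]])
  have eq: "F = F'" if "((\<lambda>y. f y) has_derivative F) (at x)" "((\<lambda>y. f' y) has_derivative F') (at x)"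
    "\<And>y. y \<in> S \<Longrightarrow> f y = f' y" for f f' :: "'a \<Rightarrow> 'a" and F F'
    by (rule has_derivative_unique[OF has_derivative_transform_within_open[OF that(1) S assms that(3)] that(2)])
  show "linear (\<lambda>\<eta>. d\<Gamma> x \<xi> \<eta> \<zeta>)"
  proof (rule linearI)
    fix \<eta> \<eta>' r
    have "(\<lambda>\<xi>. d\<Gamma> x \<xi> (\<eta> + \<eta>') \<zeta>) = (\<lambda>\<xi>. d\<Gamma> x \<xi> \<eta> \<zeta> + d\<Gamma> x \<xi> \<eta>' \<zeta>)"
      by (rule eq[OF \<Gamma>_has_derivative[OF assms] has_derivative_add[OF \<Gamma>_has_derivative[OF assms] \<Gamma>_has_derivative[OF assms]]])
        (rule linear_add[OF \<Gamma>_linear(1)])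
    then show "d\<Gamma> x \<xi> (\<eta> + \<eta>') \<zeta> = d\<Gamma> x \<xi> \<eta> \<zeta> + d\<Gamma> x \<xi> \<eta>' \<zeta>" by (rule fun_cong)
    have "(\<lambda>\<xi>. d\<Gamma> x \<xi> (r *\<^sub>R \<eta>) \<zeta>) = (\<lambda>\<xi>. r *\<^sub>R d\<Gamma> x \<xi> \<eta> \<zeta>)"
      by (rule eq[OF \<Gamma>_has_derivative[OF assms] has_derivative_scaleR_right[OF \<Gamma>_has_derivative[OF assms]]])
        (rule linear_cmul[OF \<Gamma>_linear(1)])
    then show "d\<Gamma> x \<xi> (r *\<^sub>R \<eta>) \<zeta> = r *\<^sub>R d\<Gamma> x \<xi> \<eta> \<zeta>" by (rule fun_cong)
  qed
  show "linear (d\<Gamma> x \<xi> \<eta>)"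
  proof (rule linearI)
    fix \<zeta> \<zeta>' r
    have "(\<lambda>\<xi>. d\<Gamma> x \<xi> \<eta> (\<zeta> + \<zeta>')) = (\<lambda>\<xi>. d\<Gamma> x \<xi> \<eta> \<zeta> + d\<Gamma> x \<xi> \<eta> \<zeta>')"
      by (rule eq[OF \<Gamma>_has_derivative[OF assms] has_derivative_add[OF \<Gamma>_has_derivative[OF assms] \<Gamma>_has_derivative[OF assms]]])
        (rule linear_add[OF \<Gamma>_linear(2)])
    then show "d\<Gamma> x \<xi> \<eta> (\<zeta> + \<zeta>') = d\<Gamma> x \<xi> \<eta> \<zeta> + d\<Gamma> x \<xi> \<eta> \<zeta>'" by (rule fun_cong)
    have "(\<lambda>\<xi>. d\<Gamma> x \<xi> \<eta> (r *\<^sub>R \<zeta>)) = (\<lambda>\<xi>. r *\<^sub>R d\<Gamma> x \<xi> \<eta> \<zeta>)"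
      by (rule eq[OF \<Gamma>_has_derivative[OF assms] has_derivative_scaleR_right[OF \<Gamma>_has_derivative[OF assms]]])
        (rule linear_cmul[OF \<Gamma>_linear(2)])
    then show "d\<Gamma> x \<xi> \<eta> (r *\<^sub>R \<zeta>) = r *\<^sub>R d\<Gamma> x \<xi> \<eta> \<zeta>" by (rule fun_cong)
  qed
qed

section \<open>Algebraic symmetries of the curvature tensor\<close>

lemma R_antisym: "R x \<xi> \<eta> \<zeta> = - R x \<eta> \<xi> \<zeta>"
  by (simp add: R_def)

lemma R_linear:
  assumes "x \<in> S"
  shows "linear (\<lambda>\<xi>. R x \<xi> \<eta> \<zeta>)" "linear (\<lambda>\<eta>. R x \<xi> \<eta> \<zeta>)" "linear (R x \<xi> \<eta>)"
proof -
  note l = d\<Gamma>_linear[OF assms] \<Gamma>_linear[OF assms]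
  show l1: "linear (\<lambda>\<xi>. R x \<xi> \<eta> \<zeta>)" for \<eta> \<zeta>
    unfolding R_def
    by (rule linearI)
      (simp_all add: linear_add[OF l(1)] linear_add[OF l(2)] linear_add[OF l(4)] linear_add[OF l(5)]
        linear_cmul[OF l(1)] linear_cmul[OF l(2)] linear_cmul[OF l(4)] linear_cmul[OF l(5)] algebra_simps)
  show "linear (\<lambda>\<eta>. R x \<xi> \<eta> \<zeta>)"
    unfolding R_antisym[of x \<xi>] by (rule linear_compose_neg[OF l1])
  show "linear (R x \<xi> \<eta>)"
    unfolding R_def[abs_def]
    by (rule linearI)
      (simp_all add: linear_add[OF l(3)] linear_add[OF l(5)] linear_cmul[OF l(3)] linear_cmul[OF l(5)] algebra_simps)
qed

text \<open>Mixed second derivatives of the coefficient \<open>G y \<zeta> \<omega>\<close> commute.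
  In their difference the terms with one \<open>\<Gamma>\<close> on each argument are symmetric in
  \<open>\<xi>\<close> and \<open>\<eta>\<close> and cancel; what remains is the claim.\<close>

lemma R_skew:
  assumes x: "x \<in> S"
  shows "G x (R x \<xi> \<eta> \<zeta>) \<omega> + G x \<zeta> (R x \<xi> \<eta> \<omega>) = 0"
proof -
  let ?f = "\<lambda>y. G y \<zeta> \<omega>"
  note gl = G_linear[OF x]
  have second: "frechet_derivative (\<lambda>y. frechet_derivative ?f (at y) \<eta>) (at x) \<xi> =
      G' x \<xi> (\<Gamma> x \<eta> \<zeta>) \<omega> + G x (d\<Gamma> x \<xi> \<eta> \<zeta>) \<omega> + (G' x \<xi> \<zeta> (\<Gamma> x \<eta> \<omega>) + G x \<zeta> (d\<Gamma> x \<xi> \<eta> \<omega>))" for \<xi> \<eta>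
  proof -
    have "((\<lambda>y. G y (\<Gamma> y \<eta> \<zeta>) \<omega> + G y \<zeta> (\<Gamma> y \<eta> \<omega>)) has_derivative
        (\<lambda>\<xi>. ((G' x \<xi> (\<Gamma> x \<eta> \<zeta>) \<omega> + G x (d\<Gamma> x \<xi> \<eta> \<zeta>) \<omega>) + G x (\<Gamma> x \<eta> \<zeta>) 0) +
          ((G' x \<xi> \<zeta> (\<Gamma> x \<eta> \<omega>) + G x 0 (\<Gamma> x \<eta> \<omega>)) + G x \<zeta> (d\<Gamma> x \<xi> \<eta> \<omega>)))) (at x)"
      by (intro has_derivative_add G_has_derivative_compose[OF x] \<Gamma>_has_derivative[OF x] has_derivative_const)
    then have "((\<lambda>y. frechet_derivative ?f (at y) \<eta>) has_derivative
        (\<lambda>\<xi>. ((G' x \<xi> (\<Gamma> x \<eta> \<zeta>) \<omega> + G x (d\<Gamma> x \<xi> \<eta> \<zeta>) \<omega>) + G x (\<Gamma> x \<eta> \<zeta>) 0) +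
          ((G' x \<xi> \<zeta> (\<Gamma> x \<eta> \<omega>) + G x 0 (\<Gamma> x \<eta> \<omega>)) + G x \<zeta> (d\<Gamma> x \<xi> \<eta> \<omega>)))) (at x)"
      by (rule has_derivative_transform_within_open[OF _ S x])
        (simp add: frechet_derivative_eq[OF G_has_derivative] G'_def)
    from frechet_derivative_eq[OF this] show ?thesis
      by (simp add: linear_0[OF gl(1)] linear_0[OF gl(2)])
  qed
  have "frechet_derivative (\<lambda>y. frechet_derivative ?f (at y) \<eta>) (at x) \<xi> =
      frechet_derivative (\<lambda>y. frechet_derivative ?f (at y) \<xi>) (at x) \<eta>"
    by (rule second_derivative_symmetric[OF S x G_smooth])
  then show ?thesis
    unfolding second G'_def R_def
    by (simp add: linear_add[OF gl(1)] linear_add[OF gl(2)] linear_diff[OF gl(1)] linear_diff[OF gl(2)])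
qed

lemma R_bianchi:
  assumes x: "x \<in> S" and sym: "\<And>y \<xi> \<eta>. y \<in> S \<Longrightarrow> \<Gamma> y \<xi> \<eta> = \<Gamma> y \<eta> \<xi>"
  shows "R x \<xi> \<eta> \<zeta> + R x \<eta> \<zeta> \<xi> + R x \<zeta> \<xi> \<eta> = 0"
proof -
  have d: "d\<Gamma> x \<xi> \<eta> \<zeta> = d\<Gamma> x \<xi> \<zeta> \<eta>" for \<xi> \<eta> \<zeta>
  proof -
    have "((\<lambda>y. \<Gamma> y \<zeta> \<eta>) has_derivative (\<lambda>\<xi>. d\<Gamma> x \<xi> \<eta> \<zeta>)) (at x)"
      by (rule has_derivative_transform_within_open[OF \<Gamma>_has_derivative[OF x] S x sym])
    from has_derivative_unique[OF this \<Gamma>_has_derivative[OF x]] show ?thesis by (rule fun_cong)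
  qed
  show ?thesis
    unfolding R_def d[of \<xi> \<zeta> \<eta>] d[of \<eta> \<zeta> \<xi>] d[of \<zeta> \<eta> \<xi>] sym[OF x, of \<zeta> \<eta>] sym[OF x, of \<zeta> \<xi>] sym[OF x, of \<eta> \<xi>]
    by simp
qed

text \<open>A case of pair symmetry, from skewness in each pair and the first Bianchi identity. It
  makes the operator sending \<open>\<xi>\<close> to \<open>R x \<xi> \<eta> \<eta>\<close>
  self-adjoint.\<close>

lemma R_pair_symmetric:
  assumes x: "x \<in> S" and sym: "\<And>y \<xi> \<eta>. y \<in> S \<Longrightarrow> \<Gamma> y \<xi> \<eta> = \<Gamma> y \<eta> \<xi>"
    and Gsym: "\<And>\<xi> \<eta>. G x \<xi> \<eta> = G x \<eta> \<xi>"
  shows "G x (R x \<xi> \<eta> \<eta>) \<zeta> = G x (R x \<zeta> \<eta> \<eta>) \<xi>"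
proof -
  define Q where "Q a b c d = G x (R x a b c) d" for a b c d
  note gl = G_linear[OF x]
  have Q1: "Q a b c d = - Q b a c d" for a b c d
    unfolding Q_def by (subst R_antisym) (rule linear_neg[OF gl(1)])
  have Q2: "Q a b c d = - Q a b d c" for a b c d
    using R_skew[OF x, of a b c d] Gsym[of c] by (simp add: Q_def)
  have Q3: "Q a b c d + Q b c a d + Q c a b d = 0" for a b c d
    using arg_cong[OF R_bianchi[OF x sym, of a b c], of "\<lambda>v. G x v d"]
    by (simp add: Q_def linear_add[OF gl(1)] linear_0[OF gl(1)])
  have "Q \<xi> \<eta> \<eta> \<zeta> = Q \<zeta> \<eta> \<eta> \<xi>"
    using Q3[of \<xi> \<eta> \<eta> \<zeta>] Q3[of \<zeta> \<eta> \<eta> \<xi>] Q3[of \<xi> \<eta> \<zeta> \<eta>] Q3[of \<eta> \<zeta> \<xi> \<eta>]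
      Q1[of \<xi> \<eta> \<eta> \<zeta>] Q1[of \<zeta> \<eta> \<eta> \<xi>] Q2[of \<xi> \<eta> \<eta> \<zeta>] Q2[of \<zeta> \<eta> \<eta> \<xi>]
      Q1[of \<eta> \<zeta> \<xi> \<eta>] Q1[of \<eta> \<xi> \<zeta> \<eta>] Q2[of \<zeta> \<xi> \<eta> \<eta>]
      Q2[of \<eta> \<zeta> \<xi> \<eta>] Q1[of \<xi> \<eta> \<zeta> \<eta>] by linarith
  then show ?thesis by (simp add: Q_def)
qed

end

section \<open>Comparing the signs of two quadratic forms\<close>

text \<open>First-order condition: a quadratic polynomial that vanishes at 0 and is nowhere negative
  has no linear term.\<close>

lemma quadratic_nonneg_imp_zero:
  fixes \<beta> c :: real
  assumes "\<And>t. 0 \<le> 2 * t * \<beta> + t\<^sup>2 * c"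
  shows "\<beta> = 0"
proof (rule ccontr)
  assume "\<beta> \<noteq> 0"
  \<comment> \<open>Any positive number above \<open>c / 2\<close> works: at
    \<open>- \<beta> / C\<close> the polynomial has the sign of \<open>c - 2 * C\<close>.\<close>
  define C where "C = \<bar>c\<bar> + 1"
  have C: "C > 0" "c < 2 * C" by (auto simp: C_def)
  have "2 * (- \<beta> / C) * \<beta> + (- \<beta> / C)\<^sup>2 * c = \<beta>\<^sup>2 * (c - 2 * C) / C\<^sup>2"
    using C by (simp add: field_simps power2_eq_square)
  also have "\<dots> < 0" using C \<open>\<beta> \<noteq> 0\<close> by (intro divide_neg_pos mult_pos_neg) auto
  finally show False using assms[of "- \<beta> / C"] by simp
qed

text \<open>An inner product unrelated to the standard one of \<open>'a\<close>. It is interpreted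
  for the parallel and for the given metric, so that both live on one coordinate space.\<close>

locale inner_form =
  fixes G :: "'a::euclidean_space \<Rightarrow> 'a \<Rightarrow> real"
  assumes linear_left: "linear (\<lambda>x. G x y)" and sym: "G x y = G y x" and pos: "x \<noteq> 0 \<Longrightarrow> 0 < G x x"
begin

lemma linear_right: "linear (G x)"
proof -
  have "G x = (\<lambda>z. G z x)" by (rule ext) (rule sym)
  then show ?thesis using linear_left[of x] by simp
qed

lemmas simps = linear_add[OF linear_left] linear_add[OF linear_right] linear_diff[OF linear_left] linear_diff[OF linear_right]
  linear_cmul[OF linear_left] linear_cmul[OF linear_right] linear_neg[OF linear_left] linear_neg[OF linear_right]
  linear_0[OF linear_left] linear_0[OF linear_right]

lemma bounded_bilinear: "bounded_bilinear G"
  unfolding bilinear_conv_bounded_bilinear[symmetric] bilinear_def using linear_left linear_right by blast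

definition perp :: "'a \<Rightarrow> 'a \<Rightarrow> 'a" where
  "perp y x = x - (G x y / G y y) *\<^sub>R y"

lemma perp_orthogonal: "y \<noteq> 0 \<Longrightarrow> G (perp y x) y = 0"
  using pos[of y] by (simp add: perp_def simps)

text \<open>Shows that the denominator of the sectional curvature is positive.\<close>

lemma gram_determinant:
  assumes "y \<noteq> 0" shows "G x x * G y y - (G x y)\<^sup>2 = G y y * G (perp y x) (perp y x)"
  using pos[OF assms] sym[of x y] by (simp add: perp_def simps field_simps power2_eq_square)

text \<open>A minimiser of the Rayleigh quotient on the orthogonal complement of \<open>y\<close> is an eigenvector.\<close>

lemma minimal_eigenvector:
  assumes K: "linear K" "K y = 0" "\<And>u v. G (K u) v = G (K v) u"
    and w: "w \<noteq> 0" "G w y = 0"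
  obtains x l where "x \<noteq> 0" "G x y = 0" "K x = l *\<^sub>R x" "\<And>v. G v y = 0 \<Longrightarrow> l * G v v \<le> G (K v) v"
proof -
  define Z where "Z = {v. norm v = 1} \<inter> {v. G v y = 0}"
  define q where "q = (\<lambda>v. G (K v) v / G v v)"
  have G_cont: "continuous_on X (\<lambda>v. G (f v) (h v))" if "continuous_on X f" "continuous_on X h" for X f h
    using bounded_bilinear.continuous_on[OF bounded_bilinear that] .
  have "closed {v. G v y = 0}"
    by (intro closed_Collect_eq G_cont continuous_intros)
  moreover have "compact {v::'a. norm v = 1}" using compact_sphere[of "0::'a" 1] by (simp add: sphere_def dist_norm)
  ultimately have "compact Z" unfolding Z_def by (rule compact_Int_closed[rotated])
  moreover have "(1 / norm w) *\<^sub>R w \<in> Z" using w by (simp add: Z_def simps)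
  moreover have "G v v \<noteq> 0" if "v \<in> Z" for v
  proof -
    have "v \<noteq> 0" using that by (auto simp: Z_def)
    then show ?thesis using pos[of v] by simp
  qed
  then have "continuous_on Z q"
    unfolding q_def
    by (intro continuous_on_divide G_cont continuous_on_id linear_continuous_on K(1)[unfolded linear_conv_bounded_linear] ballI)
  ultimately obtain x where x: "x \<in> Z" "\<And>v. v \<in> Z \<Longrightarrow> q x \<le> q v"
    using continuous_attains_inf[of Z q] by blast
  define l where "l = q x"
  have x0: "x \<noteq> 0" "G x y = 0" using x(1) by (auto simp: Z_def)
  have min: "l * G v v \<le> G (K v) v" if v: "G v y = 0" for v
  proof (cases "v = 0")
    case False
    have "(1 / norm v) *\<^sub>R v \<in> Z" using False v by (simp add: Z_def simps)
    from x(2)[OF this] have "l \<le> G (K v) v / G v v"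
      using False by (simp add: l_def q_def simps linear_cmul[OF K(1)])
    then show ?thesis using pos[OF False] by (simp add: field_simps)
  qed (simp add: simps linear_0[OF K(1)])
  define u where "u = K x - l *\<^sub>R x"
  have Qx: "G (K x) x = l * G x x" using pos[OF x0(1)] by (simp add: l_def q_def)
  \<comment> \<open>First variation at the minimiser in directions of the complement;
    self-adjointness merges the two mixed terms.\<close>
  have orth: "G u z = 0" if z: "G z y = 0" for z
  proof (rule quadratic_nonneg_imp_zero)
    fix t
    have "l * G (x + t *\<^sub>R z) (x + t *\<^sub>R z) \<le> G (K (x + t *\<^sub>R z)) (x + t *\<^sub>R z)"
      by (rule min) (simp add: simps x0 z)
    then show "0 \<le> 2 * t * G u z + t\<^sup>2 * (G (K z) z - l * G z z)"
      using Qx K(3)[of z x] sym[of z x]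
      by (simp add: simps linear_add[OF K(1)] linear_cmul[OF K(1)] u_def algebra_simps power2_eq_square)
  qed
  \<comment> \<open>Self-adjointness and \<open>K y = 0\<close> keep the range of \<open>K\<close>
    in the complement, so \<open>u\<close> lies there too and is orthogonal to itself.\<close>
  have "G u y = 0" using K(3)[of x y] by (simp add: u_def simps x0 K(2))
  then have "u = 0" using orth[of u] pos[of u] by fastforce
  then have "K x = l *\<^sub>R x" by (simp add: u_def)
  then show ?thesis using that x0 min by blast
qed

lemma sign_transfer_nonneg:
  assumes g: "inner_form g" and y: "y \<noteq> 0"
    and K: "linear K" "K y = 0" "\<And>u v. G (K u) v = G (K v) u"
    and P: "P \<in> {\<lambda>r::real. r > 0, \<lambda>r. r \<ge> 0}"
    and hyp: "\<And>v. v \<noteq> 0 \<Longrightarrow> g v y = 0 \<Longrightarrow> P (g (K v) v)"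
    and x: "perp y x \<noteq> 0"
  shows "P (G (K x) x)"
proof -
  interpret g: inner_form g by (rule g)
  let ?w = "perp y x"
  note w = perp_orthogonal[OF y, of x]
  obtain z l where z: "z \<noteq> 0" "G z y = 0" "K z = l *\<^sub>R z" and min: "\<And>v. G v y = 0 \<Longrightarrow> l * G v v \<le> G (K v) v"
    using minimal_eigenvector[OF K x w] by blast
  let ?z = "g.perp y z"
  have "?z \<noteq> 0"
  proof
    assume "?z = 0"
    then have e: "z = (g z y / g y y) *\<^sub>R y" by (simp add: g.perp_def)
    from arg_cong[OF e, of "\<lambda>v. G v y"] z(2) have "(g z y / g y y) * G y y = 0" by (simp add: simps)
    then have "g z y / g y y = 0" using pos[OF y] by simp
    then have "z = 0 *\<^sub>R y" using e by (simp only:)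
    then show False using z(1) by simp
  qed
  note zo = g.perp_orthogonal[OF y, of z]
  have Kz: "K ?z = l *\<^sub>R z" by (simp add: g.perp_def linear_diff[OF K(1)] linear_cmul[OF K(1)] K(2) z(3))
  \<comment> \<open>\<open>z\<close> and \<open>?z\<close> differ by a multiple of \<open>y\<close>,
    to which \<open>?z\<close> is \<open>g\<close>-orthogonal.\<close>
  have "g z ?z = g ?z ?z" using zo g.sym[of y ?z] by (simp add: g.perp_def[of y z] g.simps)
  then have "P (l * g ?z ?z)" using hyp[OF \<open>?z \<noteq> 0\<close> zo] by (simp add: Kz g.simps)
  then have l: "P l" using P g.pos[OF \<open>?z \<noteq> 0\<close>] by (auto simp: zero_less_mult_iff zero_le_mult_iff)
  \<comment> \<open>The component of \<open>x\<close> along \<open>y\<close> does not affect the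
    quadratic form: \<open>K\<close> kills it, and its range is orthogonal to
    \<open>y\<close>.\<close>
  have "K x = K ?w" by (simp add: perp_def linear_diff[OF K(1)] linear_cmul[OF K(1)] K(2))
  moreover have "G (K ?w) x = G (K ?w) ?w"
    using K(3)[of ?w y] by (simp add: perp_def[of y x] simps K(2))
  ultimately have "l * G ?w ?w \<le> G (K x) x" using min[OF w] by simp
  moreover have "P (l * G ?w ?w)" using l P pos[OF x] by auto
  ultimately show ?thesis using P by auto
qed

text \<open>The negative signs follow by passing to the negative of \<open>K\<close>, whose smallest
  eigenvalue on the complement is minus the largest one of \<open>K\<close>.\<close>

lemma sign_transfer:
  assumes g: "inner_form g" and y: "y \<noteq> 0"
    and K: "linear K" "K y = 0" "\<And>u v. G (K u) v = G (K v) u"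
    and P: "P \<in> {\<lambda>r::real. r > 0, \<lambda>r. r \<ge> 0, \<lambda>r. r < 0, \<lambda>r. r \<le> 0}"
    and hyp: "\<And>v. v \<noteq> 0 \<Longrightarrow> g v y = 0 \<Longrightarrow> P (g (K v) v)"
    and x: "perp y x \<noteq> 0"
  shows "P (G (K x) x)"
proof (cases "P \<in> {\<lambda>r. r > 0, \<lambda>r. r \<ge> 0}")
  case True
  show ?thesis by (rule sign_transfer_nonneg[OF g y K True hyp x])
next
  case False
  interpret g: inner_form g by (rule g)
  let ?P = "\<lambda>r. P (- r)"
  have P': "?P \<in> {\<lambda>r. r > 0, \<lambda>r. r \<ge> 0}" 
  proof -
    have "P = (\<lambda>r. r < 0) \<or> P = (\<lambda>r. r \<le> 0)" using P False by blast
    then show ?thesis by (elim disjE) simp_all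
  qed
  have "?P (G (- K x) x)"
  proof (rule sign_transfer_nonneg[OF g y linear_compose_neg[OF K(1)] _ _ P' _ x])
    show "- K y = 0" by (simp add: K(2))
    show "G (- K u) v = G (- K v) u" for u v using K(3)[of u v] by (simp add: simps)
    show "P (- g (- K v) v)" if "v \<noteq> 0" "g v y = 0" for v using hyp[OF that] by (simp add: g.simps)
  qed
  then show ?thesis by (simp add: simps)
qed

end

section \<open>Curvature of the parallel metric\<close>

context parallel_metric
begin

text \<open>The fields in \<open>curv_at\<close> have constant components in the very chart
  \<open>c\<close>, so the bracket term drops out and \<open>D_in_chart\<close> turns the iterated
  derivatives into the coordinate formula.\<close>

lemma
  fixes p
  defines "c \<equiv> chart_at A p"
  assumes tf: "torsion_free A D"
  shows curv_at_tangent: "curv_at A D p u v w \<in> tangent_space A p"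
    and curv_at_in_chart: "curv_at A D p u v w c = parallel_form.R (christoffel c) (cmap c p) (u c) (v c) (w c)"
proof -
  have c: "c \<in> A" "p \<in> cdom c" unfolding c_def by (rule chart_at)+
  interpret pf: parallel_form "cmap c ` cdom c" "christoffel c" "gc c" by (rule gc_parallel_form[OF c(1)])
  have x: "cmap c p \<in> cmap c ` cdom c" using c by simp
  note U = chart_domain_open[OF c(1)]
  note sm = coord_field_smooth[OF c(1) U order_refl]
  have t: "coord_field A c \<zeta> p \<in> tangent_space A p" for \<zeta>
    unfolding coord_field_def by (rule coord_vec_tangent[OF c])
  let ?W = "\<lambda>\<eta> \<zeta> q. D q (coord_field A c \<eta> q) (coord_field A c \<zeta>)"
  have W: "smooth_vfield A (cdom c) (?W \<eta> \<zeta>)" for \<eta> \<zeta> by (rule D_smooth[OF U sm sm])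
  have Wc: "(\<lambda>y. ?W \<eta> \<zeta> (cinv c y) c) = (\<lambda>y. christoffel c y \<eta> \<zeta>)" for \<eta> \<zeta>
    by (simp add: christoffel_def coord_field_def)
  have D: "D p (coord_field A c \<xi> p) (?W \<eta> \<zeta>) c =
      pf.d\<Gamma> (cmap c p) \<xi> \<eta> \<zeta> + christoffel c (cmap c p) \<xi> (christoffel c (cmap c p) \<eta> \<zeta>)" for \<xi> \<eta> \<zeta>
  proof -
    have "((\<lambda>y. ?W \<eta> \<zeta> (cinv c y) c) has_derivative (\<lambda>\<xi>. pf.d\<Gamma> (cmap c p) \<xi> \<eta> \<zeta>)) (at (cmap c p))"
      unfolding Wc by (rule pf.\<Gamma>_has_derivative[OF x])
    from D_in_chart[OF U W c(2) c t this] show ?thesis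
      using c by (simp add: christoffel_eq[OF c t])
  qed
  have lb: "D p (lie_bracket A (coord_field A c \<xi>) (coord_field A c \<eta>) p) (coord_field A c \<zeta>) = tzero" for \<xi> \<eta> \<zeta>
  proof -
    have "D p (tscale 0 tzero) (coord_field A c \<zeta>) = tscale 0 (D p tzero (coord_field A c \<zeta>))"
      by (rule D_scale_dir[OF U sm c(2) tzero_tangent])
    then show ?thesis unfolding lie_bracket_coord_field[OF tf c] by (simp add: tscale_def tzero_def)
  qed
  have eq: "curv_at A D p u v w = tdiff (tdiff (D p (coord_field A c (u c) p) (?W (v c) (w c)))
      (D p (coord_field A c (v c) p) (?W (u c) (w c)))) tzero"
    by (simp only: curv_at_def Let_def curvature_def c_def[symmetric] lb)
  show "curv_at A D p u v w \<in> tangent_space A p"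
    unfolding eq by (intro tangent_space_closed tzero_tangent D_tangent[OF U W c(2) t])
  show "curv_at A D p u v w c = parallel_form.R (christoffel c) (cmap c p) (u c) (v c) (w c)"
    unfolding eq tvec_apply D pf.R_def by simp
qed

lemma metric_inner_form:
  assumes "riemannian_metric A g" and c: "c \<in> A" "p \<in> cdom c"
  shows "inner_form (\<lambda>\<xi> \<eta>. g p (coord_vec A c p \<xi>) (coord_vec A c p \<eta>))"
proof -
  note cv = coord_vec_tangent[OF c]
  note g = assms(1)[unfolded riemannian_metric_def, THEN conjunct1, THEN spec, of p, THEN bspec, THEN bspec, THEN bspec, THEN spec, OF cv cv cv]
  show ?thesis
  proof (rule inner_form.intro)
    show "linear (\<lambda>\<xi>. g p (coord_vec A c p \<xi>) (coord_vec A c p \<eta>))" for \<eta>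
      by (rule linearI) (use g in \<open>simp_all add: coord_vec_linear[OF c]\<close>)
    show "g p (coord_vec A c p \<xi>) (coord_vec A c p \<eta>) = g p (coord_vec A c p \<eta>) (coord_vec A c p \<xi>)" for \<xi> \<eta>
      using g by blast
    show "0 < g p (coord_vec A c p \<xi>) (coord_vec A c p \<xi>)" if "\<xi> \<noteq> 0" for \<xi>
    proof -
      have "coord_vec A c p \<xi> c \<noteq> tzero c" using that c by simp
      then have "coord_vec A c p \<xi> \<noteq> tzero" by metis
      then show ?thesis using g by blast
    qed
  qed
qed

text \<open>Independence of the pair makes \<open>v\<close> nonzero and leaves \<open>u\<close> a
  nonzero component orthogonal to \<open>v\<close>, so \<open>sign_transfer\<close> applies in
  coordinates to the curvature operator of \<open>v\<close>.\<close>

theorem sec_cond_transfer: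
  assumes tf: "torsion_free A D" and g: "riemannian_metric A g"
    and P: "P \<in> {\<lambda>r::real. r > 0, \<lambda>r. r \<ge> 0, \<lambda>r. r < 0, \<lambda>r. r \<le> 0}"
    and hyp: "\<And>p x y. orthonormal_pair A g p x y \<Longrightarrow> P (g p (curv_at A D p x y y) x)"
  shows "sec_cond P A G D"
  unfolding sec_cond_def
proof (intro allI impI)
  fix p u v assume "independent_pair A p u v"
  then have u: "u \<in> tangent_space A p" and v: "v \<in> tangent_space A p"
    and ind: "\<And>a b. tadd (tscale a u) (tscale b v) = tzero \<Longrightarrow> a = 0 \<and> b = 0"
    unfolding independent_pair_def by blast+
  \<comment> \<open>The four sign conditions ignore positive factors; this absorbs both the
    normalisation to orthonormal pairs and the denominator of the sectional curvature.\<close>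
  have P_scale: "P (k * r) \<longleftrightarrow> P r" if "k > 0" for k r
    using P that by (auto simp: zero_less_mult_iff zero_le_mult_iff mult_less_0_iff mult_le_0_iff)
  define c where "c = chart_at A p"
  have c: "c \<in> A" "p \<in> cdom c" unfolding c_def by (rule chart_at)+
  interpret pf: parallel_form "cmap c ` cdom c" "christoffel c" "gc c" by (rule gc_parallel_form[OF c(1)])
  define x where "x = cmap c p"
  have x: "x \<in> cmap c ` cdom c" using c by (simp add: x_def)
  have gc: "gc c x = (\<lambda>\<xi> \<eta>. G p (coord_vec A c p \<xi>) (coord_vec A c p \<eta>))"
    using c by (simp add: gc_def x_def fun_eq_iff)
  interpret I: inner_form "gc c x" unfolding gc by (rule metric_inner_form[OF riemannian_metric c])
  let ?g = "\<lambda>\<xi> \<eta>. g p (coord_vec A c p \<xi>) (coord_vec A c p \<eta>)"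
  interpret g: inner_form ?g by (rule metric_inner_form[OF g c])
  note R_eq = curv_at_in_chart[OF tf, of p, folded c_def, folded x_def]
  let ?y = "v c"
  let ?K = "\<lambda>\<xi>. pf.R x \<xi> ?y ?y"
  have y: "?y \<noteq> 0"
  proof
    assume "?y = 0"
    then have "tadd (tscale 0 u) (tscale 1 v) = tzero"
      by (intro tangent_eqI[OF _ tzero_tangent c] tangent_space_closed tangent_tscale u v) simp
    then show False using ind by force
  qed
  have w: "I.perp ?y (u c) \<noteq> 0"
  proof
    let ?s = "gc c x (u c) ?y / gc c x ?y ?y"
    assume "I.perp ?y (u c) = 0"
    then have "tadd (tscale 1 u) (tscale (- ?s) v) = tzero"
      by (intro tangent_eqI[OF _ tzero_tangent c] tangent_space_closed tangent_tscale u v) (simp add: I.perp_def)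
    then show False using ind by force
  qed
  have "P (gc c x (?K (u c)) (u c))"
  proof (rule I.sign_transfer[OF g.inner_form_axioms y _ _ _ P _ w])
    show "linear ?K" by (rule pf.R_linear(1)[OF x])
    show "?K ?y = 0" by (simp add: pf.R_def)
    show "gc c x (?K \<xi>) \<eta> = gc c x (?K \<eta>) \<xi>" for \<xi> \<eta>
      by (rule pf.R_pair_symmetric[OF x christoffel_symmetric[OF tf c(1)] I.sym])
    fix \<xi> assume \<xi>: "\<xi> \<noteq> 0" "?g \<xi> ?y = 0"
    define a where "a = 1 / sqrt (?g \<xi> \<xi>)"
    define b where "b = 1 / sqrt (?g ?y ?y)"
    have ab: "a > 0" "b > 0" "a * a * ?g \<xi> \<xi> = 1" "b * b * ?g ?y ?y = 1"
      using g.pos[OF \<xi>(1)] g.pos[OF y] by (simp_all add: a_def b_def)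
    let ?u = "coord_vec A c p (a *\<^sub>R \<xi>)" and ?v = "coord_vec A c p (b *\<^sub>R ?y)"
    have uv: "?u \<in> tangent_space A p" "?v \<in> tangent_space A p" by (rule coord_vec_tangent[OF c])+
    have gg: "?g (a *\<^sub>R \<xi>) (a *\<^sub>R \<xi>) = 1" "?g (b *\<^sub>R ?y) (b *\<^sub>R ?y) = 1" "?g (a *\<^sub>R \<xi>) (b *\<^sub>R ?y) = 0"
      unfolding g.simps using ab \<xi> by (simp_all add: mult.assoc)
    have "orthonormal_pair A g p ?u ?v"
      unfolding orthonormal_pair_def using uv gg by simp
    from hyp[OF this] have 1: "P (g p (curv_at A D p ?u ?v ?v) ?u)" .
    have "curv_at A D p ?u ?v ?v = coord_vec A c p (curv_at A D p ?u ?v ?v c)"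
      by (rule coord_vec_of_tangent[OF curv_at_tangent[OF tf] c, symmetric])
    \<comment> \<open>Trilinearity: one factor \<open>a\<close> from the first slot and
      \<open>b\<close> twice from the other two; pairing with \<open>?u\<close> adds the second
      \<open>a\<close>.\<close>
    also have "curv_at A D p ?u ?v ?v c = (a * (b * b)) *\<^sub>R ?K \<xi>"
      using c by (simp add: R_eq linear_cmul[OF pf.R_linear(1)[OF x]] linear_cmul[OF pf.R_linear(2)[OF x]]
          linear_cmul[OF pf.R_linear(3)[OF x]] mult_ac)
    finally have "g p (curv_at A D p ?u ?v ?v) ?u = (a * a * (b * b)) * ?g (?K \<xi>) \<xi>"
      using g.simps(5)[of "a * (b * b)" "?K \<xi>" "a *\<^sub>R \<xi>"] g.simps(6)[of "?K \<xi>" a \<xi>] by simp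
    then show "P (?g (?K \<xi>) \<xi>)" using 1 P_scale ab by simp
  qed
  moreover have "gc c x (?K (u c)) (u c) = G p (curv_at A D p u v v) u"
    using gc_eq[OF c curv_at_tangent[OF tf] u, of u v v] unfolding R_eq x_def[symmetric] .
  ultimately have num: "P (G p (curv_at A D p u v v) u)" by simp
  let ?d = "G p u u * G p v v - (G p u v)\<^sup>2"
  have "?d = gc c x ?y ?y * gc c x (I.perp ?y (u c)) (I.perp ?y (u c))"
    using I.gram_determinant[OF y, of "u c"] gc_eq[OF c u u] gc_eq[OF c u v] gc_eq[OF c v v] by (simp add: x_def)
  also have "\<dots> > 0" using I.pos[OF y] I.pos[OF w] by simp
  finally have "inverse ?d > 0" by (rule positive_imp_inverse_positive)
  from P_scale[OF this] num show "P (sectional_curvature A G D p u v)"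
    unfolding sectional_curvature_def divide_inverse by (simp only: mult.commute)
qed

end

theorem theorem2p15:
  fixes A :: "('m::{t2_space, second_countable_topology}, 'n::finite) chart set"
    and g :: "('m, 'n) metric"
    and nabla :: "('m, 'n) connection"
    and \<alpha> :: "('m, 'n) form"
    and p\<^sub>0 :: 'm
    and P :: "real \<Rightarrow> bool"
  assumes "smooth_atlas A"
    and "connected (UNIV :: 'm set)"
    and "riemannian_metric A g"
    and "levi_civita A g nabla"
    and "one_form A \<alpha>"
    and "compact_holonomy A (weighted_connection nabla \<alpha>) p\<^sub>0"
    and "P \<in> {\<lambda>r. r > 0, \<lambda>r. r \<ge> 0, \<lambda>r. r < 0, \<lambda>r. r \<le> 0}"
  shows "((\<forall>p x y. orthonormal_pair A g p x y \<longrightarrow>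
             P (g p (curv_at A (weighted_connection nabla \<alpha>) p x y y) x)) \<longrightarrow>
          (\<exists>g' nabla'. riemannian_metric A g' \<and> levi_civita A g' nabla' \<and> sec_cond P A g' nabla')) \<and>
         (ric_cond P A (weighted_connection nabla \<alpha>) \<longrightarrow>
          (\<exists>g' nabla'. riemannian_metric A g' \<and> levi_civita A g' nabla' \<and> ric_cond P A nabla'))"
proof -
  let ?D = "weighted_connection nabla \<alpha>"
  have aff: "affine_connection A ?D" and tf: "torsion_free A ?D"
    using assms(1,4,5) weighted_connection_affine weighted_connection_torsion_free
    unfolding levi_civita_def by blast+
  interpret manifold_connection A ?D by unfold_locales (rule assms(1) aff)+
  obtain G where "parallel_metric A ?D G"
    by (rule parallel_metric_exists[OF assms(2,6)])
  then interpret parallel_metric A ?D G .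
  have lc: "levi_civita A G ?D" using aff tf metric_compatible by (simp add: levi_civita_def)
  \<comment> \<open>The witness for \<open>nabla'\<close> is \<open>?D\<close> itself and
    \<open>ric_cond\<close> mentions only the connection, so in the Ricci part hypothesis and
    conclusion coincide.\<close>
  show ?thesis
  proof (intro conjI impI exI[of _ G] exI[of _ ?D] riemannian_metric lc)
    assume "\<forall>p x y. orthonormal_pair A g p x y \<longrightarrow> P (g p (curv_at A ?D p x y y) x)"
    then show "sec_cond P A G ?D" by (intro sec_cond_transfer[OF tf assms(3,7)]) blast
  qed
qed

end
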